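(* Let $\lambda^1,\lambda^2,\lambda^3$ be pairwise distinct constants and $H(u_1,u_2,u_3)$ a function with $H_{12},H_{13},H_{23}$ nowhere zero satisfying $$J=0,\quad H_{123}=0,\quad \partial_{u_1}\big((\lambda^3-\lambda^2)H_{11}+R_2+R_3\big)=0,\quad \partial_{u_2}\big((\lambda^1-\lambda^3)H_{22}+R_1+R_3\big)=0,\quad \partial_{u_3}\big((\lambda^2-\lambda^1)H_{33}+R_1+R_2\big)=0.$$ Then the system $(u_i)_T+\lambda^i(u_i)_X+(H_i)_Y=0$, $i=1,2,3$, possesses a dispersionless Lax pair.
   Context: Notation: $H_i,H_{ij},H_{ijk}$ partial derivatives w.r.t. $u_1,u_2,u_3$; $R_1=\frac{H_{12}H_{13}}{H_{23}}(\lambda^2-\lambda^3)$, $R_2=\frac{H_{12}H_{23}}{H_{13}}(\lambda^3-\lambda^1)$, $R_3=\frac{H_{13}H_{23}}{H_{12}}(\lambda^1-\lambda^2)$; $\Delta=(\lambda^2-\lambda^3)H_{11}+(\lambda^3-\lambda^1)H_{22}+(\lambda^1-\lambda^2)H_{33}$; $J=(\lambda^2-\lambda^3)H_{12}^2H_{13}^2+(\lambda^3-\lambda^1)H_{23}^2H_{12}^2+(\lambda^1-\lambda^2)H_{13}^2H_{23}^2-H_{12}H_{23}H_{13}\Delta$. Write the system as $\mathbf u_T+A\mathbf u_X+B\mathbf u_Y=0$ with $A=\mathrm{diag}(\lambda^i)$, $B=(H_{ij})$. A dispersionless Lax pair is a pair of equations $\psi_T=f(\mathbf u,\psi_Y)$,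 $\psi_X=g(\mathbf u,\psi_Y)$ (with $f,g$ depending in general nonlinearly on $p=\psi_Y$) such that the system is recovered from the compatibility condition $\psi_{XT}=\psi_{TX}$; equivalently $\mathrm{grad}_{\mathbf u}f+\mathrm{grad}_{\mathbf u}g\,A=0$ and $\mathrm{grad}_{\mathbf u}g\,[f_pI_3+g_pA+B]=0$, with $\mathrm{grad}_{\mathbf u}g\not\equiv0$. *)

theory Defs
  imports "HOL-Analysis.Analysis"
begin

definition dd :: "'a::real_normed_vector \<Rightarrow> ('a \<Rightarrow> real) \<Rightarrow> 'a \<Rightarrow> real" where
  "dd v F x = deriv (\<lambda>t. F (x + t *\<^sub>R v)) 0"

fun Ck :: "nat \<Rightarrow> 'a::euclidean_space set \<Rightarrow> ('a \<Rightarrow> real) \<Rightarrow> bool" where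
  "Ck 0 U F = continuous_on U F"
| "Ck (Suc k) U F = (continuous_on U F \<and>
     (\<forall>x\<in>U. \<forall>v\<in>Basis. ((\<lambda>t. F (x + t *\<^sub>R v)) has_real_derivative dd v F x) (at 0)) \<and>
     (\<forall>v\<in>Basis. Ck k U (dd v F)))"

definition smooth_on :: "'a::euclidean_space set \<Rightarrow> ('a \<Rightarrow> real) \<Rightarrow> bool" where
  "smooth_on U F \<longleftrightarrow> (\<forall>k. Ck k U F)"

definition e :: "3 \<Rightarrow> real^3" where "e i = axis i 1"

definition Hd :: "(real^3 \<Rightarrow> real) \<Rightarrow> 3 \<Rightarrow> real^3 \<Rightarrow> real" where
  "Hd H i = dd (e i) H"
definition Hdd :: "(real^3 \<Rightarrow> real) \<Rightarrow> 3 \<Rightarrow> 3 \<Rightarrow> real^3 \<Rightarrow> real" where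
  "Hdd H i j = dd (e j) (dd (e i) H)"
definition Hddd :: "(real^3 \<Rightarrow> real) \<Rightarrow> 3 \<Rightarrow> 3 \<Rightarrow> 3 \<Rightarrow> real^3 \<Rightarrow> real" where
  "Hddd H i j k = dd (e k) (dd (e j) (dd (e i) H))"

definition R1 :: "real^3 \<Rightarrow> (real^3 \<Rightarrow> real) \<Rightarrow> real^3 \<Rightarrow> real" where
  "R1 lam H u = Hdd H 1 2 u * Hdd H 1 3 u / Hdd H 2 3 u * (lam$2 - lam$3)"
definition R2 :: "real^3 \<Rightarrow> (real^3 \<Rightarrow> real) \<Rightarrow> real^3 \<Rightarrow> real" where
  "R2 lam H u = Hdd H 1 2 u * Hdd H 2 3 u / Hdd H 1 3 u * (lam$3 - lam$1)"
definition R3 :: "real^3 \<Rightarrow> (real^3 \<Rightarrow> real) \<Rightarrow> real^3 \<Rightarrow> real" where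
  "R3 lam H u = Hdd H 1 3 u * Hdd H 2 3 u / Hdd H 1 2 u * (lam$1 - lam$2)"

definition Delta :: "real^3 \<Rightarrow> (real^3 \<Rightarrow> real) \<Rightarrow> real^3 \<Rightarrow> real" where
  "Delta lam H u = (lam$2 - lam$3) * Hdd H 1 1 u + (lam$3 - lam$1) * Hdd H 2 2 u
                 + (lam$1 - lam$2) * Hdd H 3 3 u"

definition JJ :: "real^3 \<Rightarrow> (real^3 \<Rightarrow> real) \<Rightarrow> real^3 \<Rightarrow> real" where
  "JJ lam H u = (lam$2 - lam$3) * (Hdd H 1 2 u)\<^sup>2 * (Hdd H 1 3 u)\<^sup>2
              + (lam$3 - lam$1) * (Hdd H 2 3 u)\<^sup>2 * (Hdd H 1 2 u)\<^sup>2
              + (lam$1 - lam$2) * (Hdd H 1 3 u)\<^sup>2 * (Hdd H 2 3 u)\<^sup>2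
              - Hdd H 1 2 u * Hdd H 2 3 u * Hdd H 1 3 u * Delta lam H u"

text \<open>f, g are functions of (u,p) with p = psi_Y. Partial derivatives:
  w.r.t. u_i in direction (e i, 0), w.r.t. p in direction (0,1).\<close>
definition du :: "3 \<Rightarrow> ((real^3) \<times> real \<Rightarrow> real) \<Rightarrow> (real^3) \<times> real \<Rightarrow> real" where
  "du i F = dd (e i, 0) F"
definition dp :: "((real^3) \<times> real \<Rightarrow> real) \<Rightarrow> (real^3) \<times> real \<Rightarrow> real" where
  "dp F = dd (0, 1) F"

text \<open>psi_T = f(u,psi_Y), psi_X = g(u,psi_Y) is a dispersionless Lax pair of
  u_T + A u_X + B u_Y = 0 with A = diag(lam), B = (H_ij) on the open set W of
  (u,p)-space: grad_u f + grad_u g A = 0 and grad_u g [f_p I + g_p A + B] = 0 on W,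
  and grad_u g is not identically zero on W.\<close>
definition is_disp_lax_pair ::
  "real^3 \<Rightarrow> (real^3 \<Rightarrow> real) \<Rightarrow> ((real^3) \<times> real) set \<Rightarrow>
   ((real^3) \<times> real \<Rightarrow> real) \<Rightarrow> ((real^3) \<times> real \<Rightarrow> real) \<Rightarrow> bool" where
  "is_disp_lax_pair lam H W f g \<longleftrightarrow>
     open W \<and> W \<noteq> {} \<and> smooth_on W f \<and> smooth_on W g \<and>
     (\<forall>w\<in>W. \<forall>i. du i f w + du i g w * lam$i = 0) \<and>
     (\<forall>w\<in>W. \<forall>j. du j g w * (dp f w + dp g w * lam$j)
                 + (\<Sum>i\<in>UNIV. du i g w * Hdd H i j (fst w)) = 0) \<and>
     (\<exists>w\<in>W. \<exists>i. du i g w \<noteq> 0)"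

end

theory Submission
  imports Defs
begin

text \<open>
Write \<open>x, y, z\<close> for \<open>H\<^sub>1\<^sub>2, H\<^sub>1\<^sub>3, H\<^sub>2\<^sub>3\<close>, and \<open>\<mu>\<^sub>1 = \<lambda>\<^sup>2 - \<lambda>\<^sup>3\<close> with its cyclic permutations.
The compatibility of \<open>grad f + grad g A = 0\<close> forces \<open>g = \<Sum> G\<^sub>l(u\<^sub>l, p)\<close> and \<open>f = - \<Sum> \<lambda>\<^sup>l G\<^sub>l(u\<^sub>l, p)\<close> up to
functions of \<open>p\<close>. Eliminating the \<open>p\<close>-derivatives, \<open>a\<^sub>l = \<partial>\<^sub>l G\<^sub>l\<close> must lie on a plane cubic which, because
\<open>J = 0\<close>, contains the conic \<open>\<mu>\<^sub>1 / (z a\<^sub>1) + \<mu>\<^sub>2 / (y a\<^sub>2) + \<mu>\<^sub>3 / (x a\<^sub>3) = 0\<close>. The differential conditions imply that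
\<open>\<partial>\<^sub>i \<partial>\<^sub>j\<close> annihilates \<open>H\<^sub>i\<^sub>k H\<^sub>j\<^sub>k / H\<^sub>i\<^sub>j\<close>, so that on the conic \<open>1 / a\<^sub>l\<close> is a linear expression \<open>det (w(p), w\<^sub>l(u\<^sub>l))\<close>,
where \<open>w\<^sub>1, w\<^sub>2, w\<^sub>3\<close> and \<open>w\<close> move in the plane along the Hamiltonian flow of one and the same binary cubic form.

If some \<open>w\<^sub>j\<close> is not confined to a line through the origin, one may take \<open>w(p) = w\<^sub>j(p)\<close>: then \<open>a\<^sub>i\<close> and \<open>a\<^sub>k\<close> are
multiples of \<open>H\<^sub>i\<^sub>j\<close> and \<open>H\<^sub>j\<^sub>k\<close> with \<open>u\<^sub>j\<close> replaced by \<open>p\<close>, and \<open>a\<^sub>j\<close> follows from the conic. Otherwise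
\<open>H\<^sub>i\<^sub>j\<close> is, up to a sign, the product of affine functions of \<open>u\<^sub>i\<close> and \<open>u\<^sub>j\<close>, the cubic form is a multiple of the product of three linear forms,
and \<open>w\<close> is obtained by integrating its flow by a quadrature.
\<close>

subsection \<open>Directional derivatives\<close>

text \<open>\<open>dd\<close> rests on \<open>deriv\<close>, which has a value even where no
  derivative exists. \<open>hasdd\<close> is the relational form that also asserts differentiability
  along the line, so that derivative rules can be chained.\<close>

definition hasdd :: "('a::real_normed_vector \<Rightarrow> real) \<Rightarrow> 'a \<Rightarrow> 'a \<Rightarrow> real \<Rightarrow> bool" where
  "hasdd F v x D \<longleftrightarrow> ((\<lambda>t. F (x + t *\<^sub>R v)) has_real_derivative D) (at 0)"

lemma hasdd_imp_dd: "hasdd F v x D \<Longrightarrow> dd v F x = D"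
  unfolding hasdd_def dd_def by (rule DERIV_imp_deriv)

lemma hasdd_unique: "hasdd F v x D \<Longrightarrow> hasdd F v x D' \<Longrightarrow> D = D'"
  unfolding hasdd_def by (rule DERIV_unique)

lemma hasdd_eq_rhs: "hasdd F v x D \<Longrightarrow> D = D' \<Longrightarrow> hasdd F v x D'"
  by simp

lemma hasdd_const: "hasdd (\<lambda>_. c) v x 0"
  by (simp add: hasdd_def)

lemma hasdd_add: "hasdd F v x D \<Longrightarrow> hasdd G v x E \<Longrightarrow> hasdd (\<lambda>y. F y + G y) v x (D + E)"
  unfolding hasdd_def by (auto intro!: derivative_eq_intros)

lemma hasdd_diff: "hasdd F v x D \<Longrightarrow> hasdd G v x E \<Longrightarrow> hasdd (\<lambda>y. F y - G y) v x (D - E)"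
  unfolding hasdd_def by (auto intro!: derivative_eq_intros)

lemma hasdd_minus: "hasdd F v x D \<Longrightarrow> hasdd (\<lambda>y. - F y) v x (- D)"
  unfolding hasdd_def by (auto intro!: derivative_eq_intros)

lemma hasdd_mult:
  "hasdd F v x D \<Longrightarrow> hasdd G v x E \<Longrightarrow> hasdd (\<lambda>y. F y * G y) v x (D * G x + F x * E)"
  unfolding hasdd_def by (auto intro!: derivative_eq_intros)

lemma hasdd_power2:
  "hasdd F v x D \<Longrightarrow> hasdd (\<lambda>y. (F y)\<^sup>2) v x (2 * F x * D)"
  unfolding hasdd_def by (auto intro!: derivative_eq_intros)

lemma hasdd_divide:
  "hasdd F v x D \<Longrightarrow> hasdd G v x E \<Longrightarrow> G x \<noteq> 0 \<Longrightarrow>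
    hasdd (\<lambda>y. F y / G y) v x ((D * G x - F x * E) / (G x * G x))"
  unfolding hasdd_def by (auto intro!: derivative_eq_intros)

text \<open>\<open>L\<close> carries the line through \<open>x\<close> in direction \<open>v\<close>
  to the line through \<open>L x\<close> in direction \<open>L' v\<close>, so both sides concern the
  same function of one real variable.\<close>

lemma hasdd_compose_affine:
  assumes "hasdd F (L' v) (L x) D" "\<And>t. L (x + t *\<^sub>R v) = L x + t *\<^sub>R L' v"
  shows "hasdd (\<lambda>y. F (L y)) v x D"
  using assms by (simp add: hasdd_def)

lemma hasdd_zero_dir: "hasdd F 0 x 0"
  by (simp add: hasdd_def)

lemmas hasdd_intros = hasdd_const hasdd_add hasdd_diff hasdd_minus hasdd_mult hasdd_power2 hasdd_divide

lemma DERIV_line: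
  assumes "hasdd F v (x + t *\<^sub>R v) D"
  shows "((\<lambda>s. F (x + s *\<^sub>R v)) has_real_derivative D) (at t)"
proof -
  have "(\<lambda>s. F (x + t *\<^sub>R v + s *\<^sub>R v)) = (\<lambda>s. F (x + (s + t) *\<^sub>R v))"
    by (simp add: algebra_simps)
  then show ?thesis
    using assms DERIV_shift[of "\<lambda>s. F (x + s *\<^sub>R v)" D 0 t] by (simp add: hasdd_def)
qed

lemma eventually_line_in_open:
  fixes x :: "'a::real_normed_vector"
  assumes "open U" "x \<in> U"
  shows "eventually (\<lambda>t. x + t *\<^sub>R v \<in> U) (nhds 0)"
proof -
  have "continuous_on UNIV (\<lambda>t. x + t *\<^sub>R v)"
    by (intro continuous_intros)
  then have "open ((\<lambda>t. x + t *\<^sub>R v) -` U)"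
    using assms(1) by (simp add: continuous_on_open_vimage)
  then show ?thesis
    unfolding eventually_nhds using assms(2) by (intro exI[of _ "(\<lambda>t. x + t *\<^sub>R v) -` U"]) auto
qed

lemma hasdd_cong:
  assumes "open U" "x \<in> U" "\<And>y. y \<in> U \<Longrightarrow> F y = G y"
  shows "hasdd F v x D \<longleftrightarrow> hasdd G v x D"
  unfolding hasdd_def
proof (rule DERIV_cong_ev)
  show "\<forall>\<^sub>F t in nhds 0. F (x + t *\<^sub>R v) = G (x + t *\<^sub>R v)"
    by (rule eventually_mono[OF eventually_line_in_open[OF assms(1,2)]]) (rule assms(3))
qed simp_all

lemma dd_cong:
  assumes "open U" "x \<in> U" "\<And>y. y \<in> U \<Longrightarrow> F y = G y"
  shows "dd v F x = dd v G x"
  unfolding dd_def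
proof (rule deriv_cong_ev)
  show "\<forall>\<^sub>F t in nhds 0. F (x + t *\<^sub>R v) = G (x + t *\<^sub>R v)"
    by (rule eventually_mono[OF eventually_line_in_open[OF assms(1,2)]]) (rule assms(3))
qed simp_all

subsection \<open>Smooth functions\<close>

lemma Ck_cong:
  assumes "open U" "\<And>y. y \<in> U \<Longrightarrow> F y = G y"
  shows "Ck k U F \<longleftrightarrow> Ck k U G"
  using assms(2)
proof (induction k arbitrary: F G)
  case 0
  then show ?case by (simp cong: continuous_on_cong)
next
  case (Suc k)
  have c: "continuous_on U F = continuous_on U G"
    using Suc.prems by (intro continuous_on_cong) auto
  have d: "dd v F x = dd v G x" if "x \<in> U" for v x
    using dd_cong[OF assms(1) that] Suc.prems by blast
  have h: "hasdd F v x D = hasdd G v x D" if "x \<in> U" for v x D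
    using hasdd_cong[OF assms(1) that] Suc.prems by blast
  have "Ck k U (dd v F) = Ck k U (dd v G)" for v
    using d by (rule Suc.IH)
  then show ?case
    using c d h by (simp add: hasdd_def)
qed

lemma Ck_subset: "Ck k U F \<Longrightarrow> V \<subseteq> U \<Longrightarrow> Ck k V F"
  by (induction k arbitrary: F) (auto intro: continuous_on_subset)

lemma Ck_Suc_imp: "Ck (Suc k) U F \<Longrightarrow> Ck k U F"
  by (induction k arbitrary: F) auto

text \<open>The partials may be given by formulas \<open>D v\<close>: these agree with
  \<open>dd v F\<close> on the open set \<open>U\<close>, and \<open>Ck\<close> depends only on
  values there.\<close>

lemma Ck_SucI:
  assumes "open U" "continuous_on U F"
    and "\<And>v x. v \<in> Basis \<Longrightarrow> x \<in> U \<Longrightarrow> hasdd F v x (D v x)"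
    and "\<And>v. v \<in> Basis \<Longrightarrow> Ck k U (D v)"
  shows "Ck (Suc k) U F"
proof -
  have e: "dd v F x = D v x" if "v \<in> Basis" "x \<in> U" for v x
    using assms(3)[OF that] by (rule hasdd_imp_dd)
  then have "Ck k U (dd v F)" if "v \<in> Basis" for v
    using assms(4)[OF that] Ck_cong[OF assms(1), of "dd v F" "D v"] that by blast
  then show ?thesis
    using assms(2,3) e by (simp add: hasdd_def)
qed

lemma Ck_SucD:
  assumes "Ck (Suc k) U F"
  shows "continuous_on U F" "\<And>v x. v \<in> Basis \<Longrightarrow> x \<in> U \<Longrightarrow> hasdd F v x (dd v F x)"
    "\<And>v. v \<in> Basis \<Longrightarrow> Ck k U (dd v F)"
  using assms by (auto simp: hasdd_def)

lemma Ck_continuous_on: "Ck k U F \<Longrightarrow> continuous_on U F"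
  by (cases k) auto

lemma Ck_const: "open U \<Longrightarrow> Ck k U (\<lambda>_. c)"
proof (induction k arbitrary: c)
  case (Suc k)
  show ?case
    by (rule Ck_SucI[where D="\<lambda>_ _. 0"]) (use Suc in \<open>auto intro: hasdd_const\<close>)
qed simp

lemma Ck_add: "open U \<Longrightarrow> Ck k U F \<Longrightarrow> Ck k U G \<Longrightarrow> Ck k U (\<lambda>y. F y + G y)"
proof (induction k arbitrary: F G)
  case 0
  then show ?case by (simp add: continuous_on_add)
next
  case (Suc k)
  show ?case
  proof (rule Ck_SucI[where D="\<lambda>v y. dd v F y + dd v G y"])
    show "continuous_on U (\<lambda>y. F y + G y)"
      using Suc.prems Ck_continuous_on by (blast intro: continuous_on_add)
  qed (auto intro!: hasdd_add Suc.IH simp: Suc.prems Ck_SucD(2,3)[OF Suc.prems(2)] Ck_SucD(2,3)[OF Suc.prems(3)])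
qed

lemma Ck_mult: "open U \<Longrightarrow> Ck k U F \<Longrightarrow> Ck k U G \<Longrightarrow> Ck k U (\<lambda>y. F y * G y)"
proof (induction k arbitrary: F G)
  case 0
  then show ?case by (simp add: continuous_on_mult)
next
  case (Suc k)
  show ?case
  proof (rule Ck_SucI[where D="\<lambda>v y. dd v F y * G y + F y * dd v G y"])
    show "continuous_on U (\<lambda>y. F y * G y)"
      using Suc.prems Ck_continuous_on by (blast intro: continuous_on_mult)
  next
    fix v :: 'a assume v: "v \<in> Basis"
    show "Ck k U (\<lambda>y. dd v F y * G y + F y * dd v G y)"
      using Suc.prems v by (intro Ck_add Suc.IH Ck_Suc_imp[of k U F] Ck_Suc_imp[of k U G] Ck_SucD(3))
  qed (auto intro!: hasdd_mult simp: Suc.prems Ck_SucD(2)[OF Suc.prems(2)] Ck_SucD(2)[OF Suc.prems(3)])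
qed

lemma Ck_inverse:
  assumes "open U" "\<And>y. y \<in> U \<Longrightarrow> F y \<noteq> 0"
  shows "Ck k U F \<Longrightarrow> Ck k U (\<lambda>y. 1 / F y)"
proof (induction k)
  case 0
  then show ?case using assms by (auto intro: continuous_on_divide)
next
  case (Suc k)
  show ?case
  \<comment> \<open>The derivative of \<open>1 / F\<close> is written as a product containing
    \<open>1 / F\<close> twice, so that the induction hypothesis applies to each factor.\<close>
  proof (rule Ck_SucI[where D="\<lambda>v y. (-1) * (dd v F y * (1 / F y * (1 / F y)))"])
    show "continuous_on U (\<lambda>y. 1 / F y)"
      using Ck_continuous_on[OF Suc.prems] assms by (auto intro!: continuous_on_divide continuous_on_const)
  next
    fix v :: 'a assume v: "v \<in> Basis"
    show "Ck k U (\<lambda>y. (-1) * (dd v F y * (1 / F y * (1 / F y))))"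
      using Suc.prems v assms(1)
      by (intro Ck_mult Ck_const Suc.IH Ck_Suc_imp[of k U F] Ck_SucD(3)[OF Suc.prems])
  next
    fix v x :: 'a assume "v \<in> Basis" "x \<in> U"
    then have "hasdd F v x (dd v F x)" "F x \<noteq> 0"
      using Suc.prems Ck_SucD(2) assms by blast+
    from hasdd_divide[OF hasdd_const this]
    show "hasdd (\<lambda>y. 1 / F y) v x ((-1) * (dd v F x * (1 / F x * (1 / F x))))"
      by (rule hasdd_eq_rhs) simp
  qed (rule assms)
qed

text \<open>Precomposition with affine maps sending each basis vector to a basis vector or to zero:
  no total differentiability is needed for these.\<close>

lemma Ck_compose_affine:
  fixes L :: "'a::euclidean_space \<Rightarrow> 'b::euclidean_space"
  assumes "open W" "continuous_on W L" "\<And>x. x \<in> W \<Longrightarrow> L x \<in> U"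
    and L: "\<And>x t v. v \<in> Basis \<Longrightarrow> L (x + t *\<^sub>R v) = L x + t *\<^sub>R L' v"
    and L': "\<And>v. v \<in> Basis \<Longrightarrow> L' v \<in> insert 0 Basis"
  shows "Ck k U F \<Longrightarrow> Ck k W (\<lambda>x. F (L x))"
proof (induction k arbitrary: F)
  case 0
  then show ?case
    using assms(2,3) by (auto intro: continuous_on_compose2)
next
  case (Suc k)
  show ?case
  proof (rule Ck_SucI[where D="\<lambda>v x. if L' v = 0 then 0 else dd (L' v) F (L x)"])
    show "continuous_on W (\<lambda>x. F (L x))"
      using Ck_continuous_on[OF Suc.prems] assms(2,3) by (auto intro: continuous_on_compose2)
  next
    fix v :: 'a assume v: "v \<in> Basis"
    show "Ck k W (\<lambda>x. if L' v = 0 then 0 else dd (L' v) F (L x))"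
      using Suc L'[OF v] Ck_const[OF assms(1)] Ck_SucD(3) by (cases "L' v = 0") auto
  next
    fix v x :: 'a assume v: "v \<in> Basis" and x: "x \<in> W"
    have "hasdd F (L' v) (L x) (if L' v = 0 then 0 else dd (L' v) F (L x))"
      using Ck_SucD(2)[OF Suc.prems] L'[OF v] assms(3)[OF x] hasdd_zero_dir by auto
    then show "hasdd (\<lambda>x. F (L x)) v x (if L' v = 0 then 0 else dd (L' v) F (L x))"
      by (rule hasdd_compose_affine) (rule L[OF v])
  qed (rule assms)
qed

lemma smooth_on_cong:
  "open U \<Longrightarrow> (\<And>y. y \<in> U \<Longrightarrow> F y = G y) \<Longrightarrow> smooth_on U F \<longleftrightarrow> smooth_on U G"
  unfolding smooth_on_def using Ck_cong by blast

lemma smooth_on_subset: "smooth_on U F \<Longrightarrow> V \<subseteq> U \<Longrightarrow> smooth_on V F"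
  unfolding smooth_on_def using Ck_subset by blast

lemma smooth_on_const: "open U \<Longrightarrow> smooth_on U (\<lambda>_. c)"
  unfolding smooth_on_def using Ck_const by blast

lemma smooth_on_add: "open U \<Longrightarrow> smooth_on U F \<Longrightarrow> smooth_on U G \<Longrightarrow> smooth_on U (\<lambda>y. F y + G y)"
  unfolding smooth_on_def using Ck_add by blast

lemma smooth_on_mult: "open U \<Longrightarrow> smooth_on U F \<Longrightarrow> smooth_on U G \<Longrightarrow> smooth_on U (\<lambda>y. F y * G y)"
  unfolding smooth_on_def using Ck_mult by blast

lemma smooth_on_minus: "open U \<Longrightarrow> smooth_on U F \<Longrightarrow> smooth_on U (\<lambda>y. - F y)"
  using smooth_on_mult[OF _ smooth_on_const[of U "-1"], of F] by simp

lemma smooth_on_diff: "open U \<Longrightarrow> smooth_on U F \<Longrightarrow> smooth_on U G \<Longrightarrow> smooth_on U (\<lambda>y. F y - G y)"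
  using smooth_on_add[OF _ _ smooth_on_minus, of U F G] by simp

lemma smooth_on_divide:
  assumes "open U" "smooth_on U F" "smooth_on U G" "\<And>y. y \<in> U \<Longrightarrow> G y \<noteq> 0"
  shows "smooth_on U (\<lambda>y. F y / G y)"
proof -
  have "smooth_on U (\<lambda>y. 1 / G y)"
    using assms Ck_inverse unfolding smooth_on_def by blast
  from smooth_on_mult[OF assms(1,2) this] show ?thesis by simp
qed

lemmas smooth_on_intros =
  smooth_on_const smooth_on_add smooth_on_minus smooth_on_diff smooth_on_mult smooth_on_divide

lemma smooth_on_compose_affine:
  fixes L :: "'a::euclidean_space \<Rightarrow> 'b::euclidean_space"
  assumes "smooth_on U F" "open W" "continuous_on W L" "\<And>x. x \<in> W \<Longrightarrow> L x \<in> U"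
    and "\<And>x t v. v \<in> Basis \<Longrightarrow> L (x + t *\<^sub>R v) = L x + t *\<^sub>R L' v"
    and "\<And>v. v \<in> Basis \<Longrightarrow> L' v \<in> insert 0 Basis"
  shows "smooth_on W (\<lambda>x. F (L x))"
  using assms(1) Ck_compose_affine[OF assms(2-6)] unfolding smooth_on_def by blast

lemma smooth_on_dd: "smooth_on U F \<Longrightarrow> v \<in> Basis \<Longrightarrow> smooth_on U (dd v F)"
  unfolding smooth_on_def using Ck_SucD(3) by blast

lemma smooth_on_hasdd: "smooth_on U F \<Longrightarrow> v \<in> Basis \<Longrightarrow> x \<in> U \<Longrightarrow> hasdd F v x (dd v F x)"
  unfolding smooth_on_def using Ck_SucD(2) by blast

lemma smooth_on_continuous: "smooth_on U F \<Longrightarrow> continuous_on U F"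
  unfolding smooth_on_def using Ck_continuous_on by blast

text \<open>Serves above all for primitives: continuity and smooth partials put \<open>F\<close>
  into every class \<open>Ck (Suc k)\<close>.\<close>

lemma smooth_onI_partials:
  assumes "open U" "continuous_on U F"
    and "\<And>v x. v \<in> Basis \<Longrightarrow> x \<in> U \<Longrightarrow> hasdd F v x (D v x)"
    and "\<And>v. v \<in> Basis \<Longrightarrow> smooth_on U (D v)"
  shows "smooth_on U F"
  unfolding smooth_on_def
proof
  fix k
  show "Ck k U F"
  proof (cases k)
    case (Suc k')
    then show ?thesis
      using Ck_SucI[OF assms(1-3)] assms(4) unfolding smooth_on_def by blast
  qed (use assms in simp)
qed

subsection \<open>Symmetry of second derivatives\<close>

text \<open>The mean value theorem is applied twice: along \<open>v\<close> to the difference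
  \<open>\<phi>\<close> of \<open>F\<close> over two parallel segments, then along \<open>w\<close>
  to \<open>dd v F\<close>.\<close>

lemma second_difference_mvt:
  fixes F :: "'a::euclidean_space \<Rightarrow> real"
  assumes F: "smooth_on U F" and U: "\<And>s t. 0 \<le> s \<Longrightarrow> s \<le> h \<Longrightarrow> 0 \<le> t \<Longrightarrow> t \<le> h \<Longrightarrow> x + s *\<^sub>R v + t *\<^sub>R w \<in> U"
    and vw: "v \<in> Basis" "w \<in> Basis" and h: "0 < h"
  obtains s t where "0 \<le> s" "s \<le> h" "0 \<le> t" "t \<le> h"
    "F (x + h *\<^sub>R v + h *\<^sub>R w) - F (x + h *\<^sub>R v) - F (x + h *\<^sub>R w) + F x
      = h * h * dd w (dd v F) (x + s *\<^sub>R v + t *\<^sub>R w)"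
proof -
  define \<phi> where "\<phi> s = F (x + h *\<^sub>R w + s *\<^sub>R v) - F (x + s *\<^sub>R v)" for s
  define \<phi>' where "\<phi>' s = dd v F (x + h *\<^sub>R w + s *\<^sub>R v) - dd v F (x + s *\<^sub>R v)" for s
  have "(\<phi> has_real_derivative \<phi>' s) (at s)" if "0 \<le> s" "s \<le> h" for s
  proof -
    have "x + h *\<^sub>R w + s *\<^sub>R v \<in> U" "x + s *\<^sub>R v \<in> U"
      using U[of s h] U[of s 0] that h by (simp_all add: algebra_simps)
    then show ?thesis
      unfolding \<phi>_def \<phi>'_def
      by (intro DERIV_diff DERIV_line smooth_on_hasdd[OF F vw(1)])
  qed
  from MVT2[OF h this] obtain s where s: "0 < s" "s < h" "\<phi> h - \<phi> 0 = h * \<phi>' s"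
    by auto
  have "((\<lambda>t. dd v F (x + s *\<^sub>R v + t *\<^sub>R w)) has_real_derivative
      dd w (dd v F) (x + s *\<^sub>R v + t *\<^sub>R w)) (at t)" if "0 \<le> t" "t \<le> h" for t
    using U[of s t] s that
    by (intro DERIV_line smooth_on_hasdd[OF smooth_on_dd[OF F vw(1)] vw(2)]) auto
  from MVT2[OF h this] obtain t where t: "0 < t" "t < h"
    "dd v F (x + s *\<^sub>R v + h *\<^sub>R w) - dd v F (x + s *\<^sub>R v + 0 *\<^sub>R w) =
       (h - 0) * dd w (dd v F) (x + s *\<^sub>R v + t *\<^sub>R w)"
    by auto
  show thesis
  proof (rule that[of s t])
    show "F (x + h *\<^sub>R v + h *\<^sub>R w) - F (x + h *\<^sub>R v) - F (x + h *\<^sub>R w) + F x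
      = h * h * dd w (dd v F) (x + s *\<^sub>R v + t *\<^sub>R w)"
      using s(3) t(3) by (simp add: \<phi>_def \<phi>'_def algebra_simps)
  qed (use s t in auto)
qed

text \<open>The second difference is symmetric in \<open>v\<close> and \<open>w\<close>, so the two
  mixed derivatives take a common value at two points within \<open>2 * h\<close> of
  \<open>x\<close>. Continuity then excludes a gap of \<open>2 * \<epsilon>\<close> at
  \<open>x\<close>.\<close>

lemma dd_commute:
  fixes F :: "'a::euclidean_space \<Rightarrow> real"
  assumes F: "smooth_on U F" and U: "open U" "x \<in> U" and vw: "v \<in> Basis" "w \<in> Basis"
  shows "dd v (dd w F) x = dd w (dd v F) x"
proof (rule ccontr)
  define A where "A = dd v (dd w F)"
  define B where "B = dd w (dd v F)"
  assume neq: "\<not> ?thesis"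
  define \<epsilon> where "\<epsilon> = \<bar>A x - B x\<bar> / 2"
  then have \<epsilon>: "\<epsilon> > 0" using neq by (simp add: A_def B_def)
  have "isCont A x" "isCont B x"
    using smooth_on_continuous[OF smooth_on_dd[OF smooth_on_dd[OF F]]] vw U
    unfolding A_def B_def by (simp_all add: continuous_on_eq_continuous_at)
  then obtain d1 d2 where d1: "d1 > 0" "\<And>y. dist y x < d1 \<Longrightarrow> dist (A y) (A x) < \<epsilon>"
    and d2: "d2 > 0" "\<And>y. dist y x < d2 \<Longrightarrow> dist (B y) (B x) < \<epsilon>"
    using \<epsilon> unfolding continuous_at_eps_delta by metis
  obtain r where r: "r > 0" "ball x r \<subseteq> U"
    using U open_contains_ball by blast
  define h where "h = min r (min d1 d2) / 3"
  have h: "h > 0" "2 * h < r" "2 * h < d1" "2 * h < d2"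
    using r d1 d2 by (auto simp: h_def)
  have near: "dist (x + s *\<^sub>R a + t *\<^sub>R b) x \<le> 2 * h"
    if "0 \<le> s" "s \<le> h" "0 \<le> t" "t \<le> h" "a \<in> Basis" "b \<in> Basis" for s t and a b :: 'a
  proof -
    have "dist (x + s *\<^sub>R a + t *\<^sub>R b) x = norm (s *\<^sub>R a + t *\<^sub>R b)"
      by (simp add: dist_norm add.assoc)
    also have "\<dots> \<le> s + t"
      using that norm_triangle_ineq[of "s *\<^sub>R a" "t *\<^sub>R b"] by simp
    finally show ?thesis using that by simp
  qed
  have inU: "x + s *\<^sub>R a + t *\<^sub>R b \<in> U"
    if "0 \<le> s" "s \<le> h" "0 \<le> t" "t \<le> h" "a \<in> Basis" "b \<in> Basis" for s t and a b :: 'a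
    using near[OF that] h r by (auto simp: dist_commute subset_iff)
  obtain s t where st: "0 \<le> s" "s \<le> h" "0 \<le> t" "t \<le> h"
    "F (x + h *\<^sub>R v + h *\<^sub>R w) - F (x + h *\<^sub>R v) - F (x + h *\<^sub>R w) + F x = h * h * B (x + s *\<^sub>R v + t *\<^sub>R w)"
    unfolding B_def using second_difference_mvt[OF F inU vw h(1)] vw by blast
  obtain s' t' where st': "0 \<le> s'" "s' \<le> h" "0 \<le> t'" "t' \<le> h"
    "F (x + h *\<^sub>R w + h *\<^sub>R v) - F (x + h *\<^sub>R w) - F (x + h *\<^sub>R v) + F x = h * h * A (x + s' *\<^sub>R w + t' *\<^sub>R v)"
    unfolding A_def using second_difference_mvt[OF F inU vw(2,1) h(1)] vw by blast
  have "h * h * B (x + s *\<^sub>R v + t *\<^sub>R w) = h * h * A (x + s' *\<^sub>R w + t' *\<^sub>R v)"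
    using st(5) st'(5) by (simp add: algebra_simps)
  then have eq: "B (x + s *\<^sub>R v + t *\<^sub>R w) = A (x + s' *\<^sub>R w + t' *\<^sub>R v)"
    using h by simp
  have "dist (B (x + s *\<^sub>R v + t *\<^sub>R w)) (B x) < \<epsilon>"
    using near[OF st(1-4) vw] h by (intro d2) simp
  moreover have "dist (A (x + s' *\<^sub>R w + t' *\<^sub>R v)) (A x) < \<epsilon>"
    using near[OF st'(1-4) vw(2,1)] h by (intro d1) simp
  ultimately show False
    using eq unfolding \<epsilon>_def dist_real_def by argo
qed

lemma const_along_direction:
  fixes F :: "'a::real_normed_vector \<Rightarrow> real"
  assumes "\<And>t. t \<in> closed_segment 0 s \<Longrightarrow> hasdd F v (x + t *\<^sub>R v) 0"
  shows "F (x + s *\<^sub>R v) = F x"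
proof -
  have "\<exists>c. \<forall>t\<in>closed_segment 0 s. F (x + t *\<^sub>R v) = c"
    using assms
    by (intro has_field_derivative_zero_constant)
      (auto intro: DERIV_line has_field_derivative_at_within)
  then obtain c where c: "\<And>t. t \<in> closed_segment 0 s \<Longrightarrow> F (x + t *\<^sub>R v) = c"
    by blast
  show ?thesis
    using c[of s] c[of 0] by simp
qed

subsection \<open>Differential consequences of the integrability conditions\<close>

lemma e_Basis [simp]: "e l \<in> Basis"
  by (simp add: e_def axis_in_Basis_iff)

lemma e_nth: "e l $ m = (if m = l then 1 else 0)"
  by (simp add: e_def axis_def)

lemma Basis_prod_e: "(Basis :: ((real^3) \<times> real) set) = insert (0, 1) ((\<lambda>l. (e l, 0)) ` UNIV)"
  by (auto simp: Basis_prod_def Basis_vec_def e_def Basis_real_def)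

lemma hasdd_cmult: "hasdd F v x D \<Longrightarrow> hasdd (\<lambda>y. c * F y) v x (c * D)"
  using hasdd_mult[OF hasdd_const, of F v x D c] by simp

lemma smooth_on_eq:
  "smooth_on U F \<Longrightarrow> open U \<Longrightarrow> (\<And>y. y \<in> U \<Longrightarrow> F y = G y) \<Longrightarrow> smooth_on U G"
  using smooth_on_cong by blast

text \<open>The Hessian entries are parameters so that a cyclic relabelling of \<open>i, j, k\<close> is again an instance.\<close>

locale hydro_system =
  fixes lam :: "real^3" and H :: "real^3 \<Rightarrow> real" and U :: "(real^3) set"
    and i j k :: 3 and A B C x y z :: "real^3 \<Rightarrow> real" and mi mj mk :: real
  assumes dist: "i \<noteq> j" "j \<noteq> k" "k \<noteq> i" and univ: "UNIV = {i, j, k}"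
    and mdef: "mi = lam$j - lam$k" "mj = lam$k - lam$i" "mk = lam$i - lam$j"
    and m0: "mi \<noteq> 0" "mj \<noteq> 0" "mk \<noteq> 0"
    and U: "open U" and smH: "smooth_on U H"
    and hess: "\<And>u. u \<in> U \<Longrightarrow> Hdd H i i u = A u" "\<And>u. u \<in> U \<Longrightarrow> Hdd H j j u = B u"
      "\<And>u. u \<in> U \<Longrightarrow> Hdd H k k u = C u"
      "\<And>u. u \<in> U \<Longrightarrow> Hdd H i j u = x u" "\<And>u. u \<in> U \<Longrightarrow> Hdd H j i u = x u"
      "\<And>u. u \<in> U \<Longrightarrow> Hdd H i k u = y u" "\<And>u. u \<in> U \<Longrightarrow> Hdd H k i u = y u"
      "\<And>u. u \<in> U \<Longrightarrow> Hdd H j k u = z u" "\<And>u. u \<in> U \<Longrightarrow> Hdd H k j u = z u"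
    and nz: "\<And>u. u \<in> U \<Longrightarrow> x u \<noteq> 0" "\<And>u. u \<in> U \<Longrightarrow> y u \<noteq> 0" "\<And>u. u \<in> U \<Longrightarrow> z u \<noteq> 0"
    and third0: "\<And>u. u \<in> U \<Longrightarrow> dd (e k) x u = 0" "\<And>u. u \<in> U \<Longrightarrow> dd (e j) y u = 0"
      "\<And>u. u \<in> U \<Longrightarrow> dd (e i) z u = 0"
    and J: "\<And>u. u \<in> U \<Longrightarrow> mi * A u + mj * B u + mk * C u
      = mi * (x u * y u / z u) + mj * (x u * z u / y u) + mk * (y u * z u / x u)"
    and ci: "\<And>u. u \<in> U \<Longrightarrow>
      dd (e i) (\<lambda>u. mi * A u - mj * (x u * z u / y u) - mk * (y u * z u / x u)) u = 0"
    and cj: "\<And>u. u \<in> U \<Longrightarrow>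
      dd (e j) (\<lambda>u. mj * B u - mk * (y u * z u / x u) - mi * (x u * y u / z u)) u = 0"
    and ck: "\<And>u. u \<in> U \<Longrightarrow>
      dd (e k) (\<lambda>u. mk * C u - mi * (x u * y u / z u) - mj * (x u * z u / y u)) u = 0"
begin

text \<open>The shift i to j to k to i turns (H_ij, H_ik, H_jk) into (H_jk, H_ij, H_ik) and permutes
  the hypotheses, so every fact about i also yields its versions for j and k.\<close>

lemma cyc: "hydro_system lam H U j k i B C A z x y mj mk mi"
  by unfold_locales
    (use dist univ mdef m0 U smH hess nz third0 J ci cj ck in \<open>auto simp: mult.commute algebra_simps\<close>)

lemma sum3: "(\<Sum>l\<in>UNIV. f l) = f i + f j + (f k :: real)"
  using dist by (simp add: univ)

lemma smooth_Hdd: "smooth_on U (Hdd H l m)"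
  unfolding Hdd_def by (intro smooth_on_dd smH e_Basis)

lemma smooth:
  "smooth_on U A" "smooth_on U B" "smooth_on U C" "smooth_on U x" "smooth_on U y" "smooth_on U z"
  by (rule smooth_on_eq[OF smooth_Hdd U], erule hess)+

abbreviation ri where "ri \<equiv> \<lambda>u. x u * y u / z u"
abbreviation rj where "rj \<equiv> \<lambda>u. x u * z u / y u"
abbreviation rk where "rk \<equiv> \<lambda>u. y u * z u / x u"

lemma smooth_r: "smooth_on U ri" "smooth_on U rj" "smooth_on U rk"
  using nz by (auto intro!: smooth_on_intros smooth U)

lemma hasdd_r:
  assumes "u \<in> U"
  shows "hasdd ri (e l) u (dd (e l) ri u)" "hasdd rj (e l) u (dd (e l) rj u)"
    "hasdd rk (e l) u (dd (e l) rk u)"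
  using assms by (auto intro: smooth_on_hasdd smooth_r)

lemma hasdd_basic:
  assumes "u \<in> U"
  shows "hasdd A (e l) u (dd (e l) A u)" "hasdd B (e l) u (dd (e l) B u)"
    "hasdd C (e l) u (dd (e l) C u)" "hasdd x (e l) u (dd (e l) x u)"
    "hasdd y (e l) u (dd (e l) y u)" "hasdd z (e l) u (dd (e l) z u)"
  using assms by (auto intro: smooth_on_hasdd smooth)

lemma dd_Hdd: "u \<in> U \<Longrightarrow> dd (e m) (Hdd H l l) u = dd (e l) (Hdd H l m) u"
  unfolding Hdd_def by (intro dd_commute[of U "dd (e l) H"] U smooth_on_dd smH e_Basis)

text \<open>Symmetry of third derivatives, as in H_iij = H_iji, trades derivatives of diagonal
  entries for derivatives of off-diagonal ones.\<close>

lemma third: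
  assumes "u \<in> U"
  shows "dd (e j) A u = dd (e i) x u" "dd (e k) A u = dd (e i) y u"
    "dd (e i) B u = dd (e j) x u" "dd (e k) B u = dd (e j) z u"
    "dd (e i) C u = dd (e k) y u" "dd (e j) C u = dd (e k) z u"
  using dd_Hdd[OF assms, of j i] dd_Hdd[OF assms, of k i] dd_Hdd[OF assms, of i j]
    dd_Hdd[OF assms, of k j] dd_Hdd[OF assms, of i k] dd_Hdd[OF assms, of j k]
  by (simp_all add: dd_cong[OF U assms hess(1)] dd_cong[OF U assms hess(2)] dd_cong[OF U assms hess(3)]
      dd_cong[OF U assms hess(4)] dd_cong[OF U assms hess(5)] dd_cong[OF U assms hess(6)]
      dd_cong[OF U assms hess(7)] dd_cong[OF U assms hess(8)] dd_cong[OF U assms hess(9)])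

lemma ci_exp:
  assumes "u \<in> U"
  shows "mi * dd (e i) A u = mj * dd (e i) rj u + mk * dd (e i) rk u"
proof -
  have "hasdd (\<lambda>u. mi * A u - mj * rj u - mk * rk u) (e i) u
      (0 * A u + mi * dd (e i) A u - (0 * rj u + mj * dd (e i) rj u) - (0 * rk u + mk * dd (e i) rk u))"
    by (rule hasdd_intros hasdd_basic hasdd_r assms)+
  from hasdd_imp_dd[OF this] ci[OF assms] show ?thesis by simp
qed

text \<open>Differentiate \<open>J\<close> in direction i. By \<open>ci_exp\<close> the derivative
  of \<open>mi * A\<close> cancels those of \<open>mj * rj\<close> and \<open>mk * rk\<close>; the
  derivatives of \<open>B\<close> and \<open>C\<close> are rewritten by
  \<open>third\<close>.\<close>

lemma dd_ri:
  assumes "u \<in> U"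
  shows "mi * dd (e i) ri u = mj * dd (e j) x u + mk * dd (e k) y u"
proof -
  have "hasdd (\<lambda>u. mi * A u + mj * B u + mk * C u) (e i) u
      (0 * A u + mi * dd (e i) A u + (0 * B u + mj * dd (e i) B u) + (0 * C u + mk * dd (e i) C u))"
    by (rule hasdd_intros hasdd_basic assms)+
  moreover have "hasdd (\<lambda>u. mi * ri u + mj * rj u + mk * rk u) (e i) u
      (0 * ri u + mi * dd (e i) ri u + (0 * rj u + mj * dd (e i) rj u) + (0 * rk u + mk * dd (e i) rk u))"
    by (rule hasdd_add hasdd_mult hasdd_const hasdd_r assms)+
  then have "hasdd (\<lambda>u. mi * A u + mj * B u + mk * C u) (e i) u
      (0 * ri u + mi * dd (e i) ri u + (0 * rj u + mj * dd (e i) rj u) + (0 * rk u + mk * dd (e i) rk u))"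
    using hasdd_cong[OF U assms, OF J] by simp
  ultimately show ?thesis
    using hasdd_unique ci_exp[OF assms] third[OF assms] by fastforce
qed

text \<open>As \<open>z\<close> is independent of u_i, \<open>dd_ri\<close> becomes a first-order
  relation among the off-diagonal entries alone.\<close>

lemma gradient_relation_i:
  assumes "u \<in> U"
  shows "mi * (dd (e i) x u * y u + x u * dd (e i) y u) = z u * (mj * dd (e j) x u + mk * dd (e k) y u)"
proof -
  have "hasdd ri (e i) u (((dd (e i) x u * y u + x u * dd (e i) y u) * z u - x u * y u * dd (e i) z u) / (z u * z u))"
    by (rule hasdd_intros hasdd_basic assms nz)+
  then have "dd (e i) ri u = (dd (e i) x u * y u + x u * dd (e i) y u) / z u"
    using hasdd_imp_dd third0[OF assms] nz[OF assms] by fastforce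
  with dd_ri[OF assms] nz[OF assms] show ?thesis
    by (simp add: field_simps)
qed

lemma cyc2: "hydro_system lam H U k i j C A B y z x mk mi mj"
  by (rule hydro_system.cyc[OF cyc])

lemma dd_rj: "u \<in> U \<Longrightarrow> mj * dd (e j) rj u = mi * dd (e i) x u + mk * dd (e k) z u"
  using hydro_system.dd_ri[OF cyc, of u] by (simp add: mult.commute[of "z _"] add.commute)

lemma gradient_relation_j: "u \<in> U \<Longrightarrow> mj * (dd (e j) x u * z u + x u * dd (e j) z u)
    = y u * (mi * dd (e i) x u + mk * dd (e k) z u)"
  using hydro_system.gradient_relation_i[OF cyc, of u] by (simp add: algebra_simps)

lemma hasdd_dd: "smooth_on U F \<Longrightarrow> u \<in> U \<Longrightarrow> hasdd (dd (e l) F) (e m) u (dd (e m) (dd (e l) F) u)"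
  by (intro smooth_on_hasdd smooth_on_dd) auto

lemma dd_zero_fun:
  assumes "u \<in> U" "\<And>v. v \<in> U \<Longrightarrow> F v = 0"
  shows "dd w F u = 0"
proof -
  have "dd w F u = dd w (\<lambda>_. 0) u"
    by (rule dd_cong[OF U assms])
  then show ?thesis
    using hasdd_imp_dd[OF hasdd_const] by metis
qed

text \<open>Differentiating \<open>ci_exp\<close> in direction j and \<open>dd_rj\<close> in
  direction i gives two expressions for the mixed derivative of \<open>mj * rj\<close>. Both contain
  \<open>mi * dd (e i) (dd (e i) x)\<close>, and the only other term left is the mixed derivative of
  \<open>rk\<close>.\<close>

lemma dd_ij_rk:
  assumes u: "u \<in> U"
  shows "dd (e j) (dd (e i) rk) u = 0"
proof -
  have "dd (e j) (dd (e i) A) u = dd (e i) (dd (e j) A) u"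
    by (rule dd_commute[OF smooth(1) U u]) auto
  also have "\<dots> = dd (e i) (dd (e i) x) u"
    by (rule dd_cong[OF U u]) (rule third)
  finally have 1: "dd (e j) (dd (e i) A) u = dd (e i) (dd (e i) x) u" .
  have "hasdd (\<lambda>u. mi * dd (e i) A u) (e j) u (0 * dd (e i) A u + mi * dd (e j) (dd (e i) A) u)"
    by (rule hasdd_const hasdd_mult hasdd_dd smooth u)+
  then have "hasdd (\<lambda>u. mj * dd (e i) rj u + mk * dd (e i) rk u) (e j) u
      (0 * dd (e i) A u + mi * dd (e j) (dd (e i) A) u)"
    using hasdd_cong[OF U u ci_exp] by simp
  moreover have "hasdd (\<lambda>u. mj * dd (e i) rj u + mk * dd (e i) rk u) (e j) u
      (0 * dd (e i) rj u + mj * dd (e j) (dd (e i) rj) u + (0 * dd (e i) rk u + mk * dd (e j) (dd (e i) rk) u))"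
    by (rule hasdd_add hasdd_const hasdd_mult hasdd_dd smooth_r u)+
  ultimately have 2: "mi * dd (e i) (dd (e i) x) u
      = mj * dd (e j) (dd (e i) rj) u + mk * dd (e j) (dd (e i) rk) u"
    using hasdd_unique 1 by fastforce
  have 3: "dd (e j) (dd (e i) rj) u = dd (e i) (dd (e j) rj) u"
    by (rule dd_commute[OF smooth_r(2) U u]) auto
  have "hasdd (\<lambda>u. mj * dd (e j) rj u) (e i) u (0 * dd (e j) rj u + mj * dd (e i) (dd (e j) rj) u)"
    by (rule hasdd_const hasdd_mult hasdd_dd smooth_r u)+
  then have "hasdd (\<lambda>u. mi * dd (e i) x u + mk * dd (e k) z u) (e i) u
      (0 * dd (e j) rj u + mj * dd (e i) (dd (e j) rj) u)"
    using hasdd_cong[OF U u dd_rj] by simp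
  moreover have "hasdd (\<lambda>u. mi * dd (e i) x u + mk * dd (e k) z u) (e i) u
      (0 * dd (e i) x u + mi * dd (e i) (dd (e i) x) u + (0 * dd (e k) z u + mk * dd (e i) (dd (e k) z) u))"
    by (rule hasdd_add hasdd_const hasdd_mult hasdd_dd smooth u)+
  ultimately have 4: "mj * dd (e i) (dd (e j) rj) u
      = mi * dd (e i) (dd (e i) x) u + mk * dd (e i) (dd (e k) z) u"
    using hasdd_unique by fastforce
  have "dd (e i) (dd (e k) z) u = dd (e k) (dd (e i) z) u"
    by (rule dd_commute[OF smooth(6) U u]) auto
  also have "\<dots> = 0"
    by (rule dd_zero_fun[OF u third0(3)])
  finally show ?thesis
    using 2 3 4 m0 by simp
qed

lemma dd_jk_ri:
  assumes u: "u \<in> U"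
  shows "dd (e j) (dd (e k) ri) u = 0"
proof -
  have "dd (e k) (dd (e j) ri) u = 0"
    using hydro_system.dd_ij_rk[OF cyc u] by simp
  then show ?thesis
    using dd_commute[OF smooth_r(1) U u, of "e j" "e k"] by simp
qed

text \<open>With g = Gi + Gj + Gk and f = - lam_i Gi - lam_j Gj - lam_k Gk the condition on grad f
  holds automatically. In row i the coefficient f_p + lam_i g_p collapses to
  \<open>mk * bj - mj * bk\<close>, which leaves the three equations \<open>eq\<close>.\<close>

lemma lax_pair_separated:
  fixes W :: "((real^3) \<times> real) set"
  assumes W: "open W" "W \<noteq> {}" "W \<subseteq> U \<times> UNIV"
    and sm: "smooth_on W Gi" "smooth_on W Gj" "smooth_on W Gk"
    and Gi: "\<And>w. w \<in> W \<Longrightarrow> hasdd Gi (e i, 0) w (ai w)" "\<And>w. w \<in> W \<Longrightarrow> hasdd Gi (e j, 0) w 0"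
      "\<And>w. w \<in> W \<Longrightarrow> hasdd Gi (e k, 0) w 0" "\<And>w. w \<in> W \<Longrightarrow> hasdd Gi (0, 1) w (bi w)"
    and Gj: "\<And>w. w \<in> W \<Longrightarrow> hasdd Gj (e i, 0) w 0" "\<And>w. w \<in> W \<Longrightarrow> hasdd Gj (e j, 0) w (aj w)"
      "\<And>w. w \<in> W \<Longrightarrow> hasdd Gj (e k, 0) w 0" "\<And>w. w \<in> W \<Longrightarrow> hasdd Gj (0, 1) w (bj w)"
    and Gk: "\<And>w. w \<in> W \<Longrightarrow> hasdd Gk (e i, 0) w 0" "\<And>w. w \<in> W \<Longrightarrow> hasdd Gk (e j, 0) w 0"
      "\<And>w. w \<in> W \<Longrightarrow> hasdd Gk (e k, 0) w (ak w)" "\<And>w. w \<in> W \<Longrightarrow> hasdd Gk (0, 1) w (bk w)"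
    and eq: "\<And>w. w \<in> W \<Longrightarrow> ai w * (mk * bj w - mj * bk w) + ai w * A (fst w) + aj w * x (fst w) + ak w * y (fst w) = 0"
      "\<And>w. w \<in> W \<Longrightarrow> aj w * (mi * bk w - mk * bi w) + ai w * x (fst w) + aj w * B (fst w) + ak w * z (fst w) = 0"
      "\<And>w. w \<in> W \<Longrightarrow> ak w * (mj * bi w - mi * bj w) + ai w * y (fst w) + aj w * z (fst w) + ak w * C (fst w) = 0"
    and ai: "\<And>w. w \<in> W \<Longrightarrow> ai w \<noteq> 0"
  shows "\<exists>W f g. W \<subseteq> U \<times> UNIV \<and> is_disp_lax_pair lam H W f g"
proof -
  define g where "g = (\<lambda>w. Gi w + Gj w + Gk w)"
  define f where "f = (\<lambda>w. - (lam$i * Gi w) - lam$j * Gj w - lam$k * Gk w)"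
  have ge: "hasdd g v w (p + q + r)"
    and fe: "hasdd f v w (- (lam$i * p) - lam$j * q - lam$k * r)"
    if "hasdd Gi v w p" "hasdd Gj v w q" "hasdd Gk v w r" for v w p q r
    unfolding g_def f_def using that by (auto intro!: hasdd_add hasdd_diff hasdd_minus hasdd_cmult)
  have D: "du i g w = ai w" "du j g w = aj w" "du k g w = ak w" "dp g w = bi w + bj w + bk w"
    "du i f w = - lam$i * ai w" "du j f w = - lam$j * aj w" "du k f w = - lam$k * ak w"
    "dp f w = - lam$i * bi w - lam$j * bj w - lam$k * bk w" if "w \<in> W" for w
    using that hasdd_imp_dd[OF ge[OF Gi(1) Gj(1) Gk(1)]] hasdd_imp_dd[OF fe[OF Gi(1) Gj(1) Gk(1)]]
      hasdd_imp_dd[OF ge[OF Gi(2) Gj(2) Gk(2)]] hasdd_imp_dd[OF fe[OF Gi(2) Gj(2) Gk(2)]]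
      hasdd_imp_dd[OF ge[OF Gi(3) Gj(3) Gk(3)]] hasdd_imp_dd[OF fe[OF Gi(3) Gj(3) Gk(3)]]
      hasdd_imp_dd[OF ge[OF Gi(4) Gj(4) Gk(4)]] hasdd_imp_dd[OF fe[OF Gi(4) Gj(4) Gk(4)]]
    by (simp_all add: du_def dp_def)
  have "smooth_on W f" "smooth_on W g"
    unfolding f_def g_def by (auto intro!: smooth_on_intros sm W)
  moreover have "\<forall>l. du l f w + du l g w * lam$l = 0" if "w \<in> W" for w
  proof
    fix l show "du l f w + du l g w * lam$l = 0"
      using D[OF that] univ by (cases "l = i"; cases "l = j"; cases "l = k") auto
  qed
  moreover have "\<forall>l. du l g w * (dp f w + dp g w * lam$l) + (\<Sum>m\<in>UNIV. du m g w * Hdd H m l (fst w)) = 0"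
    if "w \<in> W" for w
  proof
    fix l
    have u: "fst w \<in> U" using W(3) that by auto
    consider "l = i" | "l = j" | "l = k" using univ by auto
    then show "du l g w * (dp f w + dp g w * lam$l) + (\<Sum>m\<in>UNIV. du m g w * Hdd H m l (fst w)) = 0"
    proof cases
      case 1
      show ?thesis
        using eq(1)[OF that] unfolding 1 sum3 D[OF that] hess[OF u] mdef by (simp add: algebra_simps)
    next
      case 2
      show ?thesis
        using eq(2)[OF that] unfolding 2 sum3 D[OF that] hess[OF u] mdef by (simp add: algebra_simps)
    next
      case 3
      show ?thesis
        using eq(3)[OF that] unfolding 3 sum3 D[OF that] hess[OF u] mdef by (simp add: algebra_simps)
    qed
  qed
  moreover have "\<exists>w\<in>W. \<exists>l. du l g w \<noteq> 0"
    using W(2) ai D(1) by fastforce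
  ultimately have "is_disp_lax_pair lam H W f g"
    using W by (auto simp: is_disp_lax_pair_def)
  with W(3) show ?thesis by blast
qed

end

subsection \<open>Primitives of closed forms and freezing of a coordinate\<close>

text \<open>The algebra behind closedness of the form aj du_j + bj dp. Lower-case letters are values
  at u, capitals are values after u_j has been replaced by p, and the suffixes 1, 2, 3 mark
  derivatives in directions i, j, k. \<open>E1\<close>, \<open>E2\<close> are the gradient relations
  at both points; \<open>N1\<close>, \<open>N3\<close> say that the derivatives of \<open>rk\<close>
  along i and of \<open>ri\<close> along k do not see u_j.\<close>

lemma compatibility_identity:
  fixes y :: real
  assumes nz: "x \<noteq> 0" "y \<noteq> 0" "z \<noteq> 0" "X \<noteq> 0" "Z \<noteq> 0"
    and E1: "m1 * (x1 * y + x * y1) = z * (m2 * x2 + m3 * y3)"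
      "m1 * (X1 * y + X * y1) = Z * (m2 * X2 + m3 * y3)"
    and E2: "m2 * (x2 * z + x * z2) = y * (m1 * x1 + m3 * z3)"
      "m2 * (X2 * Z + X * Z2) = y * (m1 * X1 + m3 * Z3)"
    and N1: "(y1 * z * x - y * z * x1) / (x * x) = (y1 * Z * X - y * Z * X1) / (X * X)"
    and N3: "(x * y3 * z - x * y * z3) / (z * z) = (X * y3 * Z - X * y * Z3) / (Z * Z)"
    and N: "N = y / (z * X) - y / (x * Z)"
    and Nj: "Nj = y * x2 / (x * x * Z) - y * z2 / (z * z * X)"
    and Np: "Np = y * Z2 / (x * Z * Z) - y * X2 / (z * X * X)"
  shows "m1 * x1 * X * N\<^sup>2 - m2 * x2 * N + m2 * x * Nj + m2 * X * Np = 0"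
proof -
  \<comment> \<open>\<open>N1\<close> is solved for \<open>x1\<close> and \<open>N3\<close> for
    \<open>Z3\<close>; then \<open>E1\<close> and \<open>E2\<close> determine
    \<open>m2 * x2\<close>, \<open>m2 * X2\<close>, \<open>m2 * z2\<close> and
    \<open>m2 * Z2\<close>, so that a rational identity remains.\<close>
  have x1: "x1 = y1 * x / y - x * x * Z * (y1 * X - y * X1) / (y * z * X * X)"
    using N1 nz by (simp add: field_simps)
  have Z3: "Z3 = y3 * Z / y - x * Z * Z * (y3 * z - y * z3) / (y * X * z * z)"
    using N3 nz by (simp add: field_simps)
  define p q where "p = m1 * (x1 * y + x * y1) / z - m3 * y3" and "q = m1 * (X1 * y + X * y1) / Z - m3 * y3"
  have x2: "m2 * x2 = p" and X2: "m2 * X2 = q"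
    using E1 nz by (simp_all add: p_def q_def field_simps)
  have z2: "m2 * z2 = (y * (m1 * x1 + m3 * z3) - p * z) / x"
    using E2(1) nz x2[symmetric] by (simp add: field_simps)
  have Z2: "m2 * Z2 = (y * (m1 * X1 + m3 * Z3) - q * Z) / X"
    using E2(2) nz X2[symmetric] by (simp add: field_simps)
  have "m1 * x1 * X * N\<^sup>2 - m2 * x2 * N + m2 * x * Nj + m2 * X * Np
      = m1 * x1 * X * N\<^sup>2 - (m2 * x2) * N + x * (y * (m2 * x2) / (x * x * Z) - y * (m2 * z2) / (z * z * X))
        + X * (y * (m2 * Z2) / (x * Z * Z) - y * (m2 * X2) / (z * X * X))"
    unfolding Nj Np by (simp add: algebra_simps)
  also have "\<dots> = 0"
    unfolding x2 X2 z2 Z2 N p_def q_def Z3 x1 using nz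
    by (simp add: divide_simps power2_eq_square) algebra
  finally show ?thesis .
qed

text \<open>Poincare lemma for \<alpha> ds + \<beta> dp, where \<gamma> is the common cross
  derivative: integrate \<beta> along the edge \<open>s0\<close> and then \<alpha> in the
  s-direction.\<close>

lemma poincare_rectangle:
  fixes \<alpha> \<beta> \<gamma> :: "real \<Rightarrow> real \<Rightarrow> real"
  assumes ct: "continuous_on ({s0..s1} \<times> {p0..p1}) (\<lambda>(s, p). \<alpha> s p)"
      "continuous_on ({s0..s1} \<times> {p0..p1}) (\<lambda>(s, p). \<beta> s p)"
      "continuous_on ({s0..s1} \<times> {p0..p1}) (\<lambda>(s, p). \<gamma> s p)"
    and d\<alpha>: "\<And>s p. s \<in> {s0..s1} \<Longrightarrow> p \<in> {p0..p1} \<Longrightarrow> (\<alpha> s has_real_derivative \<gamma> s p) (at p)"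
    and d\<beta>: "\<And>s p. s \<in> {s0..s1} \<Longrightarrow> p \<in> {p0..p1} \<Longrightarrow> ((\<lambda>s. \<beta> s p) has_real_derivative \<gamma> s p) (at s)"
  obtains \<Phi> where
    "\<And>s p. s \<in> {s0<..<s1} \<Longrightarrow> p \<in> {p0<..<p1} \<Longrightarrow> ((\<lambda>s. \<Phi> s p) has_real_derivative \<alpha> s p) (at s)"
    "\<And>s p. s \<in> {s0<..<s1} \<Longrightarrow> p \<in> {p0<..<p1} \<Longrightarrow> (\<Phi> s has_real_derivative \<beta> s p) (at p)"
    "continuous_on ({s0<..<s1} \<times> {p0<..<p1}) (\<lambda>(s, p). \<Phi> s p)"
proof -
  define \<Phi> where "\<Phi> s p = integral {s0..s} (\<lambda>t. \<alpha> t p) + integral {p0..p} (\<beta> s0)" for s p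
  have slice1: "continuous_on {s0..s1} (\<lambda>s. h s p)" and slice2: "continuous_on {p0..p1} (h s)"
    if "continuous_on ({s0..s1} \<times> {p0..p1}) (\<lambda>(s, p). h s p)" "p \<in> {p0..p1}" "s \<in> {s0..s1}"
    for h :: "real \<Rightarrow> real \<Rightarrow> real" and s p
  proof -
    have "continuous_on {s0..s1} (\<lambda>s. case (s, p) of (s, p) \<Rightarrow> h s p)"
      "continuous_on {p0..p1} (\<lambda>p. case (s, p) of (s, p) \<Rightarrow> h s p)"
      by (rule continuous_on_compose2[OF that(1)]; use that in \<open>auto intro!: continuous_intros\<close>)+
    then show "continuous_on {s0..s1} (\<lambda>s. h s p)" "continuous_on {p0..p1} (h s)"
      by simp_all
  qed
  have 1: "((\<lambda>s. \<Phi> s p) has_real_derivative \<alpha> s p) (at s)"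
    if s: "s \<in> {s0<..<s1}" and p: "p \<in> {p0<..<p1}" for s p
  proof -
    have "((\<lambda>s. integral {s0..s} (\<lambda>t. \<alpha> t p)) has_real_derivative \<alpha> s p) (at s within {s0..s1})"
      using s p by (intro integral_has_real_derivative slice1[OF ct(1), of p s]) auto
    then have "((\<lambda>s. integral {s0..s} (\<lambda>t. \<alpha> t p)) has_real_derivative \<alpha> s p) (at s)"
      using s by (simp add: at_within_Icc_at)
    then show ?thesis
      unfolding \<Phi>_def by (auto intro!: derivative_eq_intros)
  qed
  have 2: "(\<Phi> s has_real_derivative \<beta> s p) (at p)"
    if s: "s \<in> {s0<..<s1}" and p: "p \<in> {p0<..<p1}" for s p
  proof -
    \<comment> \<open>Differentiation under the integral produces the integral of \<gamma>, which is
      \<open>\<beta> s p - \<beta> s0 p\<close>; the edge integral supplies the missing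
      \<open>\<beta> s0 p\<close>.\<close>
    have "((\<lambda>p. integral (cbox s0 s) (\<lambda>t. \<alpha> t p)) has_real_derivative
        integral (cbox s0 s) (\<lambda>t. \<gamma> t p)) (at p within {p0..p1})"
    proof (rule leibniz_rule_field_derivative[where fx="\<lambda>p t. \<gamma> t p"])
      show "((\<lambda>p. \<alpha> t p) has_real_derivative \<gamma> t p) (at p within {p0..p1})"
        if "p \<in> {p0..p1}" "t \<in> cbox s0 s" for p t
        using s that by (intro has_field_derivative_at_within[OF d\<alpha>]) auto
      show "(\<lambda>t. \<alpha> t p) integrable_on cbox s0 s" if "p \<in> {p0..p1}" for p
        unfolding cbox_interval using s that
        by (intro integrable_continuous_real continuous_on_subset[OF slice1[OF ct(1), of p s]]) auto
      have "continuous_on ({p0..p1} \<times> cbox s0 s) (\<lambda>w. case (snd w, fst w) of (s, p) \<Rightarrow> \<gamma> s p)"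
        by (rule continuous_on_compose2[OF ct(3)]; use s in \<open>auto intro!: continuous_intros\<close>)
      then show "continuous_on ({p0..p1} \<times> cbox s0 s) (\<lambda>(p, t). \<gamma> t p)"
        by (simp add: case_prod_beta)
    qed (use p in auto)
    moreover have "((\<lambda>t. \<gamma> t p) has_integral \<beta> s p - \<beta> s0 p) {s0..s}"
    proof (rule fundamental_theorem_of_calculus[where f="\<lambda>s. \<beta> s p"])
      show "((\<lambda>s. \<beta> s p) has_vector_derivative \<gamma> t p) (at t within {s0..s})" if "t \<in> {s0..s}" for t
        unfolding has_real_derivative_iff_has_vector_derivative[symmetric]
        using s p that by (intro has_field_derivative_at_within[OF d\<beta>]) auto
    qed (use s in auto)
    then have "integral {s0..s} (\<lambda>t. \<gamma> t p) = \<beta> s p - \<beta> s0 p"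
      by (rule integral_unique)
    moreover have "((\<lambda>p. integral {p0..p} (\<beta> s0)) has_real_derivative \<beta> s0 p) (at p within {p0..p1})"
      using s p by (intro integral_has_real_derivative slice2[OF ct(2), of p s0]) auto
    ultimately have "(\<Phi> s has_real_derivative (\<beta> s p - \<beta> s0 p + \<beta> s0 p)) (at p within {p0..p1})"
      unfolding \<Phi>_def by (intro DERIV_add) auto
    then show ?thesis
      using p by (simp add: at_within_Icc_at)
  qed
  \<comment> \<open>Joint continuity comes from total differentiability, which follows from the two
    partials because \<beta> is continuous.\<close>
  have 3: "continuous_on ({s0<..<s1} \<times> {p0<..<p1}) (\<lambda>(s, p). \<Phi> s p)"
    unfolding continuous_on_eq_continuous_within
  proof safe
    fix s p assume s: "s \<in> {s0<..<s1}" and p: "p \<in> {p0<..<p1}"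
    have "continuous_on ({s0<..<s1} \<times> {p0<..<p1}) (\<lambda>(s, p). blinfun_mult_right (\<beta> s p))"
      unfolding split_beta
      by (intro continuous_intros continuous_on_subset[OF ct(2)[unfolded split_beta]]) auto
    then have "((\<lambda>(s, p). \<Phi> s p) has_derivative
        (\<lambda>(ts, tp). \<alpha> s p * ts + blinfun_mult_right (\<beta> s p) tp)) (at (s, p) within {s0<..<s1} \<times> {p0<..<p1})"
      using s p 1[OF s p] 2
      by (intro has_derivative_partialsI)
        (auto simp: has_field_derivative_def continuous_on_eq_continuous_within
          intro: has_derivative_at_withinI)
    then show "continuous (at (s, p) within {s0<..<s1} \<times> {p0<..<p1}) (\<lambda>(s, p). \<Phi> s p)"
      by (rule has_derivative_continuous)
  qed
  show thesis
    by (rule that[OF 1 2 3])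
qed

section \<open>Replacing one coordinate by a parameter\<close>

definition upd :: "3 \<Rightarrow> real \<Rightarrow> real^3 \<Rightarrow> real^3" where
  "upd l s u = (\<chi> m. if m = l then s else u $ m)"

lemma upd_nth: "upd l s u $ m = (if m = l then s else u $ m)"
  by (simp add: upd_def)

lemma upd_affine: "upd l (s + t * s') (u + t *\<^sub>R u') = upd l s u + t *\<^sub>R upd l s' u'"
  by (simp add: upd_def vec_eq_iff)

lemma upd_e: "upd l 0 (e m) = (if m = l then 0 else e m)" "upd l 1 0 = e l" "upd l 0 0 = 0"
  by (auto simp: upd_def vec_eq_iff e_nth)

lemma upd_line: "upd l s u = u + (s - u $ l) *\<^sub>R e l"
  by (simp add: upd_def vec_eq_iff e_nth)

lemma continuous_on_upd [continuous_intros]: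
  "continuous_on S f \<Longrightarrow> continuous_on S g \<Longrightarrow> continuous_on S (\<lambda>w. upd l (f w) (g w))"
  unfolding upd_line by (intro continuous_intros)

lemma hasdd_fst: "hasdd F v (fst w) D \<Longrightarrow> hasdd (\<lambda>w. F (fst w)) (v, s) w D"
  by (rule hasdd_compose_affine[where L'=fst]) auto

lemma hasdd_fst_snd: "hasdd (\<lambda>w. F (fst w)) (0, s) w 0"
  by (simp add: hasdd_def)

lemma hasdd_upd:
  "hasdd F (upd l s v) (upd l (snd w) (fst w)) D \<Longrightarrow> hasdd (\<lambda>w. F (upd l (snd w) (fst w))) (v, s) w D"
  by (rule hasdd_compose_affine[where L'="\<lambda>w. upd l (snd w) (fst w)"]) (auto simp: upd_affine)

lemma hasdd_upd_upd:
  "hasdd F (upd m 0 (upd l s v)) (upd m c (upd l (snd w) (fst w))) D \<Longrightarrow>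
    hasdd (\<lambda>w. F (upd m c (upd l (snd w) (fst w)))) (v, s) w D"
  using upd_affine[of m c _ 0]
  by (intro hasdd_compose_affine[where L'="\<lambda>w. upd m 0 (upd l (snd w) (fst w))"]) (auto simp: upd_affine)

lemma smooth_on_fst:
  assumes "smooth_on U F" "open W" "\<And>w. w \<in> W \<Longrightarrow> fst w \<in> U"
  shows "smooth_on W (\<lambda>w :: (real^3) \<times> real. F (fst w))"
  by (rule smooth_on_compose_affine[OF assms(1,2), where L'=fst])
    (use assms(3) in \<open>auto simp: Basis_prod_e intro!: continuous_intros\<close>)

lemma smooth_on_upd:
  assumes "smooth_on U F" "open W" "\<And>w. w \<in> W \<Longrightarrow> upd l (snd w) (fst w) \<in> U"
  shows "smooth_on W (\<lambda>w :: (real^3) \<times> real. F (upd l (snd w) (fst w)))"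
  by (rule smooth_on_compose_affine[OF assms(1,2), where L'="\<lambda>w. upd l (snd w) (fst w)"])
    (use assms(3) in \<open>auto simp: Basis_prod_e upd_affine upd_e intro!: continuous_intros\<close>)

lemma smooth_on_upd_upd:
  assumes "smooth_on U F" "open W" "\<And>w. w \<in> W \<Longrightarrow> upd m c (upd l (snd w) (fst w)) \<in> U"
  shows "smooth_on W (\<lambda>w :: (real^3) \<times> real. F (upd m c (upd l (snd w) (fst w))))"
  using upd_affine[of m c _ 0]
  by (intro smooth_on_compose_affine[OF assms(1,2), where L'="\<lambda>w. upd m 0 (upd l (snd w) (fst w))"])
    (use assms(3) in \<open>auto simp: Basis_prod_e upd_affine upd_e intro!: continuous_intros\<close>)

section \<open>Coordinate cubes\<close>

definition cube :: "real^3 \<Rightarrow> real \<Rightarrow> (real^3) set" where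
  "cube c r = {u. \<forall>l. \<bar>u $ l - c $ l\<bar> < r}"

lemma open_cube: "open (cube c r)"
proof -
  have "cube c r = (\<Inter>l. {u. \<bar>u $ l - c $ l\<bar> < r})"
    by (auto simp: cube_def)
  then show ?thesis
    by (auto intro!: open_INT open_Collect_less continuous_intros)
qed

lemma center_in_cube: "0 < r \<Longrightarrow> c \<in> cube c r"
  by (simp add: cube_def)

lemma cube_mono: "r \<le> s \<Longrightarrow> cube c r \<subseteq> cube c s"
  unfolding cube_def using less_le_trans by blast

lemma cube_in_open:
  assumes "open U" "c \<in> U"
  obtains r where "0 < r" "cube c r \<subseteq> U"
proof -
  obtain d where d: "d > 0" "ball c d \<subseteq> U"
    using assms open_contains_ball by blast
  \<comment> \<open>The Euclidean norm is at most the sum of the three coordinates, hence at most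
    3d/4.\<close>
  have "cube c (d / 4) \<subseteq> ball c d"
  proof
    fix u assume u: "u \<in> cube c (d / 4)"
    have "norm (c - u) \<le> (\<Sum>l\<in>UNIV. \<bar>(c - u) $ l\<bar>)"
      by (rule norm_le_l1_cart)
    also have "\<dots> \<le> (\<Sum>l\<in>(UNIV :: 3 set). d / 4)"
      using u by (intro sum_mono) (auto simp: cube_def abs_minus_commute intro: less_imp_le)
    also have "\<dots> < d" using d by (simp add: sum_3)
    finally show "u \<in> ball c d" by (simp add: dist_norm)
  qed
  then show thesis using that[of "d / 4"] d by auto
qed

lemma upd_in_cube: "u \<in> cube c r \<Longrightarrow> \<bar>s - c $ l\<bar> < r \<Longrightarrow> upd l s u \<in> cube c r"
  by (auto simp: cube_def upd_nth)

text \<open>The reason for working with cubes instead of balls: one coordinate can be moved to any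
  admissible value, whatever the others are, without leaving the set.\<close>

lemma segment_in_cube:
  assumes "u \<in> cube c r" "\<bar>s - c $ l\<bar> < r" "t \<in> closed_segment 0 (s - u $ l)"
  shows "u + t *\<^sub>R e l \<in> cube c r"
proof -
  have *: "u + t *\<^sub>R e l = upd l (u $ l + t) u"
    by (simp add: upd_line)
  have "\<bar>u $ l - c $ l\<bar> < r" using assms(1) by (simp add: cube_def)
  then have "\<bar>u $ l + t - c $ l\<bar> < r"
    using assms(2,3) by (auto simp: closed_segment_eq_real_ivl split: if_splits)
  then show ?thesis
    unfolding * by (rule upd_in_cube[OF assms(1)])
qed

lemma const_upd:
  assumes "u \<in> cube c r" "\<bar>s - c $ l\<bar> < r" "\<And>v. v \<in> cube c r \<Longrightarrow> hasdd F (e l) v 0"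
  shows "F (upd l s u) = F u"
  unfolding upd_line using segment_in_cube[OF assms(1,2)] assms(3) by (intro const_along_direction) auto

text \<open>The form a du_j + b dp is closed and its coefficients depend on (u_j, p) only, so the
  problem reduces to the planar Poincare lemma; smoothness of the primitive comes from its
  partials.\<close>

lemma closed_form_primitive:
  fixes a b :: "(real^3) \<times> real \<Rightarrow> real"
  assumes dist: "i \<noteq> j" "k \<noteq> j" "i \<noteq> k" and univ: "UNIV = {i, j, k :: 3}"
    and r: "0 < r" and V: "V = cube c r \<times> {q - r<..<q + r}"
    and sm: "smooth_on V a" "smooth_on V b"
    and a0: "\<And>w. w \<in> V \<Longrightarrow> hasdd a (e i, 0) w 0" "\<And>w. w \<in> V \<Longrightarrow> hasdd a (e k, 0) w 0"
    and b0: "\<And>w. w \<in> V \<Longrightarrow> hasdd b (e i, 0) w 0" "\<And>w. w \<in> V \<Longrightarrow> hasdd b (e k, 0) w 0"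
    and closed: "\<And>w. w \<in> V \<Longrightarrow> hasdd a (0, 1) w (h w)" "\<And>w. w \<in> V \<Longrightarrow> hasdd b (e j, 0) w (h w)"
    and W: "W = cube c (r / 2) \<times> {q - r / 2<..<q + r / 2}"
  obtains F where "smooth_on W F"
    "\<And>w. w \<in> W \<Longrightarrow> hasdd F (e i, 0) w 0" "\<And>w. w \<in> W \<Longrightarrow> hasdd F (e k, 0) w 0"
    "\<And>w. w \<in> W \<Longrightarrow> hasdd F (e j, 0) w (a w)" "\<And>w. w \<in> W \<Longrightarrow> hasdd F (0, 1) w (b w)"
proof -
  have oV: "open V" and oW: "open W"
    unfolding V W by (auto intro!: open_Times open_cube)
  have WV: "W \<subseteq> V"
    using cube_mono[of "r / 2" r c] r unfolding V W by auto
  have smh: "smooth_on V h"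
    by (rule smooth_on_eq[OF smooth_on_dd[OF sm(1)] oV, of "(0, 1)"])
      (auto intro: hasdd_imp_dd closed simp: Basis_prod_e)
  \<comment> \<open>Moving u_i and u_k to the centre of the cube does not change the value, so
    everything may be evaluated on the slice \<open>upd j s c\<close>.\<close>
  have reduce: "F (u, p) = F (upd j (u $ j) c, p)"
    if F: "\<And>w. w \<in> V \<Longrightarrow> hasdd F (e i, 0) w 0" "\<And>w. w \<in> V \<Longrightarrow> hasdd F (e k, 0) w 0"
      and up: "(u, p) \<in> V" for F :: "(real^3) \<times> real \<Rightarrow> real" and u p
  proof -
    have p: "p \<in> {q - r<..<q + r}" and u: "u \<in> cube c r" using up by (auto simp: V)
    have slice: "hasdd (\<lambda>u. F (u, p)) (e l) v 0" if "hasdd F (e l, 0) (v, p) 0" for l v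
      using that by (simp add: hasdd_def)
    have "F (upd i (c $ i) u, p) = F (u, p)"
      using p r by (intro const_upd[OF u, where F="\<lambda>u. F (u, p)"] slice F(1)) (auto simp: V)
    moreover have u': "upd i (c $ i) u \<in> cube c r"
      using r by (intro upd_in_cube u) auto
    have "F (upd k (c $ k) (upd i (c $ i) u), p) = F (upd i (c $ i) u, p)"
      using p r by (intro const_upd[OF u', where F="\<lambda>u. F (u, p)"] slice F(2)) (auto simp: V)
    moreover have "upd k (c $ k) (upd i (c $ i) u) = upd j (u $ j) c"
    proof -
      have "m = i \<or> m = j \<or> m = k" for m using univ by auto
      then show ?thesis using dist by (auto simp: vec_eq_iff upd_nth)
    qed
    ultimately show ?thesis by simp
  qed
  \<comment> \<open>Halving the radius makes the closed rectangle lie in \<open>V\<close>, while its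
    interior still covers \<open>W\<close>.\<close>
  define s0 s1 p0 p1 where "s0 = c $ j - r / 2" and "s1 = c $ j + r / 2" and "p0 = q - r / 2" and "p1 = q + r / 2"
  have inV: "(upd j s c, p) \<in> V" if "s \<in> {s0..s1}" "p \<in> {p0..p1}" for s p
    using that r unfolding V s0_def s1_def p0_def p1_def
    by (auto intro!: upd_in_cube center_in_cube)
  have ct: "continuous_on ({s0..s1} \<times> {p0..p1}) (\<lambda>(s, p). F (upd j s c, p))"
    if "smooth_on V F" for F :: "(real^3) \<times> real \<Rightarrow> real"
    unfolding split_beta
    by (rule continuous_on_compose2[OF smooth_on_continuous[OF that]])
      (use inV in \<open>auto intro!: continuous_intros\<close>)
  have dA: "((\<lambda>p. a (upd j s c, p)) has_real_derivative h (upd j s c, p)) (at p)"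
    if "s \<in> {s0..s1}" "p \<in> {p0..p1}" for s p
    using DERIV_line[of a "(0, 1)" "(upd j s c, 0)" p] closed(1)[OF inV[OF that]] by simp
  have updj: "upd j s c + t *\<^sub>R e j = upd j (s + t) c" for s t
    by (auto simp: vec_eq_iff upd_nth e_nth)
  have dB: "((\<lambda>s. b (upd j s c, p)) has_real_derivative h (upd j s c, p)) (at s)"
    if "s \<in> {s0..s1}" "p \<in> {p0..p1}" for s p
    using DERIV_line[of b "(e j, 0)" "(upd j 0 c, p)" s] closed(2)[OF inV[OF that]] by (simp add: updj)
  obtain \<Phi> where \<Phi>:
    "\<And>s p. s \<in> {s0<..<s1} \<Longrightarrow> p \<in> {p0<..<p1} \<Longrightarrow> ((\<lambda>s. \<Phi> s p) has_real_derivative a (upd j s c, p)) (at s)"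
    "\<And>s p. s \<in> {s0<..<s1} \<Longrightarrow> p \<in> {p0<..<p1} \<Longrightarrow> (\<Phi> s has_real_derivative b (upd j s c, p)) (at p)"
    "continuous_on ({s0<..<s1} \<times> {p0<..<p1}) (\<lambda>(s, p). \<Phi> s p)"
    using poincare_rectangle[OF ct[OF sm(1)] ct[OF sm(2)] ct[OF smh] dA dB] by blast
  define F where "F w = \<Phi> (fst w $ j) (snd w)" for w :: "(real^3) \<times> real"
  have inW: "fst w $ j \<in> {s0<..<s1}" "snd w \<in> {p0<..<p1}" if "w \<in> W" for w
  proof -
    from that have "\<bar>fst w $ j - c $ j\<bar> < r / 2" "snd w \<in> {q - r / 2<..<q + r / 2}"
      by (auto simp: W cube_def)
    then show "fst w $ j \<in> {s0<..<s1}" "snd w \<in> {p0<..<p1}"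
      unfolding s0_def s1_def p0_def p1_def greaterThanLessThan_iff by linarith+
  qed
  have "hasdd F (e l, 0) w 0" if "l \<noteq> j" for l w
    using that by (simp add: hasdd_def F_def e_nth)
  then have 1: "hasdd F (e i, 0) w 0" "hasdd F (e k, 0) w 0" for w
    using dist by auto
  have 2: "hasdd F (e j, 0) w (a w)" if "w \<in> W" for w
  proof -
    have "((\<lambda>s. \<Phi> (fst w $ j + s) (snd w)) has_real_derivative a (upd j (fst w $ j) c, snd w)) (at 0)"
      using \<Phi>(1)[OF inW[OF that]] DERIV_shift[of "\<lambda>s. \<Phi> s (snd w)" _ 0 "fst w $ j"]
      by (simp add: add.commute)
    moreover have "a w = a (upd j (fst w $ j) c, snd w)"
      using reduce[OF a0, of "fst w" "snd w"] that WV by auto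
    ultimately show ?thesis
      by (simp add: hasdd_def F_def e_nth)
  qed
  have 3: "hasdd F (0, 1) w (b w)" if "w \<in> W" for w
  proof -
    have "((\<lambda>s. \<Phi> (fst w $ j) (snd w + s)) has_real_derivative b (upd j (fst w $ j) c, snd w)) (at 0)"
      using \<Phi>(2)[OF inW[OF that]] DERIV_shift[of "\<Phi> (fst w $ j)" _ 0 "snd w"]
      by (simp add: add.commute)
    moreover have "b w = b (upd j (fst w $ j) c, snd w)"
      using reduce[OF b0, of "fst w" "snd w"] that WV by auto
    ultimately show ?thesis
      by (simp add: hasdd_def F_def)
  qed
  have cF: "continuous_on W F"
  proof -
    have "continuous_on W (\<lambda>w. case (fst w $ j, snd w) of (s, p) \<Rightarrow> \<Phi> s p)"
      by (rule continuous_on_compose2[OF \<Phi>(3)]) (use inW in \<open>auto intro!: continuous_intros\<close>)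
    then show ?thesis by (simp add: F_def)
  qed
  have "smooth_on W F"
  proof (rule smooth_onI_partials[OF oW cF,
      where D="\<lambda>v. if v = (0, 1) then b else if v = (e j, 0) then a else (\<lambda>_. 0)"])
    fix v :: "(real^3) \<times> real" and w assume v: "v \<in> Basis" and w: "w \<in> W"
    have "l = i \<or> l = j \<or> l = k" for l using univ by auto
    moreover have "v = (0, 1) \<or> (\<exists>l. v = (e l, 0))"
      using v by (auto simp: Basis_prod_e)
    ultimately consider "v = (0, 1)" | "v = (e i, 0)" | "v = (e j, 0)" | "v = (e k, 0)"
      by metis
    then show "hasdd F v w ((if v = (0, 1) then b else if v = (e j, 0) then a else (\<lambda>_. 0)) w)"
    proof cases
      case 2
      moreover have "e i \<noteq> e j" using dist by (metis e_nth zero_neq_one)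
      ultimately show ?thesis using 1(1) by simp
    next
      case 4
      moreover have "e k \<noteq> e j" using dist by (metis e_nth zero_neq_one)
      ultimately show ?thesis using 1(2) by simp
    qed (use 2 3 w in auto)
  next
    fix v :: "(real^3) \<times> real"
    show "smooth_on W (if v = (0, 1) then b else if v = (e j, 0) then a else (\<lambda>_. 0))"
      using smooth_on_subset[OF sm(1) WV] smooth_on_subset[OF sm(2) WV] smooth_on_const[OF oW] by auto
  qed
  from that[OF this 1 2 3] show thesis .
qed

subsection \<open>The non-degenerate case\<close>

context hydro_system
begin

lemma dd_i_rk: "u \<in> U \<Longrightarrow> dd (e i) rk u = (dd (e i) y u * z u * x u - y u * z u * dd (e i) x u) / (x u * x u)"
  by (rule hasdd_imp_dd, rule hasdd_eq_rhs, (rule hasdd_intros hasdd_basic nz | assumption)+)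
    (simp add: third0)

lemma dd_k_ri: "u \<in> U \<Longrightarrow> dd (e k) ri u = (x u * dd (e k) y u * z u - x u * y u * dd (e k) z u) / (z u * z u)"
  by (rule hasdd_imp_dd, rule hasdd_eq_rhs, (rule hasdd_intros hasdd_basic nz | assumption)+)
    (simp add: third0)

lemma dd_dd_zero:
  assumes "smooth_on U F" "u \<in> U" "\<And>v. v \<in> U \<Longrightarrow> dd (e l) F v = 0"
  shows "dd (e l) (dd (e m) F) u = 0"
  using dd_commute[OF assms(1) U assms(2), of "e l" "e m"] dd_zero_fun[OF assms(2,3)] by simp

text \<open>The derivative of N = Y/(Z X1) - Y/(X Z1) along i is the difference of the two sides of
  the hypothesis divided by \<open>Z * Z1\<close>; along k the divisor is \<open>X * X1\<close>. The
  hypotheses say that a derivative of \<open>rk\<close>, respectively \<open>ri\<close>, is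
  unaffected by freezing u_j.\<close>

lemma N_direction_zero:
  fixes Y :: real
  assumes nz: "X \<noteq> 0" "Z \<noteq> 0" "X1 \<noteq> 0" "Z1 \<noteq> 0"
  shows "(dY * Z * X - Y * Z * dX) / (X * X) = (dY * Z1 * X1 - Y * Z1 * dX1) / (X1 * X1) \<Longrightarrow>
      (dY * (Z * X1) - Y * (0 * X1 + Z * dX1)) / (Z * X1 * (Z * X1))
      - (dY * (X * Z1) - Y * (dX * Z1 + X * 0)) / (X * Z1 * (X * Z1)) = 0"
    and "(X * dY * Z - X * Y * dZ) / (Z * Z) = (X1 * dY * Z1 - X1 * Y * dZ1) / (Z1 * Z1) \<Longrightarrow>
      (dY * (Z * X1) - Y * (dZ * X1 + Z * 0)) / (Z * X1 * (Z * X1))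
      - (dY * (X * Z1) - Y * (0 * Z1 + X * dZ1)) / (X * Z1 * (X * Z1)) = 0"
proof -
  assume h: "(dY * Z * X - Y * Z * dX) / (X * X) = (dY * Z1 * X1 - Y * Z1 * dX1) / (X1 * X1)"
  have "(dY * (Z * X1) - Y * (0 * X1 + Z * dX1)) / (Z * X1 * (Z * X1))
      - (dY * (X * Z1) - Y * (dX * Z1 + X * 0)) / (X * Z1 * (X * Z1))
    = ((dY * Z1 * X1 - Y * Z1 * dX1) / (X1 * X1) - (dY * Z * X - Y * Z * dX) / (X * X)) / (Z * Z1)"
    using nz by (simp add: divide_simps) algebra
  with h show "(dY * (Z * X1) - Y * (0 * X1 + Z * dX1)) / (Z * X1 * (Z * X1))
      - (dY * (X * Z1) - Y * (dX * Z1 + X * 0)) / (X * Z1 * (X * Z1)) = 0" by simp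
next
  assume h: "(X * dY * Z - X * Y * dZ) / (Z * Z) = (X1 * dY * Z1 - X1 * Y * dZ1) / (Z1 * Z1)"
  have "(dY * (Z * X1) - Y * (dZ * X1 + Z * 0)) / (Z * X1 * (Z * X1))
      - (dY * (X * Z1) - Y * (0 * Z1 + X * dZ1)) / (X * Z1 * (X * Z1))
    = ((X * dY * Z - X * Y * dZ) / (Z * Z) - (X1 * dY * Z1 - X1 * Y * dZ1) / (Z1 * Z1)) / (X * X1)"
    using nz by (simp add: divide_simps) algebra
  with h show "(dY * (Z * X1) - Y * (dZ * X1 + Z * 0)) / (Z * X1 * (Z * X1))
      - (dY * (X * Z1) - Y * (0 * Z1 + X * dZ1)) / (X * Z1 * (X * Z1)) = 0" by simp
qed

text \<open>Freezing \<open>u\<^sub>j\<close> at the value \<open>p\<close> turns \<open>H\<^sub>i\<^sub>j\<close> and \<open>H\<^sub>j\<^sub>k\<close> into the components of the gradient of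
  \<open>g\<close>; the remaining component is then determined by the characteristic conic and is proportional to
  \<open>1 / N\<close>.\<close>

lemma nondegenerate_case:
  assumes b: "b \<in> U" and nd: "dd (e j) x b * z b \<noteq> x b * dd (e j) z b"
  shows "\<exists>W f g. W \<subseteq> U \<times> UNIV \<and> is_disp_lax_pair lam H W f g"
proof -
  obtain d where d: "0 < d" "cube b d \<subseteq> U"
    using cube_in_open[OF U b] by blast
  \<comment> \<open>\<open>L\<close> replaces u_j by p. \<open>M\<close> also fixes u_k, which makes
    functions of \<open>M w\<close> independent of both u_j and u_k; as \<open>x\<close> is
    independent of u_k, this leaves \<open>x (L w)\<close> unchanged.\<close>
  define L where "L w = upd j (snd w) (fst w)" for w
  define M where "M w = upd k (b $ k) (L w)" for w
  define \<Omega> where "\<Omega> = cube b d \<times> {b $ j - d<..<b $ j + d}"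
  have o\<Omega>: "open \<Omega>" unfolding \<Omega>_def by (intro open_Times open_cube) auto
  have cub: "fst w \<in> cube b d" "L w \<in> cube b d" "M w \<in> cube b d" and sw: "\<bar>snd w - b $ j\<bar> < d"
    if "w \<in> \<Omega>" for w
    using that d unfolding L_def M_def \<Omega>_def by (auto intro!: upd_in_cube)
  have inU: "fst w \<in> U" "L w \<in> U" "M w \<in> U" if "w \<in> \<Omega>" for w
    using cub[OF that] d by auto
  have sm0: "smooth_on W (\<lambda>w. F (fst w))" "smooth_on W (\<lambda>w. F (L w))" "smooth_on W (\<lambda>w. F (M w))"
    if "smooth_on U F" "open W" "W \<subseteq> \<Omega>" for F W
    unfolding L_def M_def using that inU
    by (auto intro!: smooth_on_fst[OF that(1,2)] smooth_on_upd[OF that(1,2)] smooth_on_upd_upd[OF that(1,2)]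
        simp: L_def M_def)
  have constL: "F (L w) = F (fst w)"
    if "smooth_on U F" "\<And>v. v \<in> U \<Longrightarrow> dd (e j) F v = 0" "w \<in> \<Omega>" for F w
    unfolding L_def
    using smooth_on_hasdd[OF that(1) e_Basis, of _ j] that(2) d
    by (intro const_upd[OF cub(1)[OF that(3)] sw[OF that(3)]]) (metis subsetD)
  have constM: "F (M w) = F (L w)"
    if "smooth_on U F" "\<And>v. v \<in> U \<Longrightarrow> dd (e k) F v = 0" "w \<in> \<Omega>" for F w
    unfolding M_def
    using smooth_on_hasdd[OF that(1) e_Basis, of _ k] that(2) d
    by (intro const_upd[OF cub(2)[OF that(3)]]) (simp, metis subsetD)
  have D0: "hasdd (\<lambda>w. F (fst w)) (e l, 0) w (dd (e l) F (fst w))"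
    "hasdd (\<lambda>w. F (L w)) (e j, 0) w 0"
    "l \<noteq> j \<Longrightarrow> hasdd (\<lambda>w. F (L w)) (e l, 0) w (dd (e l) F (L w))"
    "hasdd (\<lambda>w. F (L w)) (0, 1) w (dd (e j) F (L w))"
    "hasdd (\<lambda>w. F (M w)) (e i, 0) w (dd (e i) F (M w))"
    "hasdd (\<lambda>w. F (M w)) (e j, 0) w 0"
    "hasdd (\<lambda>w. F (M w)) (e k, 0) w 0"
    "hasdd (\<lambda>w. F (M w)) (0, 1) w (dd (e j) F (M w))"
    if "smooth_on U F" "w \<in> \<Omega>" for F l w
    unfolding L_def M_def using dist smooth_on_hasdd[OF that(1) e_Basis inU(1)[OF that(2)]]
      smooth_on_hasdd[OF that(1) e_Basis inU(2)[OF that(2)]]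
      smooth_on_hasdd[OF that(1) e_Basis inU(3)[OF that(2)]]
    by (auto intro!: hasdd_fst hasdd_upd hasdd_upd_upd simp: upd_e hasdd_zero_dir L_def M_def)
  define x0 y0 z0 A0 x1 z1 where "x0 w = x (fst w)" and "y0 w = y (fst w)" and "z0 w = z (fst w)"
    and "A0 w = A (fst w)" and "x1 w = x (L w)" and "z1 w = z (L w)" for w :: "(real^3) \<times> real"
  define B1 B2 where "B1 w = B (L w)" and "B2 w = B (M w)" for w :: "(real^3) \<times> real"
  note fdefs = x0_def[abs_def] y0_def[abs_def] z0_def[abs_def] A0_def[abs_def] x1_def[abs_def] z1_def[abs_def]
    B1_def[abs_def] B2_def[abs_def]
  note defs = x0_def y0_def z0_def A0_def x1_def z1_def B1_def B2_def
  have nz0: "x0 w \<noteq> 0" "y0 w \<noteq> 0" "z0 w \<noteq> 0" "x1 w \<noteq> 0" "z1 w \<noteq> 0" if "w \<in> \<Omega>" for w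
    using nz inU[OF that] by (auto simp: defs)
  have smd: "smooth_on W x0" "smooth_on W y0" "smooth_on W z0" "smooth_on W A0" "smooth_on W x1" "smooth_on W z1"
    "smooth_on W B1" "smooth_on W B2" if "open W" "W \<subseteq> \<Omega>" for W
    unfolding defs by (rule sm0 smooth that)+
  \<comment> \<open>With a_i = \<open>x1 / mk\<close> and a_k = \<open>- z1 / mi\<close>, the conic
    gives a_j = - mj / (mi mk N).\<close>
  define N where "N w = y0 w / (z0 w * x1 w) - y0 w / (x0 w * z1 w)" for w
  have smN: "smooth_on \<Omega> N"
    unfolding N_def using nz0 by (intro smooth_on_intros smd o\<Omega>) auto
  \<comment> \<open>If \<open>N (b, p)\<close> vanished for all p near \<open>b $ j\<close>, then
    \<open>x b * z\<close> and \<open>z b * x\<close> would agree on the j-line through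
    \<open>b\<close>; differentiating at \<open>b\<close> would contradict
    \<open>nd\<close>.\<close>
  have "\<exists>p0. \<bar>p0 - b $ j\<bar> < d \<and> N (b, p0) \<noteq> 0"
  proof (rule ccontr)
    assume neg: "\<not> (\<exists>p0. \<bar>p0 - b $ j\<bar> < d \<and> N (b, p0) \<noteq> 0)"
    have "x b * z (b + t *\<^sub>R e j) - z b * x (b + t *\<^sub>R e j) = 0" if "\<bar>t\<bar> < d" for t
    proof -
      have w: "(b, b $ j + t) \<in> \<Omega>"
        using that d unfolding \<Omega>_def by (auto simp: center_in_cube abs_less_iff)
      have "N (b, b $ j + t) = 0"
        using neg that by auto
      then show ?thesis
        using nz0[OF w] by (simp add: N_def defs L_def upd_line field_simps)
    qed
    then have "\<forall>\<^sub>F t in nhds 0. x b * z (b + t *\<^sub>R e j) - z b * x (b + t *\<^sub>R e j) = (0::real)"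
      using d unfolding eventually_nhds_metric by (intro exI[of _ d]) (auto simp: dist_real_def)
    then have "((\<lambda>t. x b * z (b + t *\<^sub>R e j) - z b * x (b + t *\<^sub>R e j)) has_real_derivative 0) (at 0)
        \<longleftrightarrow> ((\<lambda>t. 0) has_real_derivative (0::real)) (at 0)"
      by (intro DERIV_cong_ev) auto
    then have "hasdd (\<lambda>u. x b * z u - z b * x u) (e j) b 0"
      by (simp add: hasdd_def)
    moreover have "hasdd (\<lambda>u. x b * z u - z b * x u) (e j) b (x b * dd (e j) z b - z b * dd (e j) x b)"
      by (rule hasdd_diff hasdd_cmult hasdd_basic b)+
    ultimately show False
      using hasdd_unique nd by fastforce
  qed
  then obtain p0 where p0: "\<bar>p0 - b $ j\<bar> < d" "N (b, p0) \<noteq> 0" by blast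
  have bp: "(b, p0) \<in> \<Omega>"
    using p0 d unfolding \<Omega>_def by (auto simp: center_in_cube abs_less_iff)
  have "open (\<Omega> \<inter> N -` (- {0}))"
    by (rule continuous_open_preimage[OF smooth_on_continuous[OF smN] o\<Omega>]) auto
  moreover have "(b, p0) \<in> \<Omega> \<inter> N -` (- {0})"
    using bp p0 by auto
  ultimately obtain S T where ST: "open S" "open T" "b \<in> S" "p0 \<in> T" "S \<times> T \<subseteq> \<Omega> \<inter> N -` (- {0})"
    by (rule open_prod_elim) auto
  obtain r1 where r1: "0 < r1" "cube b r1 \<subseteq> S"
    using cube_in_open[OF ST(1,3)] by blast
  obtain r2 where r2: "0 < r2" "ball p0 r2 \<subseteq> T"
    using ST(2,4) open_contains_ball by blast
  define r where "r = min r1 r2"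
  define V where "V = cube b r \<times> {p0 - r<..<p0 + r}"
  have r: "0 < r" using r1 r2 by (simp add: r_def)
  have "cube b r \<subseteq> S" using cube_mono[of r r1 b] r1 by (auto simp: r_def)
  moreover have "{p0 - r<..<p0 + r} \<subseteq> T"
  proof
    fix t assume "t \<in> {p0 - r<..<p0 + r}"
    moreover have "r \<le> r2" by (simp add: r_def)
    ultimately have "\<bar>p0 - t\<bar> < r2" unfolding greaterThanLessThan_iff by linarith
    then show "t \<in> T" using r2 by (auto simp: dist_real_def)
  qed
  ultimately have VO: "V \<subseteq> \<Omega>" and NV: "\<And>w. w \<in> V \<Longrightarrow> N w \<noteq> 0"
    using ST(5) unfolding V_def by blast+
  have oV: "open V" unfolding V_def by (intro open_Times open_cube) auto

  define Nj Np where "Nj w = y0 w * dd (e j) x (fst w) / (x0 w * x0 w * z1 w) - y0 w * dd (e j) z (fst w) / (z0 w * z0 w * x1 w)"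
    and "Np w = y0 w * dd (e j) z (L w) / (x0 w * z1 w * z1 w) - y0 w * dd (e j) x (L w) / (z0 w * x1 w * x1 w)" for w
  have yL: "dd (e i) y (L w) = dd (e i) y (fst w)" "dd (e k) y (L w) = dd (e k) y (fst w)" "y (L w) = y (fst w)"
    if "w \<in> \<Omega>" for w
    using that by (auto intro!: constL smooth_on_dd smooth dd_dd_zero third0)
  have xM: "x (M w) = x (L w)" "dd (e j) x (M w) = dd (e j) x (L w)" if "w \<in> \<Omega>" for w
    using that by (auto intro!: constM smooth_on_dd smooth dd_dd_zero third0)
  \<comment> \<open>By \<open>dd_ij_rk\<close> and \<open>dd_jk_ri\<close> these derivatives do not
    depend on u_j, so freezing u_j leaves them unchanged.\<close>
  have rkL: "dd (e i) rk (L w) = dd (e i) rk (fst w)" and riL: "dd (e k) ri (L w) = dd (e k) ri (fst w)"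
    if "w \<in> \<Omega>" for w
    using that by (auto intro!: constL smooth_on_dd smooth_r dd_ij_rk dd_jk_ri)
  have cjL: "mj * B (L w) - mk * rk (L w) - mi * ri (L w) = mj * B (fst w) - mk * rk (fst w) - mi * ri (fst w)"
    if "w \<in> \<Omega>" for w
  proof (rule constL[of "\<lambda>u. mj * B u - mk * rk u - mi * ri u", OF _ cj that])
    show "smooth_on U (\<lambda>u. mj * B u - mk * rk u - mi * ri u)"
      by (intro smooth_on_diff smooth_on_mult smooth_on_const smooth smooth_r U)
  qed
  have N1: "(dd (e i) y (fst w) * z0 w * x0 w - y0 w * z0 w * dd (e i) x (fst w)) / (x0 w * x0 w)
      = (dd (e i) y (fst w) * z1 w * x1 w - y0 w * z1 w * dd (e i) x (L w)) / (x1 w * x1 w)"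
    and N3: "(x0 w * dd (e k) y (fst w) * z0 w - x0 w * y0 w * dd (e k) z (fst w)) / (z0 w * z0 w)
      = (x1 w * dd (e k) y (fst w) * z1 w - x1 w * y0 w * dd (e k) z (L w)) / (z1 w * z1 w)" if "w \<in> \<Omega>" for w
    using rkL[OF that] riL[OF that] inU[OF that] yL[OF that] by (simp_all add: dd_i_rk dd_k_ri defs)
  have DN: "hasdd N v w ((dY * (z0 w * x1 w) - y0 w * (dZ * x1 w + z0 w * dX1)) / (z0 w * x1 w * (z0 w * x1 w))
      - (dY * (x0 w * z1 w) - y0 w * (dX * z1 w + x0 w * dZ1)) / (x0 w * z1 w * (x0 w * z1 w)))"
    if "w \<in> \<Omega>" "hasdd x0 v w dX" "hasdd y0 v w dY" "hasdd z0 v w dZ" "hasdd x1 v w dX1" "hasdd z1 v w dZ1"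
    for w v dX dY dZ dX1 dZ1
    unfolding N_def using nz0[OF that(1)] that by (intro hasdd_diff hasdd_divide hasdd_mult) auto
  have DF: "hasdd x0 (e l, 0) w (dd (e l) x (fst w))" "hasdd y0 (e l, 0) w (dd (e l) y (fst w))"
    "hasdd z0 (e l, 0) w (dd (e l) z (fst w))" "hasdd A0 (e l, 0) w (dd (e l) A (fst w))"
    "hasdd x0 (0, 1) w 0" "hasdd y0 (0, 1) w 0" "hasdd z0 (0, 1) w 0" "hasdd A0 (0, 1) w 0"
    if "w \<in> \<Omega>" for w l
    unfolding defs using that by (auto intro!: D0(1) smooth hasdd_fst_snd)
  have Di: "hasdd x0 (e i, 0) w (dd (e i) x (fst w))" "hasdd y0 (e i, 0) w (dd (e i) y (fst w))"
    "hasdd z0 (e i, 0) w 0" "hasdd x1 (e i, 0) w (dd (e i) x (L w))" "hasdd z1 (e i, 0) w 0"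
    if "w \<in> \<Omega>" for w
    using DF(1-4)[OF that, of i] D0(3)[OF smooth(4) that, of i] D0(3)[OF smooth(6) that, of i] inU[OF that] dist third0
    by (auto simp: fdefs)
  have Dk: "hasdd x0 (e k, 0) w 0" "hasdd y0 (e k, 0) w (dd (e k) y (fst w))"
    "hasdd z0 (e k, 0) w (dd (e k) z (fst w))" "hasdd x1 (e k, 0) w 0" "hasdd z1 (e k, 0) w (dd (e k) z (L w))"
    if "w \<in> \<Omega>" for w
    using DF(1-4)[OF that, of k] D0(3)[OF smooth(4) that, of k] D0(3)[OF smooth(6) that, of k] inU[OF that] dist third0
    by (auto simp: fdefs)
  have Dj: "hasdd x0 (e j, 0) w (dd (e j) x (fst w))" "hasdd y0 (e j, 0) w 0"
    "hasdd z0 (e j, 0) w (dd (e j) z (fst w))" "hasdd x1 (e j, 0) w 0" "hasdd z1 (e j, 0) w 0"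
    "hasdd A0 (e j, 0) w (dd (e i) x (fst w))"
    if "w \<in> \<Omega>" for w
    using DF(1-4)[OF that, of j] D0(2)[OF smooth(4) that] D0(2)[OF smooth(6) that] inU[OF that] third0 third
    by (auto simp: fdefs)
  have Dp: "hasdd x0 (0, 1) w 0" "hasdd y0 (0, 1) w 0" "hasdd z0 (0, 1) w 0"
    "hasdd x1 (0, 1) w (dd (e j) x (L w))" "hasdd z1 (0, 1) w (dd (e j) z (L w))"
    if "w \<in> \<Omega>" for w
    using DF[OF that] D0(4)[OF smooth(4) that] D0(4)[OF smooth(6) that] by (auto simp: fdefs)
  have DNi: "hasdd N (e i, 0) w 0" if "w \<in> \<Omega>" for w
    by (rule hasdd_eq_rhs[OF DN[OF that Di[OF that]]])
      (rule N_direction_zero(1)[OF nz0(1,3,4,5)[OF that] N1[OF that]])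
  have DNk: "hasdd N (e k, 0) w 0" if "w \<in> \<Omega>" for w
    by (rule hasdd_eq_rhs[OF DN[OF that Dk[OF that]]])
      (rule N_direction_zero(2)[OF nz0(1,3,4,5)[OF that] N3[OF that]])
  have DNj: "hasdd N (e j, 0) w (Nj w)" if "w \<in> \<Omega>" for w
    by (rule hasdd_eq_rhs[OF DN[OF that Dj(1-5)[OF that]]])
      (use nz0[OF that] in \<open>simp add: Nj_def divide_simps\<close>)
  have DNp: "hasdd N (0, 1) w (Np w)" if "w \<in> \<Omega>" for w
    by (rule hasdd_eq_rhs[OF DN[OF that Dp[OF that]]])
      (use nz0[OF that] in \<open>simp add: Np_def divide_simps\<close>)
  \<comment> \<open>This relation will give the equality of the p-derivative of a_j and the
    j-derivative of b_j.\<close>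
  have star: "mi * dd (e i) x (fst w) * x1 w * (N w)\<^sup>2 - mj * dd (e j) x (fst w) * N w
      + mj * x0 w * Nj w + mj * x1 w * Np w = 0" if "w \<in> \<Omega>" for w
    using gradient_relation_i[OF inU(1)[OF that]] gradient_relation_i[OF inU(2)[OF that]] gradient_relation_j[OF inU(1)[OF that]] gradient_relation_j[OF inU(2)[OF that]]
    by (intro compatibility_identity[OF nz0[OF that] _ _ _ _ N1[OF that] N3[OF that]])
      (auto simp: defs yL[OF that] Nj_def Np_def N_def)

  have Nzz: "N w * z0 w * z1 w = y0 w * z1 w / x1 w - y0 w * z0 w / x0 w"
    and Nxx: "N w * x0 w * x1 w = x0 w * y0 w / z0 w - x1 w * y0 w / z1 w"
    and Nxz: "x0 w / (N w * x1 w) = x0 w * z0 w / y0 w + z0 w / (z1 w * N w)"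
    if "w \<in> V" for w
  proof -
    have w: "w \<in> \<Omega>" using that VO by auto
    show "N w * z0 w * z1 w = y0 w * z1 w / x1 w - y0 w * z0 w / x0 w"
      "N w * x0 w * x1 w = x0 w * y0 w / z0 w - x1 w * y0 w / z1 w"
      using nz0[OF w] by (simp_all add: N_def field_simps)
    have "x0 w / x1 w - z0 w / z1 w = N w * (x0 w * z0 w / y0 w)"
      using nz0[OF w] by (simp add: N_def field_simps)
    then show "x0 w / (N w * x1 w) = x0 w * z0 w / y0 w + z0 w / (z1 w * N w)"
      using nz0[OF w] NV[OF that] by (simp add: field_simps)
  qed
  \<comment> \<open>The point on the conic described above; \<open>bi\<close> and \<open>bk\<close>
    are the p-derivatives of the explicit primitives \<open>Gi\<close> and \<open>Gk\<close> built
    from H_j below.\<close>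
  define ai aj ak where "ai w = x1 w / mk" and "aj w = - mj / (mi * mk) / N w" and "ak w = - z1 w / mi" for w
  define bi bk where "bi w = 1 / mk * B2 w" and "bk w = 1 / mi * (B2 w - B1 w)" for w
  \<comment> \<open>Obtained by solving the first Lax equation for bj.\<close>
  define bj where "bj w = 1 / mk * (mj * bk w
      - (A0 w - 1 / mi * (mj * (x0 w / (N w * x1 w)) + mk * (z1 w * y0 w / x1 w))))" for w
  define K1 K3 where "K1 u = mi * A u - mj * rj u - mk * rk u" and "K3 u = mk * C u - mi * ri u - mj * rj u" for u
  \<comment> \<open>In this form only quantities independent of u_i occur: \<open>K1\<close> by
    \<open>ci\<close>, \<open>N\<close> by \<open>DNi\<close>, and the difference of
    \<open>B1\<close> and \<open>B2\<close> inside \<open>bk\<close>.\<close>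
  have bj1: "bj w = 1 / mk * (mj * bk w - 1 / mi * (K1 (fst w) - mj * (z0 w / (z1 w * N w)) - mk * (N w * z0 w * z1 w)))"
    if "w \<in> V" for w
    unfolding bj_def Nzz[OF that] Nxz[OF that] using m0 by (simp add: K1_def defs field_simps)
  have Q2: "mj * (B (fst w) - B1 w) = mi * (N w * x0 w * x1 w) - mk * (N w * z0 w * z1 w)" if "w \<in> V" for w
    using cjL[of w] yL(3)[of w] that VO unfolding Nzz[OF that] Nxx[OF that] by (auto simp: defs algebra_simps)
  \<comment> \<open>The third Lax equation solved for bj, a form in which independence of u_k is
    visible. It agrees with the first by \<open>J\<close> and by \<open>Q2\<close>, which expresses
    that \<open>mj * B - mk * rk - mi * ri\<close> does not depend on u_j.\<close>
  have bj2: "bj w = 1 / mi * (mj * bi w + 1 / mk * (K3 (fst w) + mi * (N w * x0 w * x1 w) + mj * (x0 w / (N w * x1 w))))"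
    if "w \<in> V" for w
  proof -
    have "mi * mk * bj w = mj * (mi * bk w) - (K1 (fst w) - mj * (z0 w / (z1 w * N w)) - mk * (N w * z0 w * z1 w))"
      unfolding bj1[OF that] using m0 by (simp add: field_simps)
    also have "\<dots> = mj * (mk * bi w) + (K3 (fst w) + mi * (N w * x0 w * x1 w) + mj * (x0 w / (N w * x1 w)))"
      using J[OF inU(1), of w] Q2[OF that] that VO m0
      unfolding Nxz[OF that] by (auto simp: K1_def K3_def bi_def bk_def defs algebra_simps)
    finally show ?thesis using m0 by (simp add: field_simps)
  qed
  have smK: "smooth_on U K1" "smooth_on U K3"
    unfolding K1_def K3_def by (intro smooth_on_diff smooth_on_mult smooth_on_const smooth smooth_r U)+
  have DK1: "hasdd (\<lambda>w. K1 (fst w)) (e i, 0) w 0" and DK3: "hasdd (\<lambda>w. K3 (fst w)) (e k, 0) w 0"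
    if "w \<in> \<Omega>" for w
    using D0(1)[OF smK(1) that, of i] D0(1)[OF smK(2) that, of k] ci[OF inU(1)[OF that]] ck[OF inU(1)[OF that]]
    by (simp_all add: K1_def[abs_def] K3_def[abs_def])
  have DB: "hasdd B1 (e i, 0) w (dd (e j) x (L w))" "hasdd B2 (e i, 0) w (dd (e j) x (L w))"
    "hasdd B1 (e j, 0) w 0" "hasdd B2 (e j, 0) w 0" "hasdd B2 (e k, 0) w 0"
    if "w \<in> \<Omega>" for w
    using D0(2,5,6,7)[OF smooth(2) that] D0(3)[OF smooth(2) that, of i] inU[OF that] xM[OF that] third(3) dist
    unfolding fdefs by auto
  have inO: "w \<in> \<Omega>" if "w \<in> V" for w using that VO by auto
  have ND: "N w \<noteq> 0" "z1 w * N w \<noteq> 0" "N w * x1 w \<noteq> 0" "x1 w \<noteq> 0" if "w \<in> V" for w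
    using NV[OF that] nz0[OF inO[OF that]] by auto
  have bji: "hasdd bj (e i, 0) w 0" if w: "w \<in> V" for w
  proof -
    have "hasdd (\<lambda>w. 1 / mk * (mj * bk w - 1 / mi * (K1 (fst w) - mj * (z0 w / (z1 w * N w)) - mk * (N w * z0 w * z1 w)))) (e i, 0) w 0"
      unfolding bk_def
      by (rule hasdd_eq_rhs)
        (rule hasdd_cmult hasdd_diff hasdd_divide hasdd_mult DK1 DB DNi Di inO w ND | simp)+
    then show ?thesis
      using hasdd_cong[OF oV w bj1] by simp
  qed
  have bjk: "hasdd bj (e k, 0) w 0" if w: "w \<in> V" for w
  proof -
    have "hasdd (\<lambda>w. 1 / mi * (mj * bi w + 1 / mk * (K3 (fst w) + mi * (N w * x0 w * x1 w) + mj * (x0 w / (N w * x1 w))))) (e k, 0) w 0"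
      unfolding bi_def
      by (rule hasdd_eq_rhs)
        (rule hasdd_cmult hasdd_add hasdd_divide hasdd_mult DK3 DB DNk Dk inO w ND | simp)+
    then show ?thesis
      using hasdd_cong[OF oV w bj2] by simp
  qed
  \<comment> \<open>The p-derivative of \<open>aj\<close>; by \<open>star\<close> it is also the
    j-derivative of \<open>bj\<close>.\<close>
  define h where "h w = mj / (mi * mk) * Np w / (N w)\<^sup>2" for w
  have bjj: "hasdd bj (e j, 0) w (h w)" if w: "w \<in> V" for w
  proof -
    have "hasdd bj (e j, 0) w (1 / mk * (mj * (1 / mi * (0 - 0)) - (dd (e i) x (fst w) - 1 / mi *
        (mj * ((dd (e j) x (fst w) * (N w * x1 w) - x0 w * (Nj w * x1 w + N w * 0)) / (N w * x1 w * (N w * x1 w)))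
          + mk * (((0 * y0 w + z1 w * 0) * x1 w - z1 w * y0 w * 0) / (x1 w * x1 w))))))"
      unfolding bj_def bk_def
      by (rule hasdd_cmult hasdd_diff hasdd_add hasdd_divide hasdd_mult DB DNj Dj inO w ND)+
    moreover have "mk * (mi * (1 / mk * (mj * (1 / mi * (0 - 0)) - (dd (e i) x (fst w) - 1 / mi *
        (mj * ((dd (e j) x (fst w) * (N w * x1 w) - x0 w * (Nj w * x1 w + N w * 0)) / (N w * x1 w * (N w * x1 w)))
          + mk * (((0 * y0 w + z1 w * 0) * x1 w - z1 w * y0 w * 0) / (x1 w * x1 w))))))) = mk * (mi * h w)"
      using star[OF inO[OF w]] ND[OF w] m0
      by (simp add: h_def divide_simps power2_eq_square) algebra
    ultimately show ?thesis
      using m0 by simp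
  qed
  have aj': "hasdd aj v w (mj / (mi * mk) * D / (N w)\<^sup>2)" if "w \<in> V" "hasdd N v w D" for v w D
    using hasdd_divide[OF hasdd_const that(2) ND(1)[OF that(1)], of "- mj / (mi * mk)"]
    unfolding aj_def by (rule hasdd_eq_rhs) (simp add: power2_eq_square)
  have aji: "hasdd aj (e i, 0) w 0" and ajk: "hasdd aj (e k, 0) w 0" and ajp: "hasdd aj (0, 1) w (h w)"
    if "w \<in> V" for w
    using aj'[OF that DNi[OF inO[OF that]]] aj'[OF that DNk[OF inO[OF that]]] aj'[OF that DNp[OF inO[OF that]]]
    by (simp_all add: h_def)
  have smab: "smooth_on V aj" "smooth_on V bj"
    unfolding aj_def bj_def bk_def using ND m0
    by (auto intro!: smooth_on_intros smd oV VO smooth_on_subset[OF smN VO])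
  define W where "W = cube b (r / 2) \<times> {p0 - r / 2<..<p0 + r / 2}"
  obtain Gj where Gj: "smooth_on W Gj" "\<And>w. w \<in> W \<Longrightarrow> hasdd Gj (e i, 0) w 0"
    "\<And>w. w \<in> W \<Longrightarrow> hasdd Gj (e k, 0) w 0" "\<And>w. w \<in> W \<Longrightarrow> hasdd Gj (e j, 0) w (aj w)"
    "\<And>w. w \<in> W \<Longrightarrow> hasdd Gj (0, 1) w (bj w)"
    using closed_form_primitive[OF _ _ _ univ r V_def smab aji ajk bji bjk ajp bjj W_def] dist by metis
  have oW: "open W" unfolding W_def by (intro open_Times open_cube) auto
  have WV: "W \<subseteq> V"
    using cube_mono[of "r / 2" r b] r unfolding W_def V_def by auto
  have WO: "W \<subseteq> \<Omega>" using WV VO by auto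
  have bW: "(b, p0) \<in> W" using r by (simp add: W_def center_in_cube)
  \<comment> \<open>Since Q = H_j has derivatives \<open>x\<close>, \<open>B\<close>,
    \<open>z\<close>, evaluating it at \<open>M w\<close> and \<open>L w\<close> yields primitives
    with exactly the components \<open>ai\<close>, \<open>bi\<close>, \<open>ak\<close>,
    \<open>bk\<close>.\<close>
  define Q where "Q = dd (e j) H"
  have smQ: "smooth_on U Q" unfolding Q_def by (intro smooth_on_dd smH e_Basis)
  have dQ: "dd (e i) Q u = x u" "dd (e j) Q u = B u" "dd (e k) Q u = z u" if "u \<in> U" for u
    using hess[OF that] by (simp_all add: Q_def Hdd_def)
  define Gi Gk where "Gi w = 1 / mk * Q (M w)" and "Gk w = 1 / mi * (Q (M w) - Q (L w))" for w
  have GiD: "hasdd Gi v w (1 / mk * D)" if "hasdd (\<lambda>w. Q (M w)) v w D" for v w D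
    unfolding Gi_def by (rule hasdd_cmult[OF that])
  have GkD: "hasdd Gk v w (1 / mi * (D - D'))" if "hasdd (\<lambda>w. Q (M w)) v w D" "hasdd (\<lambda>w. Q (L w)) v w D'" for v w D D'
    unfolding Gk_def by (intro hasdd_cmult hasdd_diff that)
  note D0Q = D0[OF smQ]
  have G: "hasdd Gi (e i, 0) w (ai w)" "hasdd Gi (e j, 0) w 0" "hasdd Gi (e k, 0) w 0" "hasdd Gi (0, 1) w (bi w)"
    "hasdd Gk (e i, 0) w 0" "hasdd Gk (e j, 0) w 0" "hasdd Gk (e k, 0) w (ak w)" "hasdd Gk (0, 1) w (bk w)"
    if "w \<in> W" for w
  proof -
    have w: "w \<in> \<Omega>" using that WO by auto
    note u = inU[OF w]
    show "hasdd Gi (e i, 0) w (ai w)" "hasdd Gi (e j, 0) w 0" "hasdd Gi (e k, 0) w 0" "hasdd Gi (0, 1) w (bi w)"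
      using GiD[OF D0Q(5)[OF w]] GiD[OF D0Q(6)[OF w]] GiD[OF D0Q(7)[OF w]] GiD[OF D0Q(8)[OF w]] xM[OF w]
      by (simp_all add: dQ u ai_def bi_def defs)
    show "hasdd Gk (e i, 0) w 0" "hasdd Gk (e j, 0) w 0" "hasdd Gk (e k, 0) w (ak w)" "hasdd Gk (0, 1) w (bk w)"
      using GkD[OF D0Q(5)[OF w] D0Q(3)[OF w]] GkD[OF D0Q(6)[OF w] D0Q(2)[OF w]]
        GkD[OF D0Q(7)[OF w] D0Q(3)[OF w]] GkD[OF D0Q(8)[OF w] D0Q(4)[OF w]] xM[OF w] dist
      by (simp_all add: dQ u ak_def bk_def defs)
  qed
  show ?thesis
  proof (rule lax_pair_separated[of W Gi Gj Gk ai bi aj bj ak bk])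
    show "open W" "W \<noteq> {}" "W \<subseteq> U \<times> UNIV"
      using oW bW inU(1) WO by force+
    show "smooth_on W Gi" "smooth_on W Gk"
      unfolding Gi_def Gk_def by (intro smooth_on_mult smooth_on_diff smooth_on_const sm0 smQ oW WO)+
    fix w assume wW: "w \<in> W"
    then have w: "w \<in> V" using WV by auto
    note n = ND[OF w] nz0[OF inO[OF w]] m0
    have f: "A (fst w) = A0 w" "x (fst w) = x0 w" "y (fst w) = y0 w" "z (fst w) = z0 w" by (simp_all add: defs)
    show "ai w * (mk * bj w - mj * bk w) + ai w * A (fst w) + aj w * x (fst w) + ak w * y (fst w) = 0"
    proof -
      have "mk * bj w - mj * bk w = - A0 w + 1 / mi * (mj * (x0 w / (N w * x1 w)) + mk * (z1 w * y0 w / x1 w))"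
        unfolding bj_def using m0 by simp
      note * = this
      show ?thesis
        unfolding f * using n by (simp add: ai_def aj_def ak_def field_simps)
    qed
    show "aj w * (mi * bk w - mk * bi w) + ai w * x (fst w) + aj w * B (fst w) + ak w * z (fst w) = 0"
    proof -
      have *: "mi * bk w - mk * bi w = - B1 w"
        using m0 by (simp add: bi_def bk_def)
      have "aj w * (mi * bk w - mk * bi w) + aj w * B (fst w)
          = - 1 / (mi * mk) / N w * (mj * (B (fst w) - B1 w))"
        unfolding * using n by (simp add: aj_def field_simps)
      also have "\<dots> = - (ai w * x (fst w)) - ak w * z (fst w)"
        unfolding Q2[OF w] f using n by (simp add: ai_def ak_def field_simps)
      finally show ?thesis by simp
    qed
    show "ak w * (mj * bi w - mi * bj w) + ai w * y (fst w) + aj w * z (fst w) + ak w * C (fst w) = 0"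
    proof -
      have "mj * bi w - mi * bj w = - (1 / mk * (K3 (fst w) + mi * (N w * x0 w * x1 w) + mj * (x0 w / (N w * x1 w))))"
        unfolding bj2[OF w] using m0 by simp
      also have "\<dots> = - C (fst w) + 1 / mk * (mi * (x1 w * y0 w / z1 w) - mj * (z0 w / (z1 w * N w)))"
        unfolding Nxx[OF w] Nxz[OF w] using m0 by (simp add: K3_def f field_simps)
      finally have *: "mj * bi w - mi * bj w
        = - C (fst w) + 1 / mk * (mi * (x1 w * y0 w / z1 w) - mj * (z0 w / (z1 w * N w)))" .
      show ?thesis
        unfolding f * using n by (simp add: ai_def aj_def ak_def field_simps)
    qed
    show "ai w \<noteq> 0" using n by (simp add: ai_def)
  qed (use G Gj in auto)
qed

end

subsection \<open>The flow on the conic\<close>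

text \<open>Separation of variables: \<Theta>, the integral of 1 / \<phi>, is strictly increasing,
  and its inverse, shifted to start at \<open>c\<close>, solves the equation.\<close>

lemma autonomous_ode_exists:
  fixes \<phi> :: "real \<Rightarrow> real"
  assumes cont: "continuous_on {a..b} \<phi>" and pos: "\<And>s. s \<in> {a..b} \<Longrightarrow> 0 < \<phi> s" and c: "a < c" "c < b"
  obtains \<delta> \<rho> where "0 < \<delta>"
    "\<And>t. \<bar>t\<bar> < \<delta> \<Longrightarrow> \<rho> t \<in> {a<..<b} \<and> (\<rho> has_real_derivative \<phi> (\<rho> t)) (at t)"
proof -
  define \<Theta> where "\<Theta> s = integral {a..s} (\<lambda>s. 1 / \<phi> s)" for s
  have "continuous_on {a..b} (\<lambda>s. 1 / \<phi> s)"
    using pos by (intro continuous_intros cont) force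
  then have D: "(\<Theta> has_real_derivative 1 / \<phi> s) (at s)" if "s \<in> {a<..<b}" for s
    using integral_has_real_derivative[of a b "\<lambda>s. 1 / \<phi> s" s] that
    unfolding \<Theta>_def by (simp add: at_within_Icc_at)
  \<comment> \<open>A smaller closed interval around \<open>c\<close>, so that \<Theta> is
    differentiable at its endpoints as well.\<close>
  define a' b' where "a' = (a + c) / 2" and "b' = (c + b) / 2"
  have ab: "a < a'" "a' < c" "c < b'" "b' < b"
    using c by (auto simp: a'_def b'_def)
  have mono: "\<Theta> s < \<Theta> t" if "a' \<le> s" "s < t" "t \<le> b'" for s t
  proof (rule DERIV_pos_imp_increasing[OF that(2)])
    fix v assume "s \<le> v" "v \<le> t"
    then have "v \<in> {a<..<b}" using that ab by auto
    then show "\<exists>y. (\<Theta> has_real_derivative y) (at v) \<and> 0 < y"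
      using D[of v] pos[of v] by (intro exI[of _ "1 / \<phi> v"]) auto
  qed
  have inj: "inj_on \<Theta> {a'..b'}"
    by (rule linorder_inj_onI) (use mono in force)+
  define \<rho> where "\<rho> = inv_into {a'..b'} \<Theta>"
  have \<rho>\<Theta>: "\<rho> (\<Theta> s) = s" if "a' \<le> s" "s \<le> b'" for s
    unfolding \<rho>_def using that by (intro inv_into_f_f inj) auto
  have cts: "isCont \<Theta> s" if "a' \<le> s" "s \<le> b'" for s
    using that ab by (intro DERIV_isCont[OF D]) auto
  have surj: "\<exists>s. a' < s \<and> s < b' \<and> \<Theta> s = \<tau>" if \<tau>: "\<Theta> a' < \<tau>" "\<tau> < \<Theta> b'" for \<tau>
  proof -
    obtain s where s: "a' \<le> s" "s \<le> b'" "\<Theta> s = \<tau>"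
      using IVT[of \<Theta> a' \<tau> b'] \<tau> ab cts by auto
    then show ?thesis using \<tau> by (intro exI[of _ s]) (auto simp: less_le)
  qed
  have main: "\<rho> \<tau> \<in> {a<..<b} \<and> (\<rho> has_real_derivative \<phi> (\<rho> \<tau>)) (at \<tau>)" if \<tau>: "\<Theta> a' < \<tau>" "\<tau> < \<Theta> b'" for \<tau>
  proof -
    obtain s where s: "a' < s" "s < b'" "\<Theta> s = \<tau>" using surj[OF \<tau>] by blast
    then have r: "\<rho> \<tau> = s" using \<rho>\<Theta>[of s] by auto
    have sI: "s \<in> {a<..<b}" using s ab by auto
    have "isCont \<rho> (\<Theta> s)"
      by (rule isCont_inverse_function2[where a=a' and b=b']) (fact s \<rho>\<Theta> cts)+
    moreover have "\<Theta> (\<rho> y) = y" if y: "\<Theta> a' < y" "y < \<Theta> b'" for y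
    proof -
      obtain v where v: "a' < v" "v < b'" "\<Theta> v = y" using surj[OF y] by blast
      then show ?thesis using \<rho>\<Theta>[of v] by simp
    qed
    ultimately have "(\<rho> has_real_derivative inverse (1 / \<phi> s)) (at \<tau>)"
      using D[OF sI] pos[of s] sI \<tau> r s(3)
      by (intro DERIV_inverse_function[where f=\<Theta> and a="\<Theta> a'" and b="\<Theta> b'"]) simp_all
    then show ?thesis using sI by (simp add: r)
  qed
  define \<delta> where "\<delta> = min (\<Theta> c - \<Theta> a') (\<Theta> b' - \<Theta> c)"
  show thesis
  proof (rule that[of \<delta> "\<lambda>t. \<rho> (\<Theta> c + t)"])
    show "0 < \<delta>" using mono[of a' c] mono[of c b'] ab by (simp add: \<delta>_def)
    fix t :: real assume "\<bar>t\<bar> < \<delta>"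
    then have "\<Theta> a' < \<Theta> c + t" "\<Theta> c + t < \<Theta> b'" by (auto simp: \<delta>_def abs_less_iff)
    from main[OF this] show "\<rho> (\<Theta> c + t) \<in> {a<..<b} \<and>
        ((\<lambda>t. \<rho> (\<Theta> c + t)) has_real_derivative \<phi> (\<rho> (\<Theta> c + t))) (at t)"
      using DERIV_shift[of \<rho> _ t "\<Theta> c"] by (simp add: add.commute)
  qed
qed

text \<open>The ratio \<open>\<rho> = n\<^sub>2 / n\<^sub>1\<close> satisfies a scalar autonomous equation because the product
  \<open>n\<^sub>1 n\<^sub>2 (n\<^sub>1 + n\<^sub>2)\<close> is a first integral, here normalised to \<open>1\<close>.\<close>

lemma conic_flow_exists:
  fixes K :: real
  obtains \<delta> n1 n2 where "0 < \<delta>"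
    "\<And>t. \<bar>t\<bar> < \<delta> \<Longrightarrow> n1 t \<noteq> 0 \<and> n2 t \<noteq> 0 \<and> n1 t + n2 t \<noteq> 0"
    "\<And>t. \<bar>t\<bar> < \<delta> \<Longrightarrow> (n1 has_real_derivative - K * n1 t * (n1 t + 2 * n2 t)) (at t)"
    "\<And>t. \<bar>t\<bar> < \<delta> \<Longrightarrow> (n2 has_real_derivative K * n2 t * (2 * n1 t + n2 t)) (at t)"
proof -
  \<comment> \<open>With q = n2 / n1 and n1 n2 (n1 + n2) = 1 one has n1 = (q (1 + q)) to the power
    -1/3, and the flow gives q' = 3 K times (q (1 + q)) to the power 2/3. The factor 3 K is left to
    a change of time, since \<phi> must be positive whatever the sign of K.\<close>
  define \<phi> where "\<phi> s = (s * (1 + s)) powr (2 / 3)" for s :: real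
  have "continuous_on {1/2..2} \<phi>"
    unfolding \<phi>_def by (auto intro!: continuous_intros)
  moreover have "0 < \<phi> s" if "s \<in> {1/2..2}" for s
    using that by (auto simp: \<phi>_def)
  ultimately obtain \<delta>' \<rho> where \<rho>: "0 < \<delta>'"
    "\<And>t. \<bar>t\<bar> < \<delta>' \<Longrightarrow> \<rho> t \<in> {1/2<..<2} \<and> (\<rho> has_real_derivative \<phi> (\<rho> t)) (at t)"
    by (rule autonomous_ode_exists[where c=1]) auto
  \<comment> \<open>The summand 1 keeps the divisor positive when K = 0.\<close>
  define \<delta> where "\<delta> = \<delta>' / (3 * \<bar>K\<bar> + 1)"
  have \<delta>: "0 < \<delta>" using \<rho>(1) by (simp add: \<delta>_def)
  define q where "q t = \<rho> (3 * K * t)" for t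
  define n1 where "n1 t = (q t * (1 + q t)) powr (- (1 / 3))" for t
  define n2 where "n2 t = q t * n1 t" for t
  have main: "q t > 0" "(q has_real_derivative 3 * K * (q t * (1 + q t)) powr (2 / 3)) (at t)" if "\<bar>t\<bar> < \<delta>" for t
  proof -
    have "\<bar>3 * K * t\<bar> \<le> (3 * \<bar>K\<bar> + 1) * \<bar>t\<bar>" by (simp add: abs_mult algebra_simps)
    also have "\<dots> < \<delta>'" using that by (simp add: \<delta>_def field_simps)
    finally have *: "\<rho> (3 * K * t) \<in> {1/2<..<2}" "(\<rho> has_real_derivative \<phi> (\<rho> (3 * K * t))) (at (3 * K * t))"
      using \<rho>(2) by auto
    then show "q t > 0" by (auto simp: q_def)
    have "((\<lambda>t. \<rho> (3 * K * t)) has_real_derivative \<phi> (\<rho> (3 * K * t)) * (3 * K)) (at t)"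
      by (rule DERIV_chain'[where f="\<lambda>t. 3 * K * t" and g=\<rho>]) (use * in \<open>auto intro!: derivative_eq_intros\<close>)
    then show "(q has_real_derivative 3 * K * (q t * (1 + q t)) powr (2 / 3)) (at t)"
      by (simp add: q_def[abs_def] \<phi>_def mult.commute)
  qed
  have n1pos: "n1 t > 0" if "\<bar>t\<bar> < \<delta>" for t
    using main(1)[OF that] by (simp add: n1_def)
  have D1: "(n1 has_real_derivative - K * n1 t * (n1 t + 2 * n2 t)) (at t)" if "\<bar>t\<bar> < \<delta>" for t
  proof -
    note q = main[OF that]
    define E where "E = q t * (1 + q t)"
    have E: "E > 0" using q(1) by (simp add: E_def)
    have "((\<lambda>t. q t * (1 + q t)) has_real_derivative 3 * K * E powr (2 / 3) * (1 + 2 * q t)) (at t)"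
      by (rule derivative_eq_intros q(2) refl)+ (simp add: E_def algebra_simps)
    from DERIV_fun_powr[OF this, of "- (1 / 3)"] E
    have "(n1 has_real_derivative - (1 / 3) * E powr (- (1 / 3) - 1) * (3 * K * E powr (2 / 3) * (1 + 2 * q t))) (at t)"
      by (simp add: n1_def[abs_def] E_def)
    moreover have "- (1 / 3) * E powr (- (1 / 3) - 1) * (3 * K * E powr (2 / 3) * (1 + 2 * q t))
        = - K * (E powr (- (1 / 3) - 1) * E powr (2 / 3)) * (1 + 2 * q t)"
      by simp
    moreover have "E powr (- (1 / 3) - 1) * E powr (2 / 3) = n1 t * n1 t"
      unfolding n1_def E_def[symmetric] by (simp flip: powr_add)
    ultimately show ?thesis
      by (simp add: n2_def algebra_simps)
  qed
  have D2: "(n2 has_real_derivative K * n2 t * (2 * n1 t + n2 t)) (at t)" if "\<bar>t\<bar> < \<delta>" for t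
  proof -
    note q = main[OF that]
    define E where "E = q t * (1 + q t)"
    have E: "E > 0" using q(1) by (simp add: E_def)
    have e23: "E powr (2 / 3) = E * n1 t"
    proof -
      have "E * n1 t = E powr 1 * E powr (- (1 / 3))"
        using powr_one[of E] E by (simp only: n1_def E_def[symmetric] less_imp_le)
      also have "\<dots> = E powr (1 + - (1 / 3))" by (simp only: powr_add)
      finally show ?thesis by simp
    qed
    have "(n2 has_real_derivative (3 * K * E powr (2 / 3)) * n1 t + (- K * n1 t * (n1 t + 2 * n2 t)) * q t) (at t)"
      unfolding n2_def[abs_def] E_def
      by (rule DERIV_mult[OF q(2) D1[OF that], unfolded n2_def, THEN DERIV_cong]) simp
    then show ?thesis
      unfolding e23 by (rule DERIV_cong) (simp add: n2_def E_def algebra_simps)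
  qed
  show thesis
  proof (rule that[OF \<delta> _ D1 D2])
    fix t assume "\<bar>t\<bar> < \<delta>"
    then have "n1 t > 0" "n2 t > 0" using n1pos main(1) by (simp_all add: n2_def)
    then show "n1 t \<noteq> 0 \<and> n2 t \<noteq> 0 \<and> n1 t + n2 t \<noteq> 0" by simp
  qed
qed

lemma hasdd_snd_fun:
  assumes "(n has_real_derivative D) (at (snd w))"
  shows "hasdd (\<lambda>w. n (snd w)) (0, 1) w D" "hasdd (\<lambda>w. n (snd w)) (v, 0) w 0"
  using assms DERIV_shift[of n D 0 "snd w"] by (simp_all add: hasdd_def add.commute)

text \<open>Bootstrapping: the p-derivatives of both functions are polynomials in the pair, so their
  orders of smoothness rise together.\<close>

lemma smooth_conic_flow:
  fixes K :: real and W :: "((real^3) \<times> real) set"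
  assumes W: "open W" "\<And>w. w \<in> W \<Longrightarrow> \<bar>snd w\<bar> < \<delta>"
    and D: "\<And>t. \<bar>t\<bar> < \<delta> \<Longrightarrow> (n1 has_real_derivative - K * n1 t * (n1 t + 2 * n2 t)) (at t)"
      "\<And>t. \<bar>t\<bar> < \<delta> \<Longrightarrow> (n2 has_real_derivative K * n2 t * (2 * n1 t + n2 t)) (at t)"
  shows "smooth_on W (\<lambda>w. n1 (snd w))" "smooth_on W (\<lambda>w. n2 (snd w))"
proof -
  define N1 N2 where "N1 w = n1 (snd w)" and "N2 w = n2 (snd w)" for w :: "(real^3) \<times> real"
  have c: "continuous_on W (\<lambda>w. n (snd w))" if "\<And>t. \<bar>t\<bar> < \<delta> \<Longrightarrow> \<exists>D. (n has_real_derivative D) (at t)"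
    for n :: "real \<Rightarrow> real"
  proof -
    have "continuous_on {t. \<bar>t\<bar> < \<delta>} n"
      using that DERIV_isCont by (intro continuous_at_imp_continuous_on) blast
    then show ?thesis
      by (rule continuous_on_compose2) (use W(2) in \<open>auto intro!: continuous_intros\<close>)
  qed
  have cN: "continuous_on W N1" "continuous_on W N2"
    unfolding N1_def N2_def using D by (blast intro: c)+
  have "Ck m W N1 \<and> Ck m W N2" for m
  proof (induction m)
    case 0
    then show ?case using cN by simp
  next
    case (Suc m)
    have H: "hasdd N1 v w ((if v = (0, 1) then (\<lambda>w. - K * N1 w * (N1 w + 2 * N2 w)) else (\<lambda>_. 0)) w)"
      "hasdd N2 v w ((if v = (0, 1) then (\<lambda>w. K * N2 w * (2 * N1 w + N2 w)) else (\<lambda>_. 0)) w)"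
      if "v \<in> Basis" "w \<in> W" for v w
      using that(1) hasdd_snd_fun[OF D(1)[OF W(2)[OF that(2)]]] hasdd_snd_fun[OF D(2)[OF W(2)[OF that(2)]]]
      by (auto simp: Basis_prod_e N1_def[abs_def] N2_def[abs_def])
    have "Ck m W (\<lambda>w. - K * N1 w * (N1 w + 2 * N2 w))" "Ck m W (\<lambda>w. K * N2 w * (2 * N1 w + N2 w))"
      by (intro Ck_mult Ck_add Ck_const W(1); use Suc in simp)+
    then have C: "Ck m W (if v = (0, 1) then (\<lambda>w. - K * N1 w * (N1 w + 2 * N2 w)) else (\<lambda>_. 0))"
      "Ck m W (if v = (0, 1) then (\<lambda>w. K * N2 w * (2 * N1 w + N2 w)) else (\<lambda>_. 0))"
      for v :: "(real^3) \<times> real"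
      using Ck_const[OF W(1), of m 0] by simp_all
    show ?case
    proof
      show "Ck (Suc m) W N1" by (rule Ck_SucI[OF W(1) cN(1) H(1) C(1)])
      show "Ck (Suc m) W N2" by (rule Ck_SucI[OF W(1) cN(2) H(2) C(2)])
    qed
  qed
  then show "smooth_on W (\<lambda>w. n1 (snd w))" "smooth_on W (\<lambda>w. n2 (snd w))"
    by (auto simp: smooth_on_def N1_def[abs_def] N2_def[abs_def])
qed

subsection \<open>The degenerate case\<close>

text \<open>The coordinates are moved to the centre one at a time, each move staying in the
  cube.\<close>

lemma const_on_cube:
  assumes "u \<in> cube c r" "\<And>l v. v \<in> cube c r \<Longrightarrow> hasdd F (e l) v 0"
  shows "F u = F c"
proof -
  have r: "0 < r" using assms(1) unfolding cube_def by (metis (mono_tags) abs_ge_zero le_less_trans mem_Collect_eq)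
  define u1 u2 where "u1 = upd 1 (c $ 1) u" and "u2 = upd 2 (c $ 2) u1"
  have u1: "u1 \<in> cube c r" unfolding u1_def using r by (intro upd_in_cube assms(1)) auto
  have u2: "u2 \<in> cube c r" unfolding u2_def using r by (intro upd_in_cube u1) auto
  have "F u1 = F u" unfolding u1_def using r by (intro const_upd[OF assms(1)] assms(2)) auto
  moreover have "F u2 = F u1" unfolding u2_def using r by (intro const_upd[OF u1] assms(2)) auto
  moreover have "F (upd 3 (c $ 3) u2) = F u2" using r by (intro const_upd[OF u2] assms(2)) auto
  moreover have "upd 3 (c $ 3) u2 = c"
    by (simp add: vec_eq_iff forall_3 upd_nth u1_def u2_def)
  ultimately show ?thesis by simp
qed

lemma hasdd_nth: "hasdd (\<lambda>u. u $ l) (e m) u (if l = m then 1 else 0)"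
  by (simp add: hasdd_def e_nth) (auto intro!: derivative_eq_intros)

text \<open>The assumptions say that x/y, x/z and y/z are independent of u_i, u_j and u_k
  respectively. They negate the hypothesis of \<open>nondegenerate_case\<close> at all points and
  for all three cyclic relabellings.\<close>

locale degenerate_hydro_system = hydro_system +
  assumes deg: "\<And>u. u \<in> U \<Longrightarrow> dd (e i) x u * y u = x u * dd (e i) y u"
    "\<And>u. u \<in> U \<Longrightarrow> dd (e j) x u * z u = x u * dd (e j) z u"
    "\<And>u. u \<in> U \<Longrightarrow> dd (e k) y u * z u = y u * dd (e k) z u"
begin

lemma cyc_deg: "degenerate_hydro_system lam H U j k i B C A z x y mj mk mi"
  by (rule degenerate_hydro_system.intro[OF cyc], unfold_locales) (use deg in \<open>auto simp: algebra_simps\<close>)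

text \<open>Put P = mi x_i y, Q = mj x_j z, R = mk y_k z. Under \<open>deg\<close> the gradient
  relations read 2P = Q + R and 2Q = P + R, hence P = Q = R.\<close>

lemma balance:
  assumes "u \<in> U"
  shows "mi * dd (e i) x u * y u = mj * dd (e j) x u * z u"
    "mi * dd (e i) x u * y u = mk * dd (e k) y u * z u"
proof -
  have "2 * (mi * dd (e i) x u * y u) = mj * dd (e j) x u * z u + mk * dd (e k) y u * z u"
    using gradient_relation_i[OF assms] deg(1)[OF assms] by algebra
  moreover have "2 * (mj * dd (e j) x u * z u) = mi * dd (e i) x u * y u + mk * dd (e k) y u * z u"
    using gradient_relation_j[OF assms] deg(2,3)[OF assms] by algebra
  ultimately show "mi * dd (e i) x u * y u = mj * dd (e j) x u * z u"
    "mi * dd (e i) x u * y u = mk * dd (e k) y u * z u" by linarith+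
qed

lemma second_mixed:
  assumes "u \<in> U"
  shows "dd (e j) (dd (e i) x) u * y u = dd (e j) x u * dd (e i) y u"
proof -
  have 1: "hasdd (\<lambda>u. dd (e i) x u * y u) (e j) u (dd (e j) (dd (e i) x) u * y u + dd (e i) x u * dd (e j) y u)"
    by (rule hasdd_mult hasdd_dd hasdd_basic smooth assms)+
  have 2: "hasdd (\<lambda>u. x u * dd (e i) y u) (e j) u (dd (e j) x u * dd (e i) y u + x u * dd (e j) (dd (e i) y) u)"
    by (rule hasdd_mult hasdd_dd hasdd_basic smooth assms)+
  have "dd (e j) (dd (e i) y) u = 0"
    by (rule dd_dd_zero[OF smooth(5) assms third0(2)])
  then show ?thesis
    using hasdd_unique[OF iffD1[OF hasdd_cong[OF U assms deg(1)] 1] 2] third0(2)[OF assms] by simp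
qed

text \<open>Differentiate mi x_i y = mj x z_j along i, where z_j is independent of u_i. By
  \<open>deg\<close> and the same relation, the first-derivative terms cancel.\<close>

lemma second_i_zero:
  assumes "u \<in> U"
  shows "dd (e i) (dd (e i) x) u = 0"
proof -
  have 1: "hasdd (\<lambda>u. mi * (dd (e i) x u * y u)) (e i) u (mi * (dd (e i) (dd (e i) x) u * y u + dd (e i) x u * dd (e i) y u))"
    by (rule hasdd_cmult hasdd_mult hasdd_dd hasdd_basic smooth assms)+
  have 2: "hasdd (\<lambda>u. mj * (x u * dd (e j) z u)) (e i) u
      (mj * (dd (e i) x u * dd (e j) z u + x u * dd (e i) (dd (e j) z) u))"
    by (rule hasdd_cmult hasdd_mult hasdd_dd hasdd_basic smooth assms)+
  have eq: "mi * (dd (e i) x v * y v) = mj * (x v * dd (e j) z v)" if "v \<in> U" for v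
    using balance(1)[OF that] deg(2)[OF that] by (simp add: mult.assoc)
  have "dd (e i) (dd (e j) z) u = 0"
    by (rule dd_dd_zero[OF smooth(6) assms third0(3)])
  then have "mi * (dd (e i) (dd (e i) x) u * y u + dd (e i) x u * dd (e i) y u) = mj * (dd (e i) x u * dd (e j) z u)"
    using hasdd_unique[OF iffD1[OF hasdd_cong[OF U assms eq] 1] 2] by simp
  then have "mi * x u * y u * dd (e i) (dd (e i) x) u = 0"
    using eq[OF assms] deg(1)[OF assms] by algebra
  then show ?thesis
    using m0 nz[OF assms] by simp
qed

lemma second_j_zero:
  assumes "u \<in> U"
  shows "dd (e j) (dd (e j) x) u = 0"
proof -
  have 1: "hasdd (\<lambda>u. mj * (dd (e j) x u * z u)) (e j) u (mj * (dd (e j) (dd (e j) x) u * z u + dd (e j) x u * dd (e j) z u))"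
    by (rule hasdd_cmult hasdd_mult hasdd_dd hasdd_basic smooth assms)+
  have 2: "hasdd (\<lambda>u. mi * (x u * dd (e i) y u)) (e j) u
      (mi * (dd (e j) x u * dd (e i) y u + x u * dd (e j) (dd (e i) y) u))"
    by (rule hasdd_cmult hasdd_mult hasdd_dd hasdd_basic smooth assms)+
  have eq: "mj * (dd (e j) x v * z v) = mi * (x v * dd (e i) y v)" if "v \<in> U" for v
    using balance(1)[OF that] deg(1)[OF that] by (simp add: mult.assoc)
  have "dd (e j) (dd (e i) y) u = 0"
    by (rule dd_dd_zero[OF smooth(5) assms third0(2)])
  then have "mj * (dd (e j) (dd (e j) x) u * z u + dd (e j) x u * dd (e j) z u) = mi * (dd (e j) x u * dd (e i) y u)"
    using hasdd_unique[OF iffD1[OF hasdd_cong[OF U assms eq] 1] 2] by simp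
  then have "mj * x u * z u * dd (e j) (dd (e j) x) u = 0"
    using eq[OF assms] deg(2)[OF assms] by algebra
  then show ?thesis
    using m0 nz[OF assms] by simp
qed

text \<open>The pure second derivatives of \<open>x\<close> in i and j and its derivative in k
  vanish, so the mixed derivative \<kappa> is constant. Integrating successively, by comparison with
  polynomials having the same partials, gives the formula.\<close>

lemma bilinear:
  assumes c: "cube c r \<subseteq> U" and u: "u \<in> cube c r"
  shows "x u = x c + dd (e i) x c * (u $ i - c $ i) + dd (e j) x c * (u $ j - c $ j)
    + dd (e j) (dd (e i) x) c * (u $ i - c $ i) * (u $ j - c $ j)"
proof -
  define \<kappa> where "\<kappa> = dd (e j) (dd (e i) x) c"
  have sm2: "smooth_on U (dd (e j) (dd (e i) x))" by (intro smooth_on_dd smooth e_Basis)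
  have lk: "l = i \<or> l = j \<or> l = k" for l using univ by auto
  have swap: "dd (e l) (dd (e m) F) v = dd (e m) (dd (e l) F) v" if "smooth_on U F" "v \<in> U" for l m F v
    by (rule dd_commute[OF that(1) U that(2)]) auto
  have k0: "dd (e k) (dd (e m) x) v = 0" if "v \<in> U" for m v
    by (rule dd_dd_zero[OF smooth(4) that third0(1)])
  have z3: "dd (e l) (dd (e j) (dd (e i) x)) v = 0" if v: "v \<in> U" for l v
  proof -
    have "dd (e i) (dd (e j) (dd (e i) x)) v = dd (e j) (dd (e i) (dd (e i) x)) v"
      by (rule swap[OF smooth_on_dd[OF smooth(4) e_Basis] v])
    also have "\<dots> = 0" by (rule dd_zero_fun[OF v second_i_zero])
    finally have 1: "dd (e i) (dd (e j) (dd (e i) x)) v = 0" .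
    have "dd (e j) (dd (e j) (dd (e i) x)) v = dd (e j) (dd (e i) (dd (e j) x)) v"
      by (rule dd_cong[OF U v swap[OF smooth(4)]])
    also have "\<dots> = dd (e i) (dd (e j) (dd (e j) x)) v"
      by (rule swap[OF smooth_on_dd[OF smooth(4) e_Basis] v])
    also have "\<dots> = 0" by (rule dd_zero_fun[OF v second_j_zero])
    finally have 2: "dd (e j) (dd (e j) (dd (e i) x)) v = 0" .
    have "dd (e k) (dd (e j) (dd (e i) x)) v = dd (e j) (dd (e k) (dd (e i) x)) v"
      by (rule swap[OF smooth_on_dd[OF smooth(4) e_Basis] v])
    also have "\<dots> = 0" by (rule dd_zero_fun[OF v k0])
    finally show ?thesis using lk[of l] 1 2 by metis
  qed
  have xij: "dd (e j) (dd (e i) x) v = \<kappa>" if v: "v \<in> cube c r" for v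
    unfolding \<kappa>_def
    using z3 c by (intro const_on_cube[OF v] hasdd_eq_rhs[OF smooth_on_hasdd[OF sm2 e_Basis]]) auto
  have nthD: "hasdd (\<lambda>v. v $ m - c $ m) (e l) v (if m = l then 1 else 0)" for l m and v :: "real^3"
    by (rule hasdd_eq_rhs[OF hasdd_diff[OF hasdd_nth hasdd_const]]) simp
  have xi: "dd (e i) x v = dd (e i) x c + \<kappa> * (v $ j - c $ j)" if v: "v \<in> cube c r" for v
  proof -
    have "dd (e i) x v - \<kappa> * (v $ j - c $ j) = dd (e i) x c - \<kappa> * (c $ j - c $ j)"
    proof (rule const_on_cube[OF v])
      fix l v assume v: "v \<in> cube c r"
      then have vU: "v \<in> U" using c by auto
      show "hasdd (\<lambda>v. dd (e i) x v - \<kappa> * (v $ j - c $ j)) (e l) v 0"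
        by (rule hasdd_eq_rhs[OF hasdd_diff[OF hasdd_dd[OF smooth(4) vU] hasdd_cmult[OF nthD]]])
          (use lk[of l] xij[OF v] second_i_zero[OF vU] k0[OF vU] dist in auto)
    qed
    then show ?thesis by simp
  qed
  have xj: "dd (e j) x v = dd (e j) x c + \<kappa> * (v $ i - c $ i)" if v: "v \<in> cube c r" for v
  proof -
    have "dd (e j) x v - \<kappa> * (v $ i - c $ i) = dd (e j) x c - \<kappa> * (c $ i - c $ i)"
    proof (rule const_on_cube[OF v])
      fix l v assume v: "v \<in> cube c r"
      then have vU: "v \<in> U" using c by auto
      show "hasdd (\<lambda>v. dd (e j) x v - \<kappa> * (v $ i - c $ i)) (e l) v 0"
        by (rule hasdd_eq_rhs[OF hasdd_diff[OF hasdd_dd[OF smooth(4) vU] hasdd_cmult[OF nthD]]])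
          (use lk[of l] xij[OF v] swap[OF smooth(4) vU, of i j] second_j_zero[OF vU] k0[OF vU] dist in auto)
    qed
    then show ?thesis by simp
  qed
  have "x u - (dd (e i) x c * (u $ i - c $ i) + dd (e j) x c * (u $ j - c $ j) + \<kappa> * ((u $ i - c $ i) * (u $ j - c $ j)))
    = x c - (dd (e i) x c * (c $ i - c $ i) + dd (e j) x c * (c $ j - c $ j) + \<kappa> * ((c $ i - c $ i) * (c $ j - c $ j)))"
  proof (rule const_on_cube[OF u])
    fix l v assume v: "v \<in> cube c r"
    then have vU: "v \<in> U" using c by auto
    show "hasdd (\<lambda>u. x u - (dd (e i) x c * (u $ i - c $ i) + dd (e j) x c * (u $ j - c $ j)
        + \<kappa> * ((u $ i - c $ i) * (u $ j - c $ j)))) (e l) v 0"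
      by (rule hasdd_eq_rhs[OF hasdd_diff[OF hasdd_basic(4)[OF vU]
          hasdd_add[OF hasdd_add[OF hasdd_cmult[OF nthD] hasdd_cmult[OF nthD]] hasdd_cmult[OF hasdd_mult[OF nthD nthD]]]]])
        (use lk[of l] xi[OF v] xj[OF v] third0(1)[OF vU] dist in auto)
  qed
  then show ?thesis by (simp add: \<kappa>_def)
qed

end

section \<open>Normal form of the Hessian in the degenerate case\<close>

lemma factor_triple:
  fixes X Y Z :: real
  assumes "X \<noteq> 0" "Y \<noteq> 0" "Z \<noteq> 0"
  obtains s gi gj gk where "s * s = 1" "gi \<noteq> 0" "gj \<noteq> 0" "gk \<noteq> 0"
    "X = s * gi * gj" "Y = s * gi * gk" "Z = s * gj * gk"
proof -
  \<comment> \<open>The desired factorisation forces X Y / Z = s gi^2, so \<open>s\<close> is the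
    sign of this quotient and \<open>gi\<close> the root of its modulus.\<close>
  define s where "s = sgn (X * Y / Z)"
  define gi where "gi = sqrt \<bar>X * Y / Z\<bar>"
  have s: "s * s = 1" using assms by (simp add: s_def sgn_mult sgn_if)
  have gi: "gi \<noteq> 0" "gi * gi = \<bar>X * Y / Z\<bar>" using assms by (simp_all add: gi_def)
  have g2: "gi * gi = s * (X * Y / Z)"
    unfolding gi(2) s_def abs_sgn by (rule mult.commute)
  show thesis
  proof (rule that[of s gi "s * X / gi" "s * Y / gi"])
    have "s \<noteq> 0" using s by auto
    then show "s * X / gi \<noteq> 0" "s * Y / gi \<noteq> 0" using assms gi by auto
    show "X = s * gi * (s * X / gi)" "Y = s * gi * (s * Y / gi)"
      using gi s by (simp_all add: field_simps)
    have "s * (s * X / gi) * (s * Y / gi) = (s * s) * s * X * Y / (gi * gi)" by simp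
    also have "\<dots> = Z" unfolding g2 s using \<open>s \<noteq> 0\<close> assms by simp
    finally show "Z = s * (s * X / gi) * (s * Y / gi)" by simp
  qed (use s gi in auto)
qed

context degenerate_hydro_system
begin

text \<open>By \<open>deg\<close> the derivatives of \<open>rj\<close> and \<open>rk\<close> along i
  vanish, so \<open>ci\<close> makes \<open>A\<close> independent of u_i. Its other derivatives are
  x_i and y_i, which are affine in u_j and in u_k, and they integrate to the squares.\<close>

lemma diagonal_form:
  assumes c: "cube c r \<subseteq> U" and r: "0 < r" and s: "s * s = 1"
    and xf: "\<And>u. u \<in> cube c r \<Longrightarrow> x u = s * (gi + \<epsilon> / mi * (u $ i - c $ i)) * (gj + \<epsilon> / mj * (u $ j - c $ j))"
    and yf: "\<And>u. u \<in> cube c r \<Longrightarrow> y u = s * (gi + \<epsilon> / mi * (u $ i - c $ i)) * (gk + \<epsilon> / mk * (u $ k - c $ k))"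
  shows "\<exists>\<eta>. \<forall>u\<in>cube c r. mi * A u = s / 2 * (mj * (gj + \<epsilon> / mj * (u $ j - c $ j))\<^sup>2
    + mk * (gk + \<epsilon> / mk * (u $ k - c $ k))\<^sup>2) + \<eta>"
proof -
  define \<alpha>i \<alpha>j \<alpha>k where "\<alpha>i u = gi + \<epsilon> / mi * (u $ i - c $ i)" and "\<alpha>j u = gj + \<epsilon> / mj * (u $ j - c $ j)"
    and "\<alpha>k u = gk + \<epsilon> / mk * (u $ k - c $ k)" for u :: "real^3"
  have lk: "l = i \<or> l = j \<or> l = k" for l using univ by auto
  have D\<alpha>: "hasdd \<alpha>i (e l) v (if l = i then \<epsilon> / mi else 0)" "hasdd \<alpha>j (e l) v (if l = j then \<epsilon> / mj else 0)"
    "hasdd \<alpha>k (e l) v (if l = k then \<epsilon> / mk else 0)" for l v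
    unfolding \<alpha>i_def \<alpha>j_def \<alpha>k_def
    by (rule hasdd_eq_rhs[OF hasdd_add[OF hasdd_const hasdd_cmult[OF hasdd_diff[OF hasdd_nth hasdd_const]]]], simp)+
  have ox: "dd (e i) x v = s * (\<epsilon> / mi) * \<alpha>j v" "dd (e i) y v = s * (\<epsilon> / mi) * \<alpha>k v" if v: "v \<in> cube c r" for v
  proof -
    have "hasdd (\<lambda>v. s * \<alpha>i v * \<alpha>j v) (e i) v (s * (\<epsilon> / mi) * \<alpha>j v)"
      "hasdd (\<lambda>v. s * \<alpha>i v * \<alpha>k v) (e i) v (s * (\<epsilon> / mi) * \<alpha>k v)"
      using dist by (auto intro!: hasdd_eq_rhs[OF hasdd_mult[OF hasdd_cmult[OF D\<alpha>(1)] D\<alpha>(2)]]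
          hasdd_eq_rhs[OF hasdd_mult[OF hasdd_cmult[OF D\<alpha>(1)] D\<alpha>(3)]])
    then show "dd (e i) x v = s * (\<epsilon> / mi) * \<alpha>j v" "dd (e i) y v = s * (\<epsilon> / mi) * \<alpha>k v"
      using dd_cong[OF open_cube v xf] dd_cong[OF open_cube v yf]
      by (auto dest!: hasdd_imp_dd simp: \<alpha>i_def \<alpha>j_def \<alpha>k_def)
  qed
  have rj0: "dd (e i) rj v = 0" and rk0: "dd (e i) rk v = 0" if v: "v \<in> U" for v
  proof -
    have "hasdd rj (e i) v (((dd (e i) x v * z v + x v * dd (e i) z v) * y v - x v * z v * dd (e i) y v) / (y v * y v))"
      by (rule hasdd_intros hasdd_basic v nz)+
    moreover have "(dd (e i) x v * z v + x v * dd (e i) z v) * y v - x v * z v * dd (e i) y v = 0"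
      using deg(1)[OF v] third0(3)[OF v] by algebra
    ultimately show "dd (e i) rj v = 0" using hasdd_imp_dd by fastforce
    have "dd (e i) y v * z v * x v - y v * z v * dd (e i) x v = 0"
      using deg(1)[OF v] by algebra
    then show "dd (e i) rk v = 0" by (simp add: dd_i_rk[OF v])
  qed
  define G where "G u = mi * A u - s / 2 * (mj * (\<alpha>j u)\<^sup>2 + mk * (\<alpha>k u)\<^sup>2)" for u
  have "G u = G c" if "u \<in> cube c r" for u
  proof (rule const_on_cube[OF that])
    fix l v assume v: "v \<in> cube c r"
    then have vU: "v \<in> U" using c by auto
    have A: "mi * dd (e i) A v = 0" using ci_exp[OF vU] rj0[OF vU] rk0[OF vU] by simp
    have D: "hasdd G (e l) v (mi * dd (e l) A v - s / 2 * (mj * (2 * \<alpha>j v * (if l = j then \<epsilon> / mj else 0))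
        + mk * (2 * \<alpha>k v * (if l = k then \<epsilon> / mk else 0))))"
      unfolding G_def by (rule hasdd_diff hasdd_cmult hasdd_add hasdd_power2 hasdd_basic vU D\<alpha>)+
    have "mi * dd (e l) A v - s / 2 * (mj * (2 * \<alpha>j v * (if l = j then \<epsilon> / mj else 0))
        + mk * (2 * \<alpha>k v * (if l = k then \<epsilon> / mk else 0))) = 0"
      using lk[of l] A third(1,2)[OF vU] ox[OF v] m0 dist by auto
    from hasdd_eq_rhs[OF D this] show "hasdd G (e l) v 0" .
  qed
  then show ?thesis
    unfolding G_def \<alpha>j_def \<alpha>k_def by (intro exI[of _ "G c"]) (simp add: G_def \<alpha>j_def \<alpha>k_def algebra_simps)
qed

text \<open>Each off-diagonal entry is bilinear, and its coefficients at \<open>c\<close> turn out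
  to be those of a product of two affine functions, one factor per coordinate being shared among the
  entries.\<close>

lemma normal_form:
  assumes c: "cube c r \<subseteq> U" and r: "0 < r"
  obtains s \<eta>i \<eta>j \<eta>k gi \<epsilon> gj gk where "s * s = 1" "\<eta>i + \<eta>j + \<eta>k = 0"
    "\<forall>u\<in>cube c r. x u = s * (gi + \<epsilon> / mi * (u $ i - c $ i)) * (gj + \<epsilon> / mj * (u $ j - c $ j))"
    "\<forall>u\<in>cube c r. y u = s * (gi + \<epsilon> / mi * (u $ i - c $ i)) * (gk + \<epsilon> / mk * (u $ k - c $ k))"
    "\<forall>u\<in>cube c r. z u = s * (gj + \<epsilon> / mj * (u $ j - c $ j)) * (gk + \<epsilon> / mk * (u $ k - c $ k))"
    "\<forall>u\<in>cube c r. mi * A u = s / 2 * (mj * (gj + \<epsilon> / mj * (u $ j - c $ j))\<^sup>2 + mk * (gk + \<epsilon> / mk * (u $ k - c $ k))\<^sup>2) + \<eta>i"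
    "\<forall>u\<in>cube c r. mj * B u = s / 2 * (mk * (gk + \<epsilon> / mk * (u $ k - c $ k))\<^sup>2 + mi * (gi + \<epsilon> / mi * (u $ i - c $ i))\<^sup>2) + \<eta>j"
    "\<forall>u\<in>cube c r. mk * C u = s / 2 * (mi * (gi + \<epsilon> / mi * (u $ i - c $ i))\<^sup>2 + mj * (gj + \<epsilon> / mj * (u $ j - c $ j))\<^sup>2) + \<eta>k"
proof -
  have cU: "c \<in> U" using c center_in_cube[OF r] by auto
  note nzc = nz[OF cU]
  obtain s gi gj gk where g: "s * s = 1" "gi \<noteq> 0" "gj \<noteq> 0" "gk \<noteq> 0"
    "x c = s * gi * gj" "y c = s * gi * gk" "z c = s * gj * gk"
    using factor_triple[OF nzc] by metis
  have s0: "s \<noteq> 0" using g(1) by auto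
  \<comment> \<open>By \<open>balance\<close>, using j or k in place of i gives the same number;
    this is why one slope constant serves all three affine factors.\<close>
  define \<epsilon> where "\<epsilon> = mi * dd (e i) x c * y c / (gi * gj * gk)"
  have a: "mi * dd (e i) x c * y c = \<epsilon> * (gi * gj * gk)" using g by (simp add: \<epsilon>_def)
  have canc: "p = q" if "p * t = q * t" "t \<noteq> 0" for p q t :: real using that by simp
  have d: "dd (e i) x c = s * \<epsilon> * gj / mi" "dd (e j) x c = s * \<epsilon> * gi / mj"
    "dd (e i) y c = s * \<epsilon> * gk / mi" "dd (e k) y c = s * \<epsilon> * gi / mk"
    "dd (e j) z c = s * \<epsilon> * gk / mj" "dd (e k) z c = s * \<epsilon> * gj / mk"
  proof -
    have 1: "mi * dd (e i) x c = s * \<epsilon> * gj"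
    proof (rule canc[of _ "s * gi * gk"])
      show "mi * dd (e i) x c * (s * gi * gk) = s * \<epsilon> * gj * (s * gi * gk)"
        using a g(1) unfolding g(6) by algebra
    qed (use g s0 in auto)
    have 2: "mj * dd (e j) x c = s * \<epsilon> * gi"
    proof (rule canc[of _ "s * gj * gk"])
      show "mj * dd (e j) x c * (s * gj * gk) = s * \<epsilon> * gi * (s * gj * gk)"
        using a balance(1)[OF cU] g(1) unfolding g(7) by algebra
    qed (use g s0 in auto)
    have 3: "mi * dd (e i) y c = s * \<epsilon> * gk"
    proof (rule canc[of _ "s * gi * gj"])
      show "mi * dd (e i) y c * (s * gi * gj) = s * \<epsilon> * gk * (s * gi * gj)"
        using a deg(1)[OF cU] g(1) unfolding g(5) by algebra
    qed (use g s0 in auto)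
    have 4: "mk * dd (e k) y c = s * \<epsilon> * gi"
    proof (rule canc[of _ "s * gj * gk"])
      show "mk * dd (e k) y c * (s * gj * gk) = s * \<epsilon> * gi * (s * gj * gk)"
        using a balance(2)[OF cU] g(1) unfolding g(7) by algebra
    qed (use g s0 in auto)
    have 5: "mj * dd (e j) z c = s * \<epsilon> * gk"
    proof (rule canc[of _ "s * gi * gj"])
      show "mj * dd (e j) z c * (s * gi * gj) = s * \<epsilon> * gk * (s * gi * gj)"
        using a balance(1)[OF cU] deg(2)[OF cU] g(1) unfolding g(5) by algebra
    qed (use g s0 in auto)
    have 6: "mk * dd (e k) z c = s * \<epsilon> * gj"
    proof (rule canc[of _ "s * gi * gk"])
      show "mk * dd (e k) z c * (s * gi * gk) = s * \<epsilon> * gj * (s * gi * gk)"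
        using a balance(2)[OF cU] deg(3)[OF cU] g(1) unfolding g(6) by algebra
    qed (use g s0 in auto)
    show "dd (e i) x c = s * \<epsilon> * gj / mi" "dd (e j) x c = s * \<epsilon> * gi / mj"
      "dd (e i) y c = s * \<epsilon> * gk / mi" "dd (e k) y c = s * \<epsilon> * gi / mk"
      "dd (e j) z c = s * \<epsilon> * gk / mj" "dd (e k) z c = s * \<epsilon> * gj / mk"
      using 1 2 3 4 5 6 m0 by (simp_all add: field_simps)
  qed
  have form: "F u = s * (ga + \<epsilon> / ma * (u $ a - c $ a)) * (gb + \<epsilon> / mb * (u $ b - c $ b))"
    if "F u = F c + Fa * (u $ a - c $ a) + Fb * (u $ b - c $ b) + Fab * (u $ a - c $ a) * (u $ b - c $ b)"
      "F c = s * ga * gb" "Fa = s * \<epsilon> * gb / ma" "Fb = s * \<epsilon> * ga / mb" "Fab = s * (\<epsilon> / ma) * (\<epsilon> / mb)"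
    for F :: "real^3 \<Rightarrow> real" and u Fa Fb Fab a b ga gb ma mb
  proof -
    define P Q a' b' where "P = \<epsilon> / ma" and "Q = \<epsilon> / mb" and "a' = u $ a - c $ a" and "b' = u $ b - c $ b"
    have "Fa = s * P * gb" "Fb = s * Q * ga" "Fab = s * P * Q"
      using that by (simp_all add: P_def Q_def)
    then show ?thesis
      unfolding that(1,2) P_def[symmetric] Q_def[symmetric] a'_def[symmetric] b'_def[symmetric]
      by (simp add: algebra_simps)
  qed
  \<comment> \<open>\<open>second_mixed\<close> fixes the coefficient of the bilinear term at
    exactly the value that makes the polynomial factor.\<close>
  have mixed: "Fab = s * (\<epsilon> / ma) * (\<epsilon> / mb)"
    if "Fab * (s * ga * gc) = Fb * Ga" "Fb = s * \<epsilon> * ga / mb" "Ga = s * \<epsilon> * gc / ma" "ga \<noteq> 0" "gc \<noteq> 0"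
    for Fab Fb Ga ga gc ma mb :: real
  proof (rule canc[of _ "s * ga * gc"])
    show "Fab * (s * ga * gc) = s * (\<epsilon> / ma) * (\<epsilon> / mb) * (s * ga * gc)"
      unfolding that(1-3) by (simp add: mult_ac)
  qed (use that s0 in auto)
  have mix: "dd (e j) (dd (e i) x) c = s * (\<epsilon> / mi) * (\<epsilon> / mj)"
    "dd (e k) (dd (e j) z) c = s * (\<epsilon> / mj) * (\<epsilon> / mk)"
    "dd (e i) (dd (e k) y) c = s * (\<epsilon> / mk) * (\<epsilon> / mi)"
  proof -
    show "dd (e j) (dd (e i) x) c = s * (\<epsilon> / mi) * (\<epsilon> / mj)"
      using second_mixed[OF cU] unfolding g(6) by (rule mixed[OF _ d(2) d(3) g(2) g(4)])
    have "dd (e k) (dd (e j) z) c * (s * gj * gi) = dd (e k) z c * dd (e j) x c"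
      using degenerate_hydro_system.second_mixed[OF cyc_deg cU] unfolding g(5) by (simp add: mult.commute mult.left_commute)
    then show "dd (e k) (dd (e j) z) c = s * (\<epsilon> / mj) * (\<epsilon> / mk)"
      by (rule mixed[OF _ d(6) d(2) g(3) g(2)])
    have "dd (e i) (dd (e k) y) c * (s * gk * gj) = dd (e i) y c * dd (e k) z c"
      using degenerate_hydro_system.second_mixed[OF degenerate_hydro_system.cyc_deg[OF cyc_deg] cU] unfolding g(7)
      by (simp add: mult.commute mult.left_commute)
    then show "dd (e i) (dd (e k) y) c = s * (\<epsilon> / mk) * (\<epsilon> / mi)"
      by (rule mixed[OF _ d(3) d(6) g(4) g(3)])
  qed
  have xf: "x u = s * (gi + \<epsilon> / mi * (u $ i - c $ i)) * (gj + \<epsilon> / mj * (u $ j - c $ j))"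
    and zf: "z u = s * (gj + \<epsilon> / mj * (u $ j - c $ j)) * (gk + \<epsilon> / mk * (u $ k - c $ k))"
    and yf: "y u = s * (gk + \<epsilon> / mk * (u $ k - c $ k)) * (gi + \<epsilon> / mi * (u $ i - c $ i))"
    if u: "u \<in> cube c r" for u
    by (rule form[OF bilinear[OF c u] g(5) d(1,2) mix(1)],
        rule form[OF degenerate_hydro_system.bilinear[OF cyc_deg c u] g(7) d(5,6) mix(2)],
        rule form[OF degenerate_hydro_system.bilinear[OF degenerate_hydro_system.cyc_deg[OF cyc_deg] c u] _ d(4,3) mix(3)])
      (simp add: g(6))
  have yf': "y u = s * (gi + \<epsilon> / mi * (u $ i - c $ i)) * (gk + \<epsilon> / mk * (u $ k - c $ k))"
    if u: "u \<in> cube c r" for u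
    unfolding yf[OF u] by simp
  have xf': "x u = s * (gj + \<epsilon> / mj * (u $ j - c $ j)) * (gi + \<epsilon> / mi * (u $ i - c $ i))"
    and zf': "z u = s * (gk + \<epsilon> / mk * (u $ k - c $ k)) * (gj + \<epsilon> / mj * (u $ j - c $ j))"
    if u: "u \<in> cube c r" for u
    unfolding xf[OF u] zf[OF u] by simp_all
  obtain \<eta>i where \<eta>i: "\<And>u. u \<in> cube c r \<Longrightarrow> mi * A u = s / 2 * (mj * (gj + \<epsilon> / mj * (u $ j - c $ j))\<^sup>2 + mk * (gk + \<epsilon> / mk * (u $ k - c $ k))\<^sup>2) + \<eta>i"
    using diagonal_form[OF c r g(1) xf yf'] by blast
  obtain \<eta>j where \<eta>j: "\<And>u. u \<in> cube c r \<Longrightarrow> mj * B u = s / 2 * (mk * (gk + \<epsilon> / mk * (u $ k - c $ k))\<^sup>2 + mi * (gi + \<epsilon> / mi * (u $ i - c $ i))\<^sup>2) + \<eta>j"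
    using degenerate_hydro_system.diagonal_form[OF cyc_deg c r g(1) zf xf'] by blast
  obtain \<eta>k where \<eta>k: "\<And>u. u \<in> cube c r \<Longrightarrow> mk * C u = s / 2 * (mi * (gi + \<epsilon> / mi * (u $ i - c $ i))\<^sup>2 + mj * (gj + \<epsilon> / mj * (u $ j - c $ j))\<^sup>2) + \<eta>k"
    using degenerate_hydro_system.diagonal_form[OF degenerate_hydro_system.cyc_deg[OF cyc_deg] c r g(1) yf zf'] by blast
  \<comment> \<open>At the centre the quotients in \<open>J\<close> become
    \<open>s * gi\<^sup>2\<close>, \<open>s * gj\<^sup>2\<close>, \<open>s * gk\<^sup>2\<close>,
    which match the quadratic parts of the diagonal entries and leave the constants.\<close>
  have sum: "\<eta>i + \<eta>j + \<eta>k = 0"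
  proof -
    note cc = center_in_cube[OF r, of c]
    have r: "x c * y c / z c = s * gi\<^sup>2" "x c * z c / y c = s * gj\<^sup>2" "y c * z c / x c = s * gk\<^sup>2"
      unfolding g(5-7) using g(2-4) s0 by (simp_all add: field_simps power2_eq_square)
    show ?thesis
      using J[OF cU] \<eta>i[OF cc] \<eta>j[OF cc] \<eta>k[OF cc] unfolding r by (simp add: field_simps)
  qed
  show thesis
    by (rule that[OF g(1) sum]; rule ballI; erule xf yf' zf \<eta>i \<eta>j \<eta>k)
qed

end

section \<open>Explicit Lax pair in the degenerate case\<close>

lemma smooth_on_fst_nth:
  assumes "open (W :: ((real^3) \<times> real) set)"
  shows "smooth_on W (\<lambda>w. fst w $ l)"
proof (rule smooth_onI_partials[OF assms,
    where D="\<lambda>v w. if v = (e l, 0) then 1 else 0"])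
  show "continuous_on W (\<lambda>w. fst w $ l)" by (intro continuous_intros)
  fix v :: "(real^3) \<times> real" assume v: "v \<in> Basis"
  have inj: "e m = e l \<longleftrightarrow> m = l" for m by (metis e_nth zero_neq_one)
  from v consider "v = (0, 1)" | m where "v = (e m, 0)" by (auto simp: Basis_prod_e)
  then show "hasdd (\<lambda>w. fst w $ l) v w (if v = (e l, 0) then 1 else 0)" for w
  proof cases
    case 1
    then show ?thesis using hasdd_fst_snd[of "\<lambda>u. u $ l" 1 w] by simp
  next
    case 2
    then show ?thesis
      using hasdd_fst[OF hasdd_nth[of l m "fst w"], of 0] by (auto simp: inj)
  qed
  show "smooth_on W (\<lambda>w. if v = (e l, 0) then 1 else 0)"
    using smooth_on_const[OF assms] by (cases "v = (e l, 0)") auto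
qed

lemma smooth_on_snd:
  assumes "open (W :: ((real^3) \<times> real) set)"
  shows "smooth_on W snd"
proof (rule smooth_onI_partials[OF assms,
    where D="\<lambda>v w. if v = (0, 1) then 1 else 0"])
  show "continuous_on W snd" by (intro continuous_intros)
  fix v :: "(real^3) \<times> real" assume v: "v \<in> Basis"
  show "hasdd snd v w (if v = (0, 1) then 1 else 0)" for w :: "(real^3) \<times> real"
    using v hasdd_snd_fun[of "\<lambda>t. t" 1 w] by (auto simp: Basis_prod_e)
  show "smooth_on W (\<lambda>w. if v = (0, 1) then 1 else 0)"
    using smooth_on_const[OF assms] by (cases "v = (0, 1)") auto
qed

lemma hasdd_snd: "hasdd snd (0, 1) w 1" "hasdd snd (v, 0) w 0"
  using hasdd_snd_fun[of "\<lambda>t. t" 1 w] by auto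

text \<open>One row of the Lax equations in normal form; the other rows are cyclic instances. The
  key is that \<open>1 - (ni - nk) / nj\<close> equals -2 ni / nj and
  \<open>1 + (nj - ni) / nk\<close> equals -2 ni / nk when ni + nj + nk = 0.\<close>

lemma conic_coefficients:
  fixes mi mj mk s \<eta>i \<eta>j \<eta>k ni nj nk :: real
  assumes m0: "mi \<noteq> 0" "mj \<noteq> 0" "mk \<noteq> 0" and n0: "ni \<noteq> 0" "nj \<noteq> 0" "nk \<noteq> 0"
    and n: "nk = - ni - nj"
    and q: "mi * A = s / 2 * (mj * aj\<^sup>2 + mk * ak\<^sup>2) + \<eta>i"
    and \<kappa>: "mi * (mk * \<kappa>j - mj * \<kappa>k) = - \<eta>i"
    and b: "bj = - (s * mj / (2 * mi * mk)) * ((ni - nk) / nj) * aj\<^sup>2 + \<kappa>j"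
      "bk = - (s * mk / (2 * mi * mj)) * ((nj - ni) / nk) * ak\<^sup>2 + \<kappa>k"
  shows "ai * mi / ni * (mk * bj - mj * bk) + ai * mi / ni * A
    + aj * mj / nj * (s * ai * aj) + ak * mk / nk * (s * ai * ak) = 0"
proof -
  define P Q h where "P = (ni - nk) / nj" and "Q = (nj - ni) / nk" and "h = s / 2"
  have "mi * (mk * bj) = - (h * mj * P * aj\<^sup>2) + mi * mk * \<kappa>j"
    "mi * (mj * bk) = - (h * mk * Q * ak\<^sup>2) + mi * mj * \<kappa>k"
    using m0 by (simp_all add: b P_def[symmetric] Q_def[symmetric] h_def field_simps)
  then have "mi * (mk * bj - mj * bk) + mi * A
      = s / 2 * mj * aj\<^sup>2 * (1 - (ni - nk) / nj) + s / 2 * mk * ak\<^sup>2 * (1 + (nj - ni) / nk)"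
    unfolding q P_def[symmetric] Q_def[symmetric] h_def[symmetric] using \<kappa> by (simp add: algebra_simps)
  also have "\<dots> = - (ni * (s * mj / nj * aj\<^sup>2 + s * mk / nk * ak\<^sup>2))"
  proof -
    have *: "1 - (ni - nk) / nj = - 2 * ni / nj" "1 + (nj - ni) / nk = - 2 * ni / nk"
      using n0 n by (simp_all add: field_simps)
    show ?thesis unfolding * by (simp add: algebra_simps)
  qed
  finally have *: "mi * (mk * bj - mj * bk) + mi * A = - (ni * (s * mj / nj * aj\<^sup>2 + s * mk / nk * ak\<^sup>2))" .
  have "ai * mi / ni * (mk * bj - mj * bk) + ai * mi / ni * A
      + aj * mj / nj * (s * ai * aj) + ak * mk / nk * (s * ai * ak)
    = ai / ni * (mi * (mk * bj - mj * bk) + mi * A) + ai * (s * mj / nj * aj\<^sup>2 + s * mk / nk * ak\<^sup>2)"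
    by (simp add: algebra_simps power2_eq_square)
  also have "\<dots> = 0"
    unfolding * using n0 by simp
  finally show ?thesis .
qed

context degenerate_hydro_system
begin

text \<open>In normal form the conic is parametrised by a_l = \<alpha>_l m_l / n_l with ni + nj + nk
  = 0. Letting the n_l depend on p alone, closedness of the three forms a_l du_l + b_l dp is
  achieved by the flow of \<open>conic_flow_exists\<close>.\<close>

lemma degenerate_case:
  assumes U0: "U \<noteq> {}"
  shows "\<exists>W f g. W \<subseteq> U \<times> UNIV \<and> is_disp_lax_pair lam H W f g"
proof -
  obtain c where cU: "c \<in> U" using U0 by blast
  obtain r where r: "0 < r" and c: "cube c r \<subseteq> U" using cube_in_open[OF U cU] by blast
  obtain s \<eta>i \<eta>j \<eta>k gi \<epsilon> gj gk where s: "s * s = 1" and \<eta>: "\<eta>i + \<eta>j + \<eta>k = 0"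
    and F: "\<forall>u\<in>cube c r. x u = s * (gi + \<epsilon> / mi * (u $ i - c $ i)) * (gj + \<epsilon> / mj * (u $ j - c $ j))"
    "\<forall>u\<in>cube c r. y u = s * (gi + \<epsilon> / mi * (u $ i - c $ i)) * (gk + \<epsilon> / mk * (u $ k - c $ k))"
    "\<forall>u\<in>cube c r. z u = s * (gj + \<epsilon> / mj * (u $ j - c $ j)) * (gk + \<epsilon> / mk * (u $ k - c $ k))"
    "\<forall>u\<in>cube c r. mi * A u = s / 2 * (mj * (gj + \<epsilon> / mj * (u $ j - c $ j))\<^sup>2 + mk * (gk + \<epsilon> / mk * (u $ k - c $ k))\<^sup>2) + \<eta>i"
    "\<forall>u\<in>cube c r. mj * B u = s / 2 * (mk * (gk + \<epsilon> / mk * (u $ k - c $ k))\<^sup>2 + mi * (gi + \<epsilon> / mi * (u $ i - c $ i))\<^sup>2) + \<eta>j"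
    "\<forall>u\<in>cube c r. mk * C u = s / 2 * (mi * (gi + \<epsilon> / mi * (u $ i - c $ i))\<^sup>2 + mj * (gj + \<epsilon> / mj * (u $ j - c $ j))\<^sup>2) + \<eta>k"
    by (rule normal_form[OF c r])
  define \<alpha>i \<alpha>j \<alpha>k where "\<alpha>i w = gi + \<epsilon> / mi * (fst w $ i - c $ i)" and "\<alpha>j w = gj + \<epsilon> / mj * (fst w $ j - c $ j)"
    and "\<alpha>k w = gk + \<epsilon> / mk * (fst w $ k - c $ k)" for w :: "(real^3) \<times> real"
  \<comment> \<open>This speed matches the p-derivative of a_l with the u_l-derivative of b_l,
    because \<open>mi * K\<close> equals \<open>s * \<epsilon> / (mj * mk)\<close> and
    cyclically.\<close>
  define K where "K = s * \<epsilon> / (mi * mj * mk)"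
  obtain \<delta> n1 n2 where \<delta>: "0 < \<delta>"
    and n0: "\<And>t. \<bar>t\<bar> < \<delta> \<Longrightarrow> n1 t \<noteq> 0 \<and> n2 t \<noteq> 0 \<and> n1 t + n2 t \<noteq> 0"
    and Dn: "\<And>t. \<bar>t\<bar> < \<delta> \<Longrightarrow> (n1 has_real_derivative - K * n1 t * (n1 t + 2 * n2 t)) (at t)"
    "\<And>t. \<bar>t\<bar> < \<delta> \<Longrightarrow> (n2 has_real_derivative K * n2 t * (2 * n1 t + n2 t)) (at t)"
    using conic_flow_exists[of K] by metis
  define W where "W = cube c r \<times> {- \<delta><..<\<delta>}"
  have oW: "open W" unfolding W_def by (intro open_Times open_cube) auto
  have W: "fst w \<in> cube c r" "fst w \<in> U" "\<bar>snd w\<bar> < \<delta>" if "w \<in> W" for w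
    using that c by (auto simp: W_def abs_less_iff)
  define ni nj nk where "ni w = n1 (snd w)" and "nj w = n2 (snd w)" and "nk w = - n1 (snd w) - n2 (snd w)"
    for w :: "(real^3) \<times> real"
  have nn: "ni w \<noteq> 0" "nj w \<noteq> 0" "nk w \<noteq> 0" if "w \<in> W" for w
    using n0[OF W(3)[OF that]] by (auto simp: ni_def nj_def nk_def)
  have sn: "smooth_on W ni" "smooth_on W nj" "smooth_on W nk"
    unfolding ni_def nj_def nk_def using smooth_conic_flow[OF oW W(3) Dn]
    by (auto intro!: smooth_on_diff smooth_on_minus oW)
  have s\<alpha>: "smooth_on W \<alpha>i" "smooth_on W \<alpha>j" "smooth_on W \<alpha>k"
    unfolding \<alpha>i_def \<alpha>j_def \<alpha>k_def
    by (intro smooth_on_add smooth_on_mult smooth_on_diff smooth_on_const smooth_on_fst_nth oW)+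
  have D\<alpha>: "hasdd \<alpha>i (e l, 0) w (if l = i then \<epsilon> / mi else 0)" "hasdd \<alpha>j (e l, 0) w (if l = j then \<epsilon> / mj else 0)"
    "hasdd \<alpha>k (e l, 0) w (if l = k then \<epsilon> / mk else 0)" for l w
    unfolding \<alpha>i_def \<alpha>j_def \<alpha>k_def
    by (rule hasdd_eq_rhs[OF hasdd_add[OF hasdd_const hasdd_cmult[OF hasdd_diff[OF hasdd_fst[OF hasdd_nth] hasdd_const]]]], simp)+
  have D\<alpha>p: "hasdd \<alpha>i (0, 1) w 0" "hasdd \<alpha>j (0, 1) w 0" "hasdd \<alpha>k (0, 1) w 0" for w
    unfolding \<alpha>i_def \<alpha>j_def \<alpha>k_def by (rule hasdd_fst_snd[of "\<lambda>u. _ + _ * (u $ _ - _)"])+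
  have Dnu: "hasdd ni (e l, 0) w 0" "hasdd nj (e l, 0) w 0" "hasdd nk (e l, 0) w 0" for l w
    by (simp_all add: hasdd_def ni_def nj_def nk_def)
  have Dnp: "hasdd ni (0, 1) w (K * ni w * (nk w - nj w))" "hasdd nj (0, 1) w (K * nj w * (ni w - nk w))"
    "hasdd nk (0, 1) w (K * nk w * (nj w - ni w))" if "w \<in> W" for w
  proof -
    have 1: "hasdd (\<lambda>w. n1 (snd w)) (0, 1) w (- K * n1 (snd w) * (n1 (snd w) + 2 * n2 (snd w)))"
      "hasdd (\<lambda>w. n2 (snd w)) (0, 1) w (K * n2 (snd w) * (2 * n1 (snd w) + n2 (snd w)))"
      using hasdd_snd_fun(1)[OF Dn(1)[OF W(3)[OF that]]] hasdd_snd_fun(1)[OF Dn(2)[OF W(3)[OF that]]] by auto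
    show "hasdd ni (0, 1) w (K * ni w * (nk w - nj w))" "hasdd nj (0, 1) w (K * nj w * (ni w - nk w))"
      using 1 by (simp_all add: ni_def[abs_def] nj_def[abs_def] nk_def algebra_simps)
    show "hasdd nk (0, 1) w (K * nk w * (nj w - ni w))"
      unfolding nk_def[abs_def]
      by (rule hasdd_eq_rhs[OF hasdd_diff[OF hasdd_minus[OF 1(1)] 1(2)]])
        (simp add: ni_def nj_def nk_def algebra_simps)
  qed
  \<comment> \<open>The constants must absorb the \<eta>'s in the three rows. Normalising the one
    for i to 0, rows j and k fix the other two, and row i then holds because the \<eta>'s sum to
    zero.\<close>
  define \<kappa>j \<kappa>k where "\<kappa>j = \<eta>k / (mi * mk)" and "\<kappa>k = - \<eta>j / (mi * mj)"
  have \<kappa>: "mi * (mk * \<kappa>j - mj * \<kappa>k) = - \<eta>i" "mj * (mi * \<kappa>k - mk * 0) = - \<eta>j" "mk * (mj * 0 - mi * \<kappa>j) = - \<eta>k"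
  proof -
    have "mi * (mk * \<kappa>j) = \<eta>k" "mi * (mj * \<kappa>k) = - \<eta>j"
      using m0 by (simp_all add: \<kappa>j_def \<kappa>k_def)
    then show "mi * (mk * \<kappa>j - mj * \<kappa>k) = - \<eta>i" "mj * (mi * \<kappa>k - mk * 0) = - \<eta>j" "mk * (mj * 0 - mi * \<kappa>j) = - \<eta>k"
      using \<eta> by (simp_all add: algebra_simps)
  qed
  define ai aj ak where "ai w = \<alpha>i w * mi / ni w" and "aj w = \<alpha>j w * mj / nj w" and "ak w = \<alpha>k w * mk / nk w" for w
  define bi bj bk where "bi w = - (s * mi / (2 * mk * mj)) * ((nk w - nj w) / ni w) * (\<alpha>i w)\<^sup>2 + 0"
    and "bj w = - (s * mj / (2 * mi * mk)) * ((ni w - nk w) / nj w) * (\<alpha>j w)\<^sup>2 + \<kappa>j"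
    and "bk w = - (s * mk / (2 * mi * mj)) * ((nj w - ni w) / nk w) * (\<alpha>k w)\<^sup>2 + \<kappa>k" for w
  have prim: "\<exists>G. smooth_on W G \<and> (\<forall>w\<in>W. hasdd G (e l, 0) w (\<alpha> w * m / n w) \<and> hasdd G (0, 1) w (b w)
      \<and> (\<forall>l'. l' \<noteq> l \<longrightarrow> hasdd G (e l', 0) w 0))"
    if m: "m \<noteq> 0" "m' \<noteq> 0" "m'' \<noteq> 0" and mm: "m * m' * m'' = mi * mj * mk"
      and n: "\<And>w. w \<in> W \<Longrightarrow> n w \<noteq> 0" and sm: "smooth_on W n" "smooth_on W \<alpha>" "smooth_on W b"
      and Dn: "\<And>l w. hasdd n (e l, 0) w 0" "\<And>w. w \<in> W \<Longrightarrow> hasdd n (0, 1) w (K * n w * (n' w - n'' w))"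
      and D: "\<And>l' w. hasdd \<alpha> (e l', 0) w (if l' = l then \<epsilon> / m else 0)" "\<And>w. hasdd \<alpha> (0, 1) w 0"
      and \<alpha>: "\<And>w. \<alpha> w = g + \<epsilon> / m * (fst w $ l - c $ l)"
      and b: "\<And>w. b w = - (s * m / (2 * m' * m'')) * ((n' w - n'' w) / n w) * (\<alpha> w)\<^sup>2 + \<kappa>"
      and \<epsilon>: "\<epsilon> \<noteq> 0"
    for l m m' m'' n n' n'' \<alpha> b g \<kappa>
  proof (intro exI conjI ballI allI impI)
    \<comment> \<open>Integrating a_l in u_l divides by the slope \<open>\<epsilon> / m\<close> of
      the affine factor, hence the restriction to nonzero \<epsilon>.\<close>
    define G where "G w = m * m / (2 * \<epsilon>) * ((\<alpha> w)\<^sup>2 / n w) + \<kappa> * snd w" for w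
    show "smooth_on W G"
      unfolding G_def power2_eq_square
      by (intro smooth_on_add smooth_on_mult smooth_on_divide smooth_on_const smooth_on_snd sm oW n)
    fix w assume w: "w \<in> W"
    have DG: "hasdd G v w (m * m / (2 * \<epsilon>) * ((2 * \<alpha> w * D' * n w - (\<alpha> w)\<^sup>2 * N) / (n w * n w)) + \<kappa> * P)"
      if "hasdd \<alpha> v w D'" "hasdd n v w N" "hasdd snd v w P" for v D' N P
      unfolding G_def
      by (intro hasdd_add hasdd_cmult hasdd_divide hasdd_power2 that n w)
    show "hasdd G (e l, 0) w (\<alpha> w * m / n w)"
      by (rule hasdd_eq_rhs[OF DG[OF D(1) Dn(1) hasdd_snd(2)]]) (use m n[OF w] \<epsilon> in \<open>simp add: field_simps\<close>)
    show "hasdd G (0, 1) w (b w)"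
    proof (rule hasdd_eq_rhs[OF DG[OF D(2) Dn(2)[OF w] hasdd_snd(1)]])
      have K: "K = s * \<epsilon> / (m * m' * m'')" by (simp add: K_def mm)
      show "m * m / (2 * \<epsilon>) * ((2 * \<alpha> w * 0 * n w - (\<alpha> w)\<^sup>2 * (K * n w * (n' w - n'' w))) / (n w * n w)) + \<kappa> * 1 = b w"
        unfolding b K using m n[OF w] \<epsilon> by (simp add: field_simps)
    qed
    show "hasdd G (e l', 0) w 0" if "l' \<noteq> l" for l'
      by (rule hasdd_eq_rhs[OF DG[OF D(1) Dn(1) hasdd_snd(2)]]) (use that in simp)
  qed
  have prim0: "\<exists>G. smooth_on W G \<and> (\<forall>w\<in>W. hasdd G (e l, 0) w (\<alpha> w * m / n w) \<and> hasdd G (0, 1) w (b w)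
      \<and> (\<forall>l'. l' \<noteq> l \<longrightarrow> hasdd G (e l', 0) w 0))"
    if n: "\<And>w. w \<in> W \<Longrightarrow> n w \<noteq> 0" and sm: "smooth_on W n" "smooth_on W \<alpha>" "smooth_on W b"
      and Dn: "\<And>l w. hasdd n (e l, 0) w 0" "\<And>w. w \<in> W \<Longrightarrow> hasdd n (0, 1) w 0"
      and \<alpha>: "\<And>v w. hasdd \<alpha> v w 0"
      and b: "\<And>l w. w \<in> W \<Longrightarrow> hasdd b (e l, 0) w 0" "\<And>w. w \<in> W \<Longrightarrow> hasdd b (0, 1) w 0"
    for l m n \<alpha> b
  proof (intro exI conjI ballI allI impI)
    \<comment> \<open>If \<epsilon> = 0 then K = 0 as well, all coefficients have zero partials, and
      a primitive linear in u_l and p suffices.\<close>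
    define G where "G w = m * (\<alpha> w / n w) * (fst w $ l) + b w * snd w" for w
    show "smooth_on W G"
      unfolding G_def
      by (intro smooth_on_add smooth_on_mult smooth_on_divide smooth_on_const smooth_on_snd smooth_on_fst_nth sm oW n)
    fix w assume w: "w \<in> W"
    have DG: "hasdd G v w (m * ((0 * n w - \<alpha> w * 0) / (n w * n w)) * fst w $ l + m * (\<alpha> w / n w) * L
        + (0 * snd w + b w * P))"
      if "hasdd n v w 0" "hasdd b v w 0" "hasdd (\<lambda>w. fst w $ l) v w L" "hasdd snd v w P" for v L P
      unfolding G_def
      by (intro hasdd_add hasdd_mult[OF hasdd_cmult] hasdd_mult hasdd_divide that n w \<alpha>)
    show "hasdd G (e l, 0) w (\<alpha> w * m / n w)"
      by (rule hasdd_eq_rhs[OF DG[OF Dn(1) b(1)[OF w] hasdd_fst[OF hasdd_nth] hasdd_snd(2)]]) simp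
    show "hasdd G (0, 1) w (b w)"
      by (rule hasdd_eq_rhs[OF DG[OF Dn(2)[OF w] b(2)[OF w] hasdd_fst_snd hasdd_snd(1)]]) simp
    show "hasdd G (e l', 0) w 0" if "l' \<noteq> l" for l'
      by (rule hasdd_eq_rhs[OF DG[OF Dn(1) b(1)[OF w] hasdd_fst[OF hasdd_nth] hasdd_snd(2)]]) (use that in simp)
  qed
  have sb: "smooth_on W bi" "smooth_on W bj" "smooth_on W bk"
    unfolding bi_def bj_def bk_def power2_eq_square
    by (intro smooth_on_add smooth_on_mult smooth_on_divide smooth_on_diff smooth_on_const sn s\<alpha> oW nn; assumption)+
  have "(\<exists>G. smooth_on W G \<and> (\<forall>w\<in>W. hasdd G (e i, 0) w (ai w) \<and> hasdd G (0, 1) w (bi w)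
      \<and> (\<forall>l'. l' \<noteq> i \<longrightarrow> hasdd G (e l', 0) w 0)))
    \<and> (\<exists>G. smooth_on W G \<and> (\<forall>w\<in>W. hasdd G (e j, 0) w (aj w) \<and> hasdd G (0, 1) w (bj w)
      \<and> (\<forall>l'. l' \<noteq> j \<longrightarrow> hasdd G (e l', 0) w 0)))
    \<and> (\<exists>G. smooth_on W G \<and> (\<forall>w\<in>W. hasdd G (e k, 0) w (ak w) \<and> hasdd G (0, 1) w (bk w)
      \<and> (\<forall>l'. l' \<noteq> k \<longrightarrow> hasdd G (e l', 0) w 0)))"
  proof (cases "\<epsilon> = 0")
    case False
    show ?thesis
      unfolding ai_def aj_def ak_def
      by (intro conjI
          prim[OF m0(1) m0(3) m0(2) _ nn(1) sn(1) s\<alpha>(1) sb(1) Dnu(1) Dnp(1) D\<alpha>(1) D\<alpha>p(1) \<alpha>i_def bi_def False]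
          prim[OF m0(2) m0(1) m0(3) _ nn(2) sn(2) s\<alpha>(2) sb(2) Dnu(2) Dnp(2) D\<alpha>(2) D\<alpha>p(2) \<alpha>j_def bj_def False]
          prim[OF m0(3) m0(1) m0(2) _ nn(3) sn(3) s\<alpha>(3) sb(3) Dnu(3) Dnp(3) D\<alpha>(3) D\<alpha>p(3) \<alpha>k_def bk_def False])
        simp_all
  next
    case True
    then have K: "K = 0" by (simp add: K_def)
    have \<alpha>0: "hasdd \<alpha>i v w 0" "hasdd \<alpha>j v w 0" "hasdd \<alpha>k v w 0" for v w
      using True by (simp_all add: \<alpha>i_def[abs_def] \<alpha>j_def[abs_def] \<alpha>k_def[abs_def] hasdd_const)
    have Dn0: "hasdd ni (0, 1) w 0" "hasdd nj (0, 1) w 0" "hasdd nk (0, 1) w 0" if "w \<in> W" for w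
      using Dnp[OF that] K by simp_all
    have Db0: "hasdd (\<lambda>w. q * ((f w - g w) / h w) * (\<alpha> w)\<^sup>2 + \<kappa>) v w 0"
      if "hasdd f v w 0" "hasdd g v w 0" "hasdd h v w 0" "h w \<noteq> 0" "hasdd \<alpha> v w 0" for q f g h \<alpha> \<kappa> v w
      by (rule hasdd_eq_rhs[OF hasdd_add[OF hasdd_mult[OF hasdd_cmult[OF hasdd_divide[OF hasdd_diff[OF that(1,2)] that(3,4)]]
          hasdd_power2[OF that(5)]] hasdd_const]]) simp
    have Db: "hasdd bi v w 0" "hasdd bj v w 0" "hasdd bk v w 0"
      if "w \<in> W" "hasdd ni v w 0" "hasdd nj v w 0" "hasdd nk v w 0" for v w
      unfolding bi_def bj_def bk_def by (rule Db0 that \<alpha>0 nn)+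
    show ?thesis
      unfolding ai_def aj_def ak_def
      by (intro conjI
          prim0[OF nn(1) sn(1) s\<alpha>(1) sb(1) Dnu(1) Dn0(1) \<alpha>0(1) Db(1)[OF _ Dnu] Db(1)[OF _ Dn0]]
          prim0[OF nn(2) sn(2) s\<alpha>(2) sb(2) Dnu(2) Dn0(2) \<alpha>0(2) Db(2)[OF _ Dnu] Db(2)[OF _ Dn0]]
          prim0[OF nn(3) sn(3) s\<alpha>(3) sb(3) Dnu(3) Dn0(3) \<alpha>0(3) Db(3)[OF _ Dnu] Db(3)[OF _ Dn0]])
  qed
  then obtain Gi Gj Gk where G: "smooth_on W Gi" "smooth_on W Gj" "smooth_on W Gk"
    "\<forall>w\<in>W. hasdd Gi (e i, 0) w (ai w) \<and> hasdd Gi (0, 1) w (bi w) \<and> (\<forall>l'. l' \<noteq> i \<longrightarrow> hasdd Gi (e l', 0) w 0)"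
    "\<forall>w\<in>W. hasdd Gj (e j, 0) w (aj w) \<and> hasdd Gj (0, 1) w (bj w) \<and> (\<forall>l'. l' \<noteq> j \<longrightarrow> hasdd Gj (e l', 0) w 0)"
    "\<forall>w\<in>W. hasdd Gk (e k, 0) w (ak w) \<and> hasdd Gk (0, 1) w (bk w) \<and> (\<forall>l'. l' \<noteq> k \<longrightarrow> hasdd Gk (e l', 0) w 0)"
    by blast
  have xyz: "x (fst w) = s * \<alpha>i w * \<alpha>j w" "y (fst w) = s * \<alpha>i w * \<alpha>k w" "z (fst w) = s * \<alpha>j w * \<alpha>k w"
    "mi * A (fst w) = s / 2 * (mj * (\<alpha>j w)\<^sup>2 + mk * (\<alpha>k w)\<^sup>2) + \<eta>i"
    "mj * B (fst w) = s / 2 * (mk * (\<alpha>k w)\<^sup>2 + mi * (\<alpha>i w)\<^sup>2) + \<eta>j"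
    "mk * C (fst w) = s / 2 * (mi * (\<alpha>i w)\<^sup>2 + mj * (\<alpha>j w)\<^sup>2) + \<eta>k" if "w \<in> W" for w
    using F[THEN bspec, OF W(1)[OF that]] by (simp_all add: \<alpha>i_def \<alpha>j_def \<alpha>k_def)
  show ?thesis
  proof (rule lax_pair_separated[OF oW _ _ G(1-3), of ai bi aj bj ak bk])
    show "W \<noteq> {}" "W \<subseteq> U \<times> UNIV"
      using \<delta> center_in_cube[OF r, of c] c unfolding W_def by auto
    fix w assume w: "w \<in> W"
    note n = nn[OF w]
    have sum: "nk w = - ni w - nj w" "ni w = - nj w - nk w" "nj w = - nk w - ni w"
      by (simp_all add: ni_def nj_def nk_def)
    show "ai w * (mk * bj w - mj * bk w) + ai w * A (fst w) + aj w * x (fst w) + ak w * y (fst w) = 0"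
      unfolding xyz(1,2)[OF w] ai_def aj_def ak_def
      by (rule conic_coefficients[OF m0 n sum(1) xyz(4)[OF w] \<kappa>(1)]) (simp_all add: bj_def bk_def)
    have "aj w * (mi * bk w - mk * bi w) + aj w * B (fst w)
        + \<alpha>k w * mk / nk w * (s * \<alpha>j w * \<alpha>k w) + \<alpha>i w * mi / ni w * (s * \<alpha>j w * \<alpha>i w) = 0"
      unfolding aj_def
      by (rule conic_coefficients[OF m0(2,3,1) n(2,3,1) sum(2) xyz(5)[OF w] \<kappa>(2)])
        (simp_all add: bi_def bk_def mult_ac)
    then show "aj w * (mi * bk w - mk * bi w) + ai w * x (fst w) + aj w * B (fst w) + ak w * z (fst w) = 0"
      unfolding xyz(1,3)[OF w] ai_def ak_def by (simp add: mult_ac add_ac)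
    have "ak w * (mj * bi w - mi * bj w) + ak w * C (fst w)
        + \<alpha>i w * mi / ni w * (s * \<alpha>k w * \<alpha>i w) + \<alpha>j w * mj / nj w * (s * \<alpha>k w * \<alpha>j w) = 0"
      unfolding ak_def
      by (rule conic_coefficients[OF m0(3,1,2) n(3,1,2) sum(3) xyz(6)[OF w] \<kappa>(3)])
        (simp_all add: bi_def bj_def mult_ac)
    then show "ak w * (mj * bi w - mi * bj w) + ai w * y (fst w) + aj w * z (fst w) + ak w * C (fst w) = 0"
      unfolding xyz(2,3)[OF w] ai_def aj_def by (simp add: mult_ac add_ac)
    show "ai w \<noteq> 0"
      using nz(1)[OF W(2)[OF w]] n m0 unfolding xyz(1)[OF w] ai_def by auto
  qed (use G dist in auto)
qed

end

section \<open>Reduction of the theorem to the two cases\<close>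

theorem theorem4:
  fixes lam :: "real^3" and H :: "real^3 \<Rightarrow> real" and U :: "(real^3) set"
  assumes distinct: "lam$1 \<noteq> lam$2" "lam$1 \<noteq> lam$3" "lam$2 \<noteq> lam$3"
    and U: "open U" "U \<noteq> {}"
    and smooth: "smooth_on U H"
    and nz: "\<forall>u\<in>U. Hdd H 1 2 u \<noteq> 0 \<and> Hdd H 1 3 u \<noteq> 0 \<and> Hdd H 2 3 u \<noteq> 0"
    and J0: "\<forall>u\<in>U. JJ lam H u = 0"
    and H123: "\<forall>u\<in>U. Hddd H 1 2 3 u = 0"
    and c1: "\<forall>u\<in>U. dd (e 1) (\<lambda>v. (lam$3 - lam$2) * Hdd H 1 1 v + R2 lam H v + R3 lam H v) u = 0"
    and c2: "\<forall>u\<in>U. dd (e 2) (\<lambda>v. (lam$1 - lam$3) * Hdd H 2 2 v + R1 lam H v + R3 lam H v) u = 0"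
    and c3: "\<forall>u\<in>U. dd (e 3) (\<lambda>v. (lam$2 - lam$1) * Hdd H 3 3 v + R1 lam H v + R2 lam H v) u = 0"
  shows "\<exists>W f g. W \<subseteq> U \<times> UNIV \<and> is_disp_lax_pair lam H W f g"
proof -
  have smd: "smooth_on U (dd (e l) H)" for l by (intro smooth_on_dd smooth e_Basis)
  have smdd: "smooth_on U (Hdd H l m)" for l m unfolding Hdd_def by (intro smooth_on_dd smd e_Basis)
  have sym: "Hdd H l m u = Hdd H m l u" if "u \<in> U" for l m u
    unfolding Hdd_def by (rule dd_commute[OF smooth U(1) that]) auto
  have t12: "dd (e 3) (Hdd H 1 2) u = 0" if "u \<in> U" for u
    using H123 that by (simp add: Hddd_def Hdd_def)
  have t13: "dd (e 2) (Hdd H 1 3) u = 0" if "u \<in> U" for u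
  proof -
    have "dd (e 2) (Hdd H 1 3) u = dd (e 3) (Hdd H 1 2) u"
      unfolding Hdd_def by (rule dd_commute[OF smd U(1) that]) auto
    then show ?thesis using t12[OF that] by simp
  qed
  have t23: "dd (e 1) (Hdd H 2 3) u = 0" if "u \<in> U" for u
  proof -
    have "dd (e 1) (Hdd H 2 3) u = dd (e 3) (Hdd H 2 1) u"
      unfolding Hdd_def by (rule dd_commute[OF smd U(1) that]) auto
    also have "\<dots> = dd (e 3) (Hdd H 1 2) u"
      by (rule dd_cong[OF U(1) that sym])
    finally show ?thesis using t12[OF that] by simp
  qed
  \<comment> \<open>Each differential condition in the locale is the negative of the given one, as
    lam_3 - lam_2 = - (lam_2 - lam_3) and its cyclic analogues.\<close>
  have neg: "dd v (\<lambda>u. - F u) u = 0" if "dd v F u = 0" "smooth_on U F" "u \<in> U" "v \<in> Basis" for v F u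
    using hasdd_imp_dd[OF hasdd_minus[OF smooth_on_hasdd[OF that(2,4,3)]]] that(1) by simp
  have smR: "smooth_on U (R1 lam H)" "smooth_on U (R2 lam H)" "smooth_on U (R3 lam H)"
    unfolding R1_def R2_def R3_def using nz by (auto intro!: smooth_on_intros smdd U(1))
  have dist: "(1::3) \<noteq> 2" "(2::3) \<noteq> 3" "(3::3) \<noteq> 1" by auto
  interpret h: hydro_system lam H U 1 2 3 "Hdd H 1 1" "Hdd H 2 2" "Hdd H 3 3" "Hdd H 1 2" "Hdd H 1 3" "Hdd H 2 3"
    "lam$2 - lam$3" "lam$3 - lam$1" "lam$1 - lam$2"
  proof
    show "UNIV = {1, 2, 3::3}" by (rule UNIV_3)
    fix u assume u: "u \<in> U"
    show "(lam$2 - lam$3) * Hdd H 1 1 u + (lam$3 - lam$1) * Hdd H 2 2 u + (lam$1 - lam$2) * Hdd H 3 3 u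
      = (lam$2 - lam$3) * (Hdd H 1 2 u * Hdd H 1 3 u / Hdd H 2 3 u)
        + (lam$3 - lam$1) * (Hdd H 1 2 u * Hdd H 2 3 u / Hdd H 1 3 u)
        + (lam$1 - lam$2) * (Hdd H 1 3 u * Hdd H 2 3 u / Hdd H 1 2 u)"
    proof -
      \<comment> \<open>Dividing J = 0 by the product of the three nonzero mixed derivatives gives
        the form of J used in the locale.\<close>
      define p where "p = Hdd H 1 2 u * Hdd H 2 3 u * Hdd H 1 3 u"
      have p: "p \<noteq> 0" using nz u by (simp add: p_def)
      have "JJ lam H u = 0" using J0 u by blast
      then have "p * Delta lam H u = (lam$2 - lam$3) * (Hdd H 1 2 u)\<^sup>2 * (Hdd H 1 3 u)\<^sup>2
              + (lam$3 - lam$1) * (Hdd H 2 3 u)\<^sup>2 * (Hdd H 1 2 u)\<^sup>2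
              + (lam$1 - lam$2) * (Hdd H 1 3 u)\<^sup>2 * (Hdd H 2 3 u)\<^sup>2"
        by (simp add: JJ_def p_def)
      also have "\<dots> = p * ((lam$2 - lam$3) * (Hdd H 1 2 u * Hdd H 1 3 u / Hdd H 2 3 u)
        + (lam$3 - lam$1) * (Hdd H 1 2 u * Hdd H 2 3 u / Hdd H 1 3 u)
        + (lam$1 - lam$2) * (Hdd H 1 3 u * Hdd H 2 3 u / Hdd H 1 2 u))"
        using nz u by (simp add: p_def distrib_left power2_eq_square)
      finally show ?thesis using p by (simp add: Delta_def)
    qed
    have s1: "smooth_on U (\<lambda>v. (lam$3 - lam$2) * Hdd H 1 1 v + R2 lam H v + R3 lam H v)"
      and s2: "smooth_on U (\<lambda>v. (lam$1 - lam$3) * Hdd H 2 2 v + R1 lam H v + R3 lam H v)"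
      and s3: "smooth_on U (\<lambda>v. (lam$2 - lam$1) * Hdd H 3 3 v + R1 lam H v + R2 lam H v)"
      by (intro smooth_on_add smooth_on_mult smooth_on_const smdd smR U(1))+
    show "dd (e 1) (\<lambda>u. (lam$2 - lam$3) * Hdd H 1 1 u - (lam$3 - lam$1) * (Hdd H 1 2 u * Hdd H 2 3 u / Hdd H 1 3 u)
        - (lam$1 - lam$2) * (Hdd H 1 3 u * Hdd H 2 3 u / Hdd H 1 2 u)) u = 0"
      using neg[OF _ s1 u, of "e 1"] c1 u by (simp add: R2_def R3_def algebra_simps)
    show "dd (e 2) (\<lambda>u. (lam$3 - lam$1) * Hdd H 2 2 u - (lam$1 - lam$2) * (Hdd H 1 3 u * Hdd H 2 3 u / Hdd H 1 2 u)
        - (lam$2 - lam$3) * (Hdd H 1 2 u * Hdd H 1 3 u / Hdd H 2 3 u)) u = 0"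
      using neg[OF _ s2 u, of "e 2"] c2 u by (simp add: R1_def R3_def algebra_simps)
    show "dd (e 3) (\<lambda>u. (lam$1 - lam$2) * Hdd H 3 3 u - (lam$2 - lam$3) * (Hdd H 1 2 u * Hdd H 1 3 u / Hdd H 2 3 u)
        - (lam$3 - lam$1) * (Hdd H 1 2 u * Hdd H 2 3 u / Hdd H 1 3 u)) u = 0"
      using neg[OF _ s3 u, of "e 3"] c3 u by (simp add: R1_def R2_def algebra_simps)
  qed (use dist distinct U(1) smooth sym nz t12 t13 t23 in auto)
  show ?thesis
  \<comment> \<open>The locale predicate itself serves as the case condition: given
    \<open>h\<close>, its failure provides a point where one of the three proportionalities breaks
    down.\<close>
  proof (cases "degenerate_hydro_system lam H U 1 2 3 (Hdd H 1 1) (Hdd H 2 2) (Hdd H 3 3) (Hdd H 1 2) (Hdd H 1 3) (Hdd H 2 3)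
      (lam$2 - lam$3) (lam$3 - lam$1) (lam$1 - lam$2)")
    case True
    show ?thesis by (rule degenerate_hydro_system.degenerate_case[OF True U(2)])
  next
    case False
    then obtain b where b: "b \<in> U" and "dd (e 1) (Hdd H 1 2) b * Hdd H 1 3 b \<noteq> Hdd H 1 2 b * dd (e 1) (Hdd H 1 3) b
      \<or> dd (e 2) (Hdd H 1 2) b * Hdd H 2 3 b \<noteq> Hdd H 1 2 b * dd (e 2) (Hdd H 2 3) b
      \<or> dd (e 3) (Hdd H 1 3) b * Hdd H 2 3 b \<noteq> Hdd H 1 3 b * dd (e 3) (Hdd H 2 3) b"
      using h.hydro_system_axioms by (auto simp: degenerate_hydro_system_def degenerate_hydro_system_axioms_def)
    \<comment> \<open>The factors are reordered so that each alternative is literally the hypothesis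
      of \<open>nondegenerate_case\<close> for one cyclic relabelling.\<close>
    then consider "dd (e 1) (Hdd H 1 3) b * Hdd H 1 2 b \<noteq> Hdd H 1 3 b * dd (e 1) (Hdd H 1 2) b"
      | "dd (e 2) (Hdd H 1 2) b * Hdd H 2 3 b \<noteq> Hdd H 1 2 b * dd (e 2) (Hdd H 2 3) b"
      | "dd (e 3) (Hdd H 2 3) b * Hdd H 1 3 b \<noteq> Hdd H 2 3 b * dd (e 3) (Hdd H 1 3) b"
      by (metis mult.commute)
    then show ?thesis
    proof cases
      case 1
      show ?thesis by (rule hydro_system.nondegenerate_case[OF h.cyc2 b 1])
    next
      case 2
      show ?thesis by (rule h.nondegenerate_case[OF b 2])
    next
      case 3
      show ?thesis by (rule hydro_system.nondegenerate_case[OF h.cyc b 3])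
    qed
  qed
qed

end
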